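(* Let $k,d\in\mathbb{N}$, let $U\subseteq F^d$ be open and let $\mu$ be a $k$-friendly measure on $U$. Then there exists $\varepsilon_0=\varepsilon_0(d,\mu)>0$ such that $\mu(DI(k,\varepsilon))=0$ for every $0<\varepsilon<\varepsilon_0$. In particular, the set of $k$-singular vectors is $\mu$-null.
   Context: Let $q$ be a prime power, $\Lambda=\mathbb{F}_q[T]$, $F=\mathbb{F}_q((T^{-1}))$, with $|a|=e^{\deg a}$ for nonzero $a\in F$ ($\deg$ = exponent of the leading term) and $|0|=0$; $F^d$ carries the sup norm $\|\mathbf{x}\|=\max_i|x_i|$. Let $N=\binom{k+d}{d}-1$, the number of nonconstant monomials in $d$ variables of total degree $\leq k$. For $P\in\Lambda[X_1,\dots,X_d]$, $\widetilde{\operatorname{H}}(P)$ is the maximum absolute value of the coefficients of the nonconstant monomials of $P$. For $0<\varepsilon\leq\frac1e$, $\mathbf{x}\in F^d$ is $(k,\varepsilon)$-Dirichlet improvable if there is $m_0\in\mathbb{N}$ such that for every $m\geq m_0$ there is a nonzero $P\in\Lambda[X_1,\dots,X_d]$ of total degree $\leq k$ with $|P(\mathbf{x})|<\varepsilon e^{-mN}$ and $\widetilde{\operatorname{H}}(P)<\varepsilon e^m$; $DI(k,\varepsilon)$ is the set of such $\mathbf{x}$. $\mathbf{x}$ is $k$-singular if it is $(k,\varepsilon)$-Dirichlet improvable for every $0<\varepsilon\leq\frac1e$. For a ball $B=B(\mathbf{x};r)$, $3B=B(\mathbf{x};3r)$. Let $\mu$ be a Radon measure on $F^d$ with $\mu(U)>0$.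 $\mu$ is Federer on $U$ if there is $D>0$ such that $\mu(3B)/\mu(B)\leq D$ for every ball $B$ centered in $\operatorname{supp}\mu$ with $3B\subseteq U$. For continuous $f:U\to F$ and $B\subseteq U$, $\|f\|_{\mu,B}=\sup_{\mathbf{x}\in B\cap\operatorname{supp}\mu}|f(\mathbf{x})|$; $f$ is $(C,\alpha)$-good on $U$ w.r.t. $\mu$ if for every ball $B\subseteq U$ centered in $\operatorname{supp}\mu$ and every $\varepsilon>0$, $\mu(\{\mathbf{x}\in B:|f(\mathbf{x})|<\varepsilon\})\leq C(\varepsilon/\|f\|_{\mu,B})^\alpha\mu(B)$. A map $\mathbf{f}=(f_1,\dots,f_n):U\to F^n$ is $(C,\alpha)$-good w.r.t. $\mu$ if every $F$-linear combination of $1,f_1,\dots,f_n$ is, and is nonplanar w.r.t. $\mu$ if for every ball $B\subseteq U$ centered in $\operatorname{supp}\mu$ the restrictions of $1,f_1,\dots,f_n$ to $B\cap\operatorname{supp}\mu$ are linearly independent over $F$. $\mu$ is $k$-friendly on $U$ if it is Federer on $U$ and the map $\mathbf{f}:U\to F^N$ sending $(x_1,\dots,x_d)$ to the $N$ distinct nonconstant monomials of total degree $\leq k$ in $x_1,\dots,x_d$ is $(C,\alpha)$-good for some $C,\alpha>0$ and nonplanar with respect to $\mu$.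
   Formalization: The formal theorem says that DI(k,ε)∩U and the k-singular vectors in U are μ-null: μ is only assumed friendly on U, so a point mass at 0 outside U would refute μ(DI(k,ε))=0. The constant ε₀ is chosen for the given k, U and μ. *)

theory Defs
  imports
    "HOL-Analysis.Analysis"
    "HOL-Computational_Algebra.Formal_Laurent_Series"
    "HOL-Library.Poly_Mapping"
begin

text \<open>
  For a finite field \<open>'a\<close> (the field with \<open>q\<close> elements), \<open>F\<close> is the type \<open>'a fls\<close>, read as Laurent
  series in \<open>T\<^sup>-\<^sup>1\<close>: \<open>fls_X\<close> plays the role of \<open>T\<^sup>-\<^sup>1\<close> and \<open>fls_X_inv\<close> that of \<open>T\<close>, so
  that the degree in \<open>T\<close> is minus the subdegree. \<open>F^d\<close> is \<open>'a fls ^ 'd\<close>. The library metric on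
  \<open>'a fls\<close> uses base 2 instead of \<open>e\<close>; it is used here only for the topology (open sets, compact
  sets, Borel sets), while absolute values, norms and balls are the ones defined below.
\<close>

definition fls_abs :: "'a::zero fls \<Rightarrow> real" where
  "fls_abs a = (if a = 0 then 0 else exp (- real_of_int (fls_subdegree a)))"

definition sup_norm :: "'a::zero fls ^ 'd::finite \<Rightarrow> real" where
  "sup_norm x = Max (range (\<lambda>i. fls_abs (x $ i)))"

definition fball :: "'a::field fls ^ 'd::finite \<Rightarrow> real \<Rightarrow> ('a fls ^ 'd) set" where
  "fball x r = {y. sup_norm (y - x) < r}"


subsection \<open>Polynomials over \<open>\<Lambda>\<close>\<close>

text \<open>\<open>\<Lambda>\<close> is \<open>'a poly\<close>; its embedding into \<open>F\<close> sends the indeterminate to \<open>T\<close>.\<close>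

definition of_Lambda :: "'a::field poly \<Rightarrow> 'a fls" where
  "of_Lambda p = poly (map_poly fls_const p) fls_X_inv"

text \<open>Monomials in the variables \<open>X\<^sub>i\<close>, \<open>i :: 'd\<close>, are represented by their exponent vectors.\<close>

type_synonym 'd monomial = "'d \<Rightarrow>\<^sub>0 nat"

type_synonym ('a, 'd) Lambda_mpoly = "'d monomial \<Rightarrow>\<^sub>0 'a poly"

definition monomial_degree :: "'d::finite monomial \<Rightarrow> nat" where
  "monomial_degree \<alpha> = (\<Sum>i\<in>UNIV. Poly_Mapping.lookup \<alpha> i)"

definition monomial_value :: "'d::finite monomial \<Rightarrow> 'a::field fls ^ 'd \<Rightarrow> 'a fls" where
  "monomial_value \<alpha> x = (\<Prod>i\<in>UNIV. (x $ i) ^ Poly_Mapping.lookup \<alpha> i)"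

definition nonconstant_monomials :: "nat \<Rightarrow> 'd::finite monomial set" where
  "nonconstant_monomials k = {\<alpha>. \<alpha> \<noteq> 0 \<and> monomial_degree \<alpha> \<le> k}"

definition total_degree :: "('a::field, 'd::finite) Lambda_mpoly \<Rightarrow> nat" where
  "total_degree P = Max (insert 0 (monomial_degree ` Poly_Mapping.keys P))"

definition mpoly_value :: "('a::field, 'd::finite) Lambda_mpoly \<Rightarrow> 'a fls ^ 'd \<Rightarrow> 'a fls" where
  "mpoly_value P x = (\<Sum>\<alpha>\<in>Poly_Mapping.keys P. of_Lambda (Poly_Mapping.lookup P \<alpha>) * monomial_value \<alpha> x)"

text \<open>The height without the constant term; the inserted \<open>0\<close> only matters for constant \<open>P\<close>.\<close>

definition height_nc :: "('a::field, 'd::finite) Lambda_mpoly \<Rightarrow> real" where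
  "height_nc P = Max (insert 0 ((\<lambda>\<alpha>. fls_abs (of_Lambda (Poly_Mapping.lookup P \<alpha>))) ` (Poly_Mapping.keys P - {0})))"


subsection \<open>Dirichlet improvable and singular vectors\<close>

definition num_monomials :: "nat \<Rightarrow> nat \<Rightarrow> nat" where
  "num_monomials k d = ((k + d) choose d) - 1"

text \<open>The notion is meant for \<open>0 < \<epsilon> \<le> 1/e\<close>; the formula is used without that restriction. It is
  monotone in \<open>\<epsilon>\<close>, so statements about all sufficiently small \<open>\<epsilon>\<close> are not affected.\<close>

definition dirichlet_improvable :: "nat \<Rightarrow> real \<Rightarrow> 'a::field fls ^ 'd::finite \<Rightarrow> bool" where
  "dirichlet_improvable k \<epsilon> x \<longleftrightarrow>
    (\<exists>m0::nat. \<forall>m\<ge>m0. \<exists>P :: ('a, 'd) Lambda_mpoly.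
       P \<noteq> 0 \<and> total_degree P \<le> k \<and>
       fls_abs (mpoly_value P x) < \<epsilon> * exp (- (real m * real (num_monomials k CARD('d)))) \<and>
       height_nc P < \<epsilon> * exp (real m))"

definition DI :: "nat \<Rightarrow> real \<Rightarrow> ('a::field fls ^ 'd::finite) set" where
  "DI k \<epsilon> = {x. dirichlet_improvable k \<epsilon> x}"

definition singular_vector :: "nat \<Rightarrow> 'a::field fls ^ 'd::finite \<Rightarrow> bool" where
  "singular_vector k x \<longleftrightarrow> (\<forall>\<epsilon>. 0 < \<epsilon> \<and> \<epsilon> \<le> 1 / exp 1 \<longrightarrow> dirichlet_improvable k \<epsilon> x)"


subsection \<open>Friendly measures\<close>

definition radon_measure :: "'b::t2_space measure \<Rightarrow> bool" where
  "radon_measure M \<longleftrightarrow>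
     sets M = sets borel \<and>
     (\<forall>K. compact K \<longrightarrow> emeasure M K < \<infinity>) \<and>
     (\<forall>A\<in>sets borel. emeasure M A = (INF V\<in>{V. open V \<and> A \<subseteq> V}. emeasure M V)) \<and>
     (\<forall>V. open V \<longrightarrow>
        emeasure M V = (SUP K\<in>{K. compact K \<and> K \<subseteq> V}. emeasure M K))"

definition msupport :: "'b::t2_space measure \<Rightarrow> 'b set" where
  "msupport M = {x. \<forall>V. open V \<and> x \<in> V \<longrightarrow> emeasure M V > 0}"

definition federer_on :: "('a::field fls ^ 'd::finite) set \<Rightarrow> ('a fls ^ 'd) measure \<Rightarrow> bool" where
  "federer_on U M \<longleftrightarrow>
     (\<exists>D>0. \<forall>x\<in>msupport M. \<forall>r>0. fball x (3 * r) \<subseteq> U \<longrightarrow>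
        measure M (fball x (3 * r)) / measure M (fball x r) \<le> D)"

definition sup_on_supp ::
  "('a::field fls ^ 'd::finite) measure \<Rightarrow> ('a fls ^ 'd) set \<Rightarrow> ('a fls ^ 'd \<Rightarrow> 'a fls) \<Rightarrow> real" where
  "sup_on_supp M B f = (SUP x\<in>B \<inter> msupport M. fls_abs (f x))"

text \<open>
  If \<open>f\<close> vanishes on \<open>B \<inter> msupport M\<close>, then \<open>\<epsilon> / \<parallel>f\<parallel>\<close> is infinite and the inequality is void. The guard
  below expresses this, since Isabelle's convention is \<open>\<epsilon> / 0 = 0\<close>.
\<close>

definition good_fun ::
  "real \<Rightarrow> real \<Rightarrow> ('a::field fls ^ 'd::finite) set \<Rightarrow> ('a fls ^ 'd) measure \<Rightarrow>
   ('a fls ^ 'd \<Rightarrow> 'a fls) \<Rightarrow> bool" where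
  "good_fun C a U M f \<longleftrightarrow>
     (\<forall>x\<in>msupport M. \<forall>r>0. \<forall>\<epsilon>>0. fball x r \<subseteq> U \<longrightarrow> sup_on_supp M (fball x r) f > 0 \<longrightarrow>
        measure M {y \<in> fball x r. fls_abs (f y) < \<epsilon>}
          \<le> C * (\<epsilon> / sup_on_supp M (fball x r) f) powr a * measure M (fball x r))"

text \<open>In the next two definitions a map into \<open>F^n\<close> is given by its components, indexed by a
  finite set \<open>I\<close> with \<open>n\<close> elements.\<close>

definition good_map ::
  "real \<Rightarrow> real \<Rightarrow> ('a::field fls ^ 'd::finite) set \<Rightarrow> ('a fls ^ 'd) measure \<Rightarrow>
   'i set \<Rightarrow> ('i \<Rightarrow> 'a fls ^ 'd \<Rightarrow> 'a fls) \<Rightarrow> bool" where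
  "good_map C a U M I f \<longleftrightarrow>
     (\<forall>c0 c. good_fun C a U M (\<lambda>x. c0 + (\<Sum>i\<in>I. c i * f i x)))"

definition nonplanar ::
  "('a::field fls ^ 'd::finite) set \<Rightarrow> ('a fls ^ 'd) measure \<Rightarrow>
   'i set \<Rightarrow> ('i \<Rightarrow> 'a fls ^ 'd \<Rightarrow> 'a fls) \<Rightarrow> bool" where
  "nonplanar U M I f \<longleftrightarrow>
     (\<forall>x\<in>msupport M. \<forall>r>0. fball x r \<subseteq> U \<longrightarrow>
        (\<forall>c0 c. (\<forall>y\<in>fball x r \<inter> msupport M. c0 + (\<Sum>i\<in>I. c i * f i y) = 0) \<longrightarrow>
           c0 = 0 \<and> (\<forall>i\<in>I. c i = 0)))"

definition friendly_on ::
  "nat \<Rightarrow> ('a::field fls ^ 'd::finite) set \<Rightarrow> ('a fls ^ 'd) measure \<Rightarrow> bool" where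
  "friendly_on k U M \<longleftrightarrow>
     federer_on U M \<and>
     (\<exists>C>0. \<exists>a>0. good_map C a U M (nonconstant_monomials k) monomial_value) \<and>
     nonplanar U M (nonconstant_monomials k) monomial_value"

end

theory Submission
  imports Defs "HOL-Library.Function_Algebras"
begin

text \<open>
  A vector \<open>x\<close> is improved at time \<open>m\<close> iff the lattice spanned by the vectors
  \<open>g\<^sub>m u\<^bsub>f(x)\<^esub> v\<close>, \<open>v \<in> \<Lambda>\<^bsup>N+1\<^esup>\<close>, has a nonzero element of norm less than \<open>\<epsilon>\<close>, where \<open>u\<close> replaces the
  constant coefficient of a polynomial by its value at \<open>x\<close> and \<open>g\<^sub>m\<close> is a diagonal flow. The covolume
  of a sublattice is the maximum of finitely many \<open>F\<close>-linear combinations of \<open>1, f\<^sub>1, ..., f\<^sub>N\<close>. It is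
  therefore \<open>(C,\<alpha>)\<close>-good, and by nonplanarity it reaches 1 on any given ball once \<open>m\<close> is large. The
  induction of Kleinbock and Margulis over flags of sublattices then shows that in every ball the
  vectors improved at time \<open>m\<close> form a set of relative measure \<open>O(\<epsilon>\<^sup>\<alpha>)\<close>, with a constant independent of
  the ball. For small \<open>\<epsilon>\<close> this is at most 1/2 in all balls, so the set of improvable vectors is null.
\<close>

section \<open>Absolute value and balls\<close>

unbundle fps_syntax

text \<open>Two dependences must be kept apart. The time from which every covolume reaches 1 depends
  on the ball; this is harmless because an improvable vector is improved at all large times. The
  proportion of exceptional points must not depend on the ball: it involves only the Federer
  constant, \<open>C\<close>, \<open>a\<close> and the number of ranks, and these determine the
  threshold for \<epsilon>. Uniformity over the infinitely many sublattices comes from integrality: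
  a nonzero minor of a matrix over \<Lambda> has absolute value at least 1, and in rank below N + 1
  the flow multiplies a suitable coefficient by at least \<open>exp m\<close>. In full rank there is
  no growth, but there determinant one keeps the covolume at least 1. Balls are taken at integer
  levels, where each ball has a unique parent one level up. The Federer condition then compares a
  ball with its parent, and the induction pays this factor once per rank. The field may have
  characteristic 2, so that a wedge product with a repeated factor needs an argument beyond
  antisymmetry.\<close>

lemma fls_abs_0 [simp]: "fls_abs 0 = 0"
  by (simp add: fls_abs_def)

lemma fls_abs_nonneg [simp]: "fls_abs a \<ge> 0"
  by (simp add: fls_abs_def)

lemma fls_abs_eq_0_iff [simp]: "fls_abs a = 0 \<longleftrightarrow> a = 0"
  by (simp add: fls_abs_def)

lemma fls_abs_1 [simp]: "fls_abs (1 :: 'a::field fls) = 1"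
  by (simp add: fls_abs_def)

lemma fls_abs_mult: "fls_abs (a * b) = fls_abs a * fls_abs (b :: 'a::field fls)"
  by (simp add: fls_abs_def exp_add[symmetric])

lemma fls_abs_minus [simp]: "fls_abs (- a) = fls_abs (a :: 'a::field fls)"
  by (simp add: fls_abs_def)

lemma fls_abs_power: "fls_abs (a ^ n) = fls_abs (a :: 'a::field fls) ^ n"
  by (induction n) (simp_all add: fls_abs_mult)

lemma fls_abs_le_exp_iff:
  "fls_abs a \<le> exp (real_of_int j) \<longleftrightarrow> (\<forall>n < - j. a $$ n = 0)"
proof (cases "a = 0")
  case False
  then have "fls_abs a \<le> exp (real_of_int j) \<longleftrightarrow> - j \<le> fls_subdegree a"
    by (simp add: fls_abs_def) linarith
  also have "\<dots> \<longleftrightarrow> (\<forall>n < - j. a $$ n = 0)"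
    using False by (meson fls_eq0_below_subdegree fls_subdegree_geI order_less_le_trans)
  finally show ?thesis .
qed simp

lemma fls_abs_exp_cases:
  assumes "a \<noteq> 0"
  obtains j where "fls_abs a = exp (real_of_int j)"
  using assms by (metis fls_abs_def of_int_minus)

text \<open>Absolute values are discrete: they are 0 or \<open>exp\<close> of an integer. Being
  below \<open>r\<close> therefore amounts to a bound by the largest such power strictly below
  \<open>r\<close>, and open balls are closed balls.\<close>

lemma fls_abs_less_iff_le_exp:
  assumes "exp (real_of_int j) < r" "r \<le> exp (real_of_int (j + 1))"
  shows "fls_abs a < r \<longleftrightarrow> fls_abs a \<le> exp (real_of_int j)"
proof (cases "a = 0")
  case True
  moreover have "0 < exp (real_of_int j)" by simp
  ultimately have "0 < r" using assms(1) by linarith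
  then show ?thesis using True by simp
next
  case False
  then obtain i where i: "fls_abs a = exp (real_of_int i)" by (rule fls_abs_exp_cases)
  show ?thesis
  proof
    assume "fls_abs a < r"
    then have "exp (real_of_int i) < exp (real_of_int (j + 1))" using assms i by linarith
    then have "i < j + 1" by (simp only: exp_less_cancel_iff of_int_less_iff)
    then have "i \<le> j" by simp
    then show "fls_abs a \<le> exp (real_of_int j)" using i by simp
  qed (use assms in linarith)
qed

lemma fls_abs_add_le:
  fixes a b :: "'a::field fls"
  assumes "fls_abs a \<le> r" "fls_abs b \<le> r"
  shows "fls_abs (a + b) \<le> r"
proof (cases "a + b = 0 \<or> a = 0 \<or> b = 0")
  case True
  then show ?thesis using assms by (auto intro: order_trans[OF fls_abs_nonneg])
next
  case False
  then have "fls_subdegree (a + b) \<ge> min (fls_subdegree a) (fls_subdegree b)"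
    using fls_plus_subdegree by blast
  then have "fls_abs (a + b) \<le> max (fls_abs a) (fls_abs b)"
    using False by (simp add: fls_abs_def le_max_iff_disj min_le_iff_disj)
  then show ?thesis using assms by linarith
qed

lemma fls_abs_sum_le:
  fixes f :: "'i \<Rightarrow> 'a::field fls"
  assumes "0 \<le> r" "\<And>i. i \<in> A \<Longrightarrow> fls_abs (f i) \<le> r"
  shows "fls_abs (sum f A) \<le> r"
  using assms(2) by (induction A rule: infinite_finite_induct) (auto simp: assms(1) intro: fls_abs_add_le)

section \<open>Balls of integer level and their topology\<close>

definition cb :: "'a::field fls ^ 'd::finite \<Rightarrow> int \<Rightarrow> ('a fls ^ 'd) set" where
  "cb x j = {y. \<forall>i. fls_abs (y $ i - x $ i) \<le> exp (real_of_int j)}"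

text \<open>Membership is agreement of all coefficients below \<open>- j\<close>. The ultrametric
  facts that follow, such as every point of a ball being a centre, reduce to this being an
  equivalence relation.\<close>

lemma mem_cb_iff: "y \<in> cb x j \<longleftrightarrow> (\<forall>i. \<forall>n < - j. y $ i $$ n = x $ i $$ n)"
  by (simp add: cb_def fls_abs_le_exp_iff)

lemma centre_in_cb [simp]: "x \<in> cb x j"
  by (simp add: mem_cb_iff)

lemma cb_eq: "y \<in> cb x j \<Longrightarrow> cb y j = cb x j"
  by (auto simp: mem_cb_iff)

lemma cb_mono: "i \<le> j \<Longrightarrow> cb x i \<subseteq> cb x j"
  by (auto simp: mem_cb_iff)

lemma fball_eq_cb:
  assumes "exp (real_of_int j) < r" "r \<le> exp (real_of_int (j + 1))"
  shows "fball x r = cb x j"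
proof -
  have "sup_norm (y - x) < r \<longleftrightarrow> (\<forall>i. fls_abs (y $ i - x $ i) < r)" for y
    unfolding sup_norm_def by (subst Max_less_iff) auto
  then show ?thesis
    using fls_abs_less_iff_le_exp[OF assms] by (auto simp: fball_def cb_def)
qed

lemma fball_exp_Suc: "fball x (exp (real_of_int (j + 1))) = cb x j"
  by (rule fball_eq_cb) auto

lemma open_fls_abs_ball:
  fixes a :: "'a::field fls"
  shows "open {b. fls_abs (b - a) \<le> exp (real_of_int j)}"
  unfolding open_fls_def
proof safe
  fix c :: "'a fls"
  assume c: "fls_abs (c - a) \<le> exp (real_of_int j)"
  let ?r = "inverse (2 ^ nat (- j)) :: real"
  have "fls_abs (y - a) \<le> exp (real_of_int j)" if y: "dist y c < ?r" for y
  proof -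
    have "fls_abs (y - c) \<le> exp (real_of_int j)"
    proof (cases "y = c")
      case False
      have r1: "?r \<le> 1" by (simp add: inverse_le_1_iff)
      have pos: "fls_subdegree (y - c) \<ge> 0"
      proof (rule ccontr)
        assume "\<not> ?thesis"
        then have "dist y c = 2 ^ nat (- fls_subdegree (y - c))"
          using False by (simp add: dist_fls_def)
        also have "\<dots> \<ge> (1::real)" by simp
        finally show False using y r1 by linarith
      qed
      then have "inverse (2 ^ nat (fls_subdegree (y - c))) < ?r"
        using y False by (simp add: dist_fls_def)
      then have "nat (- j) < nat (fls_subdegree (y - c))"
        by (simp add: inverse_less_iff_less)
      then show ?thesis using False by (simp add: fls_abs_def)
    qed simp
    from fls_abs_add_le[OF this c] show ?thesis by simp
  qed
  then show "\<exists>r>0. {y. dist y c < r} \<subseteq> {b. fls_abs (b - a) \<le> exp (real_of_int j)}"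
    by (intro exI[of _ ?r]) auto
qed

lemma open_fls_contains_ball:
  fixes S :: "'a::field fls set"
  assumes "open S" "a \<in> S"
  shows "\<exists>j. {b. fls_abs (b - a) \<le> exp (real_of_int j)} \<subseteq> S"
proof -
  from assms obtain r where r: "r > 0" "{y. dist y a < r} \<subseteq> S"
    unfolding open_fls_def by blast
  obtain n where n: "inverse (2 ^ n) < r"
    using reals_power_lt_ex[OF r(1), of 2] by (auto simp: power_inverse inverse_eq_divide power_one_over)
  have "dist b a < r" if "fls_abs (b - a) \<le> exp (real_of_int (- int n))" for b
  proof (cases "b = a")
    case False
    have "real_of_int (- fls_subdegree (b - a)) \<le> real_of_int (- int n)"
      using that False by (simp add: fls_abs_def)
    then have s: "fls_subdegree (b - a) \<ge> int n" by linarith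
    then have "dist b a = inverse (2 ^ nat (fls_subdegree (b - a)))"
      using False by (simp add: dist_fls_def)
    also have "\<dots> \<le> inverse (2 ^ n)"
      using s by (intro le_imp_inverse_le power_increasing) auto
    finally show ?thesis using n by linarith
  qed (use r in simp)
  then show ?thesis using r(2) by blast
qed

lemma open_cb [simp]: "open (cb x j)"
  unfolding open_vec_def
proof
  fix y assume y: "y \<in> cb x j"
  show "\<exists>A. (\<forall>i. open (A i) \<and> y $ i \<in> A i) \<and> (\<forall>z. (\<forall>i. z $ i \<in> A i) \<longrightarrow> z \<in> cb x j)"
    using y by (intro exI[of _ "\<lambda>i. {b. fls_abs (b - x $ i) \<le> exp (real_of_int j)}"])
      (auto simp: open_fls_abs_ball cb_def)
qed

lemma open_contains_cb:
  assumes "open V" "y \<in> V"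
  obtains j where "cb y j \<subseteq> V"
proof -
  from assms have "\<exists>A. (\<forall>i. open (A i) \<and> y $ i \<in> A i) \<and> (\<forall>z. (\<forall>i. z $ i \<in> A i) \<longrightarrow> z \<in> V)"
    unfolding open_vec_def by (elim bspec)
  then obtain A where A: "\<And>i. open (A i)" "\<And>i. y $ i \<in> A i" "\<And>z. (\<And>i. z $ i \<in> A i) \<Longrightarrow> z \<in> V"
    by auto
  have "\<forall>i. \<exists>j. {b. fls_abs (b - y $ i) \<le> exp (real_of_int j)} \<subseteq> A i"
    using open_fls_contains_ball[OF A(1) A(2)] by (rule allI)
  from choice[OF this]
  obtain J where J: "\<And>i. {b. fls_abs (b - y $ i) \<le> exp (real_of_int (J i))} \<subseteq> A i" by auto
  define j where "j = Min (range J)"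
  have "j \<le> J i" for i unfolding j_def by simp
  have "cb y j \<subseteq> V"
  proof
    fix z assume z: "z \<in> cb y j"
    have "z $ i \<in> A i" for i
    proof -
      have "fls_abs (z $ i - y $ i) \<le> exp (real_of_int j)" using z by (simp add: cb_def)
      also have "\<dots> \<le> exp (real_of_int (J i))" using \<open>j \<le> J i\<close> by simp
      finally show ?thesis using J[of i] by blast
    qed
    then show "z \<in> V" using A(3) by blast
  qed
  then show ?thesis by (rule that)
qed

lemma cb_finite_union:
  fixes x :: "'a::{field,finite} fls ^ 'd::finite"
  shows "\<exists>Z. finite Z \<and> Z \<subseteq> cb x j \<and> cb x j \<subseteq> (\<Union>z\<in>Z. cb z (j - 1))"
proof -
  \<comment> \<open>\<open>g c\<close> is \<open>x\<close> with its coefficients at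
    \<open>- j\<close> replaced by \<open>c\<close>. Only these coefficients separate the subballs
    of level \<open>j - 1\<close>, and the finite field allows finitely many choices.\<close>
  define g :: "'a ^ 'd \<Rightarrow> 'a fls ^ 'd"
    where "g c = (\<chi> i. x $ i + fls_shift j (fls_const (c $ i - x $ i $$ (- j))))" for c
  have g: "g c $ i $$ n = (if n = - j then c $ i else x $ i $$ n)" for c i n
    by (auto simp: g_def)
  have "cb x j \<subseteq> (\<Union>z\<in>range g. cb z (j - 1))"
  proof
    fix y assume y: "y \<in> cb x j"
    have "y \<in> cb (g (\<chi> i. y $ i $$ (- j))) (j - 1)"
      unfolding mem_cb_iff
    proof (intro allI impI)
      fix i n assume "n < - (j - 1)"
      then show "y $ i $$ n = g (\<chi> i. y $ i $$ (- j)) $ i $$ n"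
        using y by (cases "n = - j") (auto simp: g mem_cb_iff)
    qed
    then show "y \<in> (\<Union>z\<in>range g. cb z (j - 1))" by blast
  qed
  moreover have "range g \<subseteq> cb x j" by (auto simp: mem_cb_iff g)
  ultimately show ?thesis by (intro exI[of _ "range g"]) auto
qed

lemma nested_cb_inter:
  fixes z :: "nat \<Rightarrow> 'a::field fls ^ 'd::finite"
  assumes z: "\<And>n. z (Suc n) \<in> cb (z n) (j - int n)"
  shows "\<exists>y. \<forall>n. y \<in> cb (z n) (j - int n)"
proof -
  have step: "z (m + p) $ i $$ n = z m $ i $$ n" if "n < int m - j" for m p i n
  proof (induction p)
    case (Suc p)
    have "z (Suc (m + p)) $ i $$ n = z (m + p) $ i $$ n"
      using z[of "m + p"] that unfolding mem_cb_iff by auto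
    with Suc show ?case by simp
  qed simp
  have step': "z m' $ i $$ n = z m $ i $$ n" if "n < int m - j" "m \<le> m'" for m m' i n
    using step[OF that(1), of "m' - m" i] that(2) by simp
  \<comment> \<open>Ball \<open>m\<close> fixes the coefficients below \<open>m - j\<close>, so the
    coefficient at \<open>n\<close> is final from index \<open>n + j + 1\<close> on. For
    \<open>n < - j\<close> the index is 0, and the subdegree of \<open>z 0\<close> bounds the
    support of \<open>y\<close> from below.\<close>
  define y where "y = (\<chi> i. Abs_fls (\<lambda>n. z (nat (n + j + 1)) $ i $$ n))"
  have y: "y $ i $$ n = z (nat (n + j + 1)) $ i $$ n" for i n
  proof -
    have "\<forall>n < min (fls_subdegree (z 0 $ i)) (- j). z (nat (n + j + 1)) $ i $$ n = 0"
      by simp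
    then show ?thesis unfolding y_def vec_lambda_beta by (rule nth_Abs_fls_lower_bound)
  qed
  have "y \<in> cb (z m) (j - int m)" for m
    unfolding mem_cb_iff
  proof (intro allI impI)
    fix i n assume n: "n < - (j - int m)"
    then show "y $ i $$ n = z m $ i $$ n"
      unfolding y by (intro step'[symmetric]) auto
  qed
  then show ?thesis by blast
qed

text \<open>A Koenig argument: a ball without finite subcover contains, at every smaller scale, a ball
  without finite subcover, and such a nested sequence of balls has a common point.\<close>

lemma compact_cb [simp]:
  fixes x :: "'a::{field,finite} fls ^ 'd::finite"
  shows "compact (cb x j)"
proof (rule compactI)
  fix \<C> :: "('a fls ^ 'd) set set"
  assume op: "\<forall>t\<in>\<C>. open t" and cov: "cb x j \<subseteq> \<Union>\<C>"
  define bad where "bad B \<longleftrightarrow> \<not> (\<exists>\<D>\<subseteq>\<C>. finite \<D> \<and> B \<subseteq> \<Union>\<D>)" for B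
  have step: "\<exists>z. z \<in> cb y l \<and> bad (cb z (l - 1))" if bad: "bad (cb y l)" for y l
  proof (rule ccontr)
    assume "\<not> ?thesis"
    then have "\<not> bad (cb z (l - 1))" if "z \<in> cb y l" for z using that by blast
    then have good: "\<exists>\<D>\<subseteq>\<C>. finite \<D> \<and> cb z (l - 1) \<subseteq> \<Union>\<D>" if "z \<in> cb y l" for z
      using that unfolding bad_def not_not .
    obtain Z where Z: "finite Z" "Z \<subseteq> cb y l" "cb y l \<subseteq> (\<Union>z\<in>Z. cb z (l - 1))"
      using cb_finite_union[of y l] by auto
    have "\<forall>z\<in>Z. \<exists>\<D>. \<D> \<subseteq> \<C> \<and> finite \<D> \<and> cb z (l - 1) \<subseteq> \<Union>\<D>"
      by (intro ballI good) (rule subsetD[OF Z(2)])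
    from bchoice[OF this] obtain D
      where D: "\<And>z. z \<in> Z \<Longrightarrow> D z \<subseteq> \<C> \<and> finite (D z) \<and> cb z (l - 1) \<subseteq> \<Union>(D z)"
      by auto
    have "cb y l \<subseteq> \<Union>(\<Union>(D ` Z))"
    proof
      fix u assume "u \<in> cb y l"
      then obtain v where v: "v \<in> Z" "u \<in> cb v (l - 1)" using Z(3) by auto
      then have "u \<in> \<Union>(D v)" using D[OF v(1)] by blast
      then show "u \<in> \<Union>(\<Union>(D ` Z))" using v(1) by auto
    qed
    moreover have "finite (\<Union>(D ` Z))" "\<Union>(D ` Z) \<subseteq> \<C>" using Z(1) D by (simp, blast)
    ultimately have "\<exists>\<D>\<subseteq>\<C>. finite \<D> \<and> cb y l \<subseteq> \<Union>\<D>" by (intro exI conjI)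
    then show False using bad unfolding bad_def by (rule notE[rotated])
  qed
  show "\<exists>\<D>\<subseteq>\<C>. finite \<D> \<and> cb x j \<subseteq> \<Union>\<D>"
  proof (rule ccontr)
    assume "\<not> ?thesis"
    then have bad0: "bad (cb x j)" by (simp add: bad_def)
    define Q where "Q n a \<longleftrightarrow> bad (cb a (j - int n)) \<and> (n = 0 \<longrightarrow> a = x)" for n a
    have Q0: "\<exists>a. Q 0 a" using bad0 by (intro exI[of _ x]) (simp add: Q_def)
    have QS: "\<exists>b. Q (Suc n) b \<and> b \<in> cb a (j - int n)" if "Q n a" for a n
      using step[of a "j - int n"] that by (auto simp: Q_def algebra_simps)
    have "\<exists>z. \<forall>n. Q n (z n) \<and> z (Suc n) \<in> cb (z n) (j - int n)"
      by (rule dependent_nat_choice[where P = Q and Q = "\<lambda>n a b. b \<in> cb a (j - int n)", OF Q0])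
        (rule QS)
    then obtain z where "\<And>n. Q n (z n)" "\<And>n. z (Suc n) \<in> cb (z n) (j - int n)" by blast
    then have z: "z 0 = x" "\<And>n. bad (cb (z n) (j - int n))" "\<And>n. z (Suc n) \<in> cb (z n) (j - int n)"
      by (simp_all add: Q_def)
    obtain y where y: "\<And>n. y \<in> cb (z n) (j - int n)" using nested_cb_inter[of z j, OF z(3)] by auto
    have "y \<in> cb x j" using y[of 0] z(1) by simp
    then obtain t where t: "t \<in> \<C>" "y \<in> t" using cov by blast
    then obtain l where l: "cb y l \<subseteq> t" using op open_contains_cb[of t y] by auto
    \<comment> \<open>At this index the level of the nested ball is at most \<open>l\<close>, so the
      single set \<open>t\<close> covers a bad ball.\<close>
    have "cb (z (nat (j - l))) (j - int (nat (j - l))) = cb y (j - int (nat (j - l)))"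
      by (rule cb_eq[OF y, symmetric])
    also have "\<dots> \<subseteq> cb y l" by (rule cb_mono) simp
    finally have "\<not> bad (cb (z (nat (j - l))) (j - int (nat (j - l))))"
      unfolding bad_def not_not using l t(1) by (intro exI[of _ "{t}"]) simp
    then show False using z(2) by blast
  qed
qed

lemma UN_cb_eq_UNIV: "(\<Union>n. cb 0 (int n)) = UNIV"
proof -
  have "\<exists>n. x \<in> cb 0 (int n)" for x :: "'a::field fls ^ 'd::finite"
  proof -
    obtain n where n: "\<And>i. nat (- fls_subdegree (x $ i)) \<le> n"
      using finite_nat_set_iff_bounded_le[of "range (\<lambda>i. nat (- fls_subdegree (x $ i)))"] by auto
    have "x $ i $$ m = 0" if "m < - int n" for i m
      using n[of i] that by (intro fls_eq0_below_subdegree) linarith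
    then show ?thesis by (intro exI[of _ n]) (simp add: mem_cb_iff)
  qed
  then show ?thesis by blast
qed

text \<open>Balls of one level coincide or are disjoint, so finitely many of them meet the compact
  ball \<open>cb 0 n\<close>, and these compact balls exhaust the space. Every family of balls is
  thus open to countable additivity.\<close>

lemma countable_cb:
  "countable {cb x j | (x :: 'a::{field,finite} fls ^ 'd::finite) j. True}"
proof -
  have "finite ((\<lambda>x. cb x j) ` cb (0 :: 'a fls ^ 'd) (int n))" for n j
  proof -
    have "cb (0 :: 'a fls ^ 'd) (int n) \<subseteq> (\<Union>x\<in>cb 0 (int n). cb x j)"
      by (rule subsetI, erule UN_I) (rule centre_in_cb)
    then obtain Z where Z: "finite Z" "cb (0 :: 'a fls ^ 'd) (int n) \<subseteq> (\<Union>x\<in>Z. cb x j)"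
      using compactE_image[OF compact_cb, of "cb 0 (int n)" "\<lambda>x. cb x j" 0 "int n"] open_cb by metis
    have "(\<lambda>x. cb x j) ` cb 0 (int n) \<subseteq> (\<lambda>x. cb x j) ` Z"
    proof safe
      fix x :: "'a fls ^ 'd" assume "x \<in> cb 0 (int n)"
      then obtain z where "z \<in> Z" "x \<in> cb z j" using Z(2) by auto
      then show "cb x j \<in> (\<lambda>x. cb x j) ` Z" by (auto simp: cb_eq)
    qed
    then show ?thesis using Z(1) finite_surj by blast
  qed
  then have "countable (\<Union>j. \<Union>n. (\<lambda>x. cb x j) ` cb (0 :: 'a fls ^ 'd) (int n))"
    by (intro countable_UN) (auto intro: countable_finite)
  moreover have "{cb x j | (x :: 'a fls ^ 'd) j. True} \<subseteq> (\<Union>j. \<Union>n. (\<lambda>x. cb x j) ` cb (0 :: 'a fls ^ 'd) (int n))"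
  proof safe
    fix x :: "'a fls ^ 'd" and j
    have "x \<in> (\<Union>n. cb 0 (int n))" unfolding UN_cb_eq_UNIV by (rule UNIV_I)
    then obtain n where "x \<in> cb 0 (int n)" by (rule UN_E)
    then have "cb x j \<in> (\<lambda>x. cb x j) ` cb 0 (int n)" by (rule imageI)
    then have "cb x j \<in> (\<Union>n. (\<lambda>x. cb x j) ` cb 0 (int n))" by (rule UN_I[OF UNIV_I])
    then show "cb x j \<in> (\<Union>j. \<Union>n. (\<lambda>x. cb x j) ` cb 0 (int n))" by (rule UN_I[OF UNIV_I])
  qed
  ultimately show ?thesis by (rule countable_subset[rotated])
qed

section \<open>Continuity in terms of absolute values\<close>

definition fls_continuous :: "('a::field fls ^ 'd::finite \<Rightarrow> 'a fls) \<Rightarrow> bool" where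
  "fls_continuous f \<longleftrightarrow> (\<forall>y j. \<exists>l. \<forall>z\<in>cb y l. fls_abs (f z - f y) \<le> exp (real_of_int j))"

lemma fls_continuous_const [intro]: "fls_continuous (\<lambda>x. c)"
  by (simp add: fls_continuous_def)

lemma fls_continuous_component [intro]: "fls_continuous (\<lambda>x. x $ i)"
  by (auto simp: fls_continuous_def cb_def)

lemma fls_continuous_add [intro]:
  assumes "fls_continuous f" "fls_continuous g"
  shows "fls_continuous (\<lambda>x. f x + g x)"
  unfolding fls_continuous_def
proof (intro allI)
  fix y j
  obtain l l' where l: "\<And>z. z \<in> cb y l \<Longrightarrow> fls_abs (f z - f y) \<le> exp (real_of_int j)"
      "\<And>z. z \<in> cb y l' \<Longrightarrow> fls_abs (g z - g y) \<le> exp (real_of_int j)"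
    using assms unfolding fls_continuous_def by metis
  have "fls_abs (f z + g z - (f y + g y)) \<le> exp (real_of_int j)" if "z \<in> cb y (min l l')" for z
  proof -
    have "z \<in> cb y l" "z \<in> cb y l'"
      using that cb_mono[of "min l l'" l y] cb_mono[of "min l l'" l' y] by auto
    from fls_abs_add_le[OF l(1)[OF this(1)] l(2)[OF this(2)]] show ?thesis
      by (simp add: algebra_simps)
  qed
  then show "\<exists>l. \<forall>z\<in>cb y l. fls_abs (f z + g z - (f y + g y)) \<le> exp (real_of_int j)" by blast
qed

lemma fls_continuous_mult [intro]:
  assumes "fls_continuous f" "fls_continuous g"
  shows "fls_continuous (\<lambda>x. f x * g x)"
  unfolding fls_continuous_def
proof (intro allI)
  fix y :: "'a fls ^ 'b" and j :: int
  have "\<exists>N::int. fls_abs a \<le> exp (real_of_int N)" for a :: "'a fls"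
    by (metis fls_abs_0 fls_abs_exp_cases exp_ge_zero order_refl)
  then obtain A B where A: "fls_abs (f y) \<le> exp (real_of_int A)" and B: "fls_abs (g y) \<le> exp (real_of_int B)"
    by metis
  \<comment> \<open>The increments of \<open>f\<close> and \<open>g\<close> will be at most
    \<open>exp i\<close> and \<open>exp (min i (j - i))\<close>. Then each term of the expanded
    difference is at most \<open>exp j\<close>: \<open>j - i\<close> serves the product of the
    increments, \<open>j - B\<close> and \<open>j - A\<close> the mixed terms.\<close>
  define i where "i = min 0 (min (j - A) (j - B))"
  obtain l l' where l: "\<And>z. z \<in> cb y l \<Longrightarrow> fls_abs (f z - f y) \<le> exp (real_of_int i)"
      "\<And>z. z \<in> cb y l' \<Longrightarrow> fls_abs (g z - g y) \<le> exp (real_of_int (min i (j - i)))"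
    using assms unfolding fls_continuous_def by metis
  have "fls_abs (f z * g z - (f y * g y)) \<le> exp (real_of_int j)" if "z \<in> cb y (min l l')" for z
  proof -
    have "z \<in> cb y l" "z \<in> cb y l'"
      using that cb_mono[of "min l l'" l y] cb_mono[of "min l l'" l' y] by auto
    note lz = l(1)[OF this(1)] l(2)[OF this(2)]
    have le: "a * b \<le> exp (real_of_int j)"
      if "0 \<le> a" "0 \<le> b" "a \<le> exp (real_of_int p)" "b \<le> exp (real_of_int q)" "p + q \<le> j" for a b p q
    proof -
      have "a * b \<le> exp (real_of_int p) * exp (real_of_int q)" using that by (intro mult_mono) auto
      also have "\<dots> = exp (real_of_int (p + q))" by (simp add: exp_add)
      also have "\<dots> \<le> exp (real_of_int j)" using that by (simp only: exp_le_cancel_iff of_int_le_iff)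
      finally show ?thesis .
    qed
    have "fls_abs ((f z - f y) * (g z - g y)) \<le> exp (real_of_int j)"
      unfolding fls_abs_mult by (rule le[OF _ _ lz]) auto
    moreover have "fls_abs ((f z - f y) * g y) \<le> exp (real_of_int j)"
      unfolding fls_abs_mult by (rule le[OF _ _ lz(1) B]) (auto simp: i_def)
    moreover have "fls_abs (f y * (g z - g y)) \<le> exp (real_of_int j)"
      unfolding fls_abs_mult by (rule le[OF _ _ A lz(2)]) (auto simp: i_def)
    ultimately have "fls_abs ((f z - f y) * (g z - g y) + (f z - f y) * g y + f y * (g z - g y)) \<le> exp (real_of_int j)"
      by (intro fls_abs_add_le)
    then show ?thesis by (simp add: algebra_simps)
  qed
  then show "\<exists>l. \<forall>z\<in>cb y l. fls_abs (f z * g z - (f y * g y)) \<le> exp (real_of_int j)" by blast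
qed

lemma fls_continuous_power [intro]: "fls_continuous f \<Longrightarrow> fls_continuous (\<lambda>x. f x ^ n)"
  by (induction n) auto

lemma fls_continuous_sum [intro]:
  "(\<And>i. i \<in> A \<Longrightarrow> fls_continuous (f i)) \<Longrightarrow> fls_continuous (\<lambda>x. \<Sum>i\<in>A. f i x)"
  by (induction A rule: infinite_finite_induct) auto

lemma fls_continuous_prod [intro]:
  "(\<And>i. i \<in> A \<Longrightarrow> fls_continuous (f i)) \<Longrightarrow> fls_continuous (\<lambda>x. \<Prod>i\<in>A. f i x)"
  by (induction A rule: infinite_finite_induct) auto

lemma fls_continuous_monomial_value [intro]: "fls_continuous (monomial_value \<alpha>)"
  unfolding monomial_value_def[abs_def]
  by (intro fls_continuous_prod fls_continuous_power fls_continuous_component)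

lemma fls_continuous_mpoly_value [intro]: "fls_continuous (mpoly_value P)"
  unfolding mpoly_value_def[abs_def]
  by (intro fls_continuous_sum fls_continuous_mult fls_continuous_const fls_continuous_monomial_value)

text \<open>By the ultrametric inequality a perturbation smaller than \<open>c\<close> cannot lift a
  value from below \<open>c\<close> to \<open>c\<close> or above, so one precision
  \<open>exp j < c\<close> serves at every point.\<close>

lemma open_fls_abs_less:
  assumes "fls_continuous f"
  shows "open {x. fls_abs (f x) < c}"
proof -
  have "\<exists>T. open T \<and> y \<in> T \<and> T \<subseteq> {x. fls_abs (f x) < c}" if y: "fls_abs (f y) < c" for y
  proof -
    have "c > 0" using y fls_abs_nonneg[of "f y"] by linarith
    define j where "j = \<lfloor>ln c\<rfloor> - 1"
    have "exp (real_of_int j) < exp (ln c)" unfolding j_def by (simp only: exp_less_cancel_iff) linarith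
    then have j: "exp (real_of_int j) < c" using \<open>c > 0\<close> by simp
    obtain l where l: "\<And>z. z \<in> cb y l \<Longrightarrow> fls_abs (f z - f y) \<le> exp (real_of_int j)"
      using assms unfolding fls_continuous_def by metis
    have "fls_abs (f z) < c" if "z \<in> cb y l" for z
    proof -
      have "fls_abs ((f z - f y) + f y) \<le> max (exp (real_of_int j)) (fls_abs (f y))"
        using l[OF that] by (intro fls_abs_add_le) auto
      then show ?thesis using j y by auto
    qed
    then show ?thesis by (intro exI[of _ "cb y l"]) auto
  qed
  then show ?thesis by (subst open_subopen) auto
qed

text \<open>Compactness supplies the boundedness under which the real supremum in
  \<open>sup_on_supp\<close> dominates the values.\<close>

lemma fls_continuous_bounded_on_cb:
  fixes f :: "'a::{field,finite} fls ^ 'd::finite \<Rightarrow> 'a fls"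
  assumes "fls_continuous f"
  obtains b where "b > 0" "\<And>y. y \<in> cb x j \<Longrightarrow> fls_abs (f y) \<le> b"
proof -
  have "cb x j \<subseteq> (\<Union>n\<in>UNIV. {y. fls_abs (f y) < real n})"
    using reals_Archimedean2 by blast
  from compactE_image[OF compact_cb _ this] open_fls_abs_less[OF assms]
  obtain N where N: "finite N" "cb x j \<subseteq> (\<Union>n\<in>N. {y. fls_abs (f y) < real n})" by auto
  obtain n where n: "\<And>i. i \<in> N \<Longrightarrow> i \<le> n" using N(1) finite_nat_set_iff_bounded_le by auto
  have bd: "fls_abs (f y) \<le> real (Suc n)" if "y \<in> cb x j" for y
  proof -
    obtain i where "i \<in> N" "fls_abs (f y) < real i" using N(2) \<open>y \<in> cb x j\<close> by auto
    then show ?thesis using n[of i] by simp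
  qed
  show ?thesis by (rule that[of "real (Suc n)", OF _ bd]) auto
qed

section \<open>Quantitative nondivergence in ultrametric spaces\<close>

lemma radon_measureD:
  assumes "radon_measure M"
  shows "sets M = sets borel"
    and "compact K \<Longrightarrow> emeasure M K < \<infinity>"
    and "A \<in> sets borel \<Longrightarrow> emeasure M A = (INF V\<in>{V. open V \<and> A \<subseteq> V}. emeasure M V)"
  using assms unfolding radon_measure_def by auto

lemma radon_sets_open: "radon_measure M \<Longrightarrow> open V \<Longrightarrow> V \<in> sets M"
  by (simp add: radon_measureD)

lemma emeasure_cb_finite:
  fixes M :: "('a::{field,finite} fls ^ 'd::finite) measure"
  assumes "radon_measure M"
  shows "emeasure M (cb x j) < \<infinity>"
  by (rule radon_measureD(2)[OF assms compact_cb])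

lemma emeasure_cb_pos: "x \<in> msupport M \<Longrightarrow> emeasure M (cb x j) > 0"
  by (simp add: msupport_def)

text \<open>The complement of the support is the union of the balls of measure zero, since an open
  null neighbourhood contains a ball around its point; and there are only countably many
  balls.\<close>

lemma null_sets_compl_msupport:
  fixes M :: "('a::{field,finite} fls ^ 'd::finite) measure"
  assumes "radon_measure M"
  shows "- msupport M \<in> null_sets M"
proof -
  let ?F = "{B. (\<exists>x j. B = cb x j) \<and> emeasure M B = 0}"
  have "countable ?F"
    by (rule countable_subset[OF _ countable_cb]) auto
  then have "\<Union>?F \<in> null_sets M"
  proof -
    have "(\<Union>B\<in>?F. B) \<in> null_sets M"
      using \<open>countable ?F\<close> radon_sets_open[OF assms open_cb]
      by (intro null_sets_UN') (auto intro!: null_setsI)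
    then show ?thesis by simp
  qed
  moreover have "\<Union>?F = - msupport M"
  proof (rule set_eqI)
    fix x
    have *: "x \<in> \<Union>?F" if "open V" "x \<in> V" "emeasure M V = 0" for V
    proof -
      obtain j where j: "cb x j \<subseteq> V" using open_contains_cb[OF \<open>open V\<close> \<open>x \<in> V\<close>] by auto
      have "emeasure M (cb x j) = 0"
        using emeasure_mono[OF j radon_sets_open[OF assms \<open>open V\<close>]] that by simp
      then show ?thesis by (intro UnionI[of "cb x j"]) auto
    qed
    show "x \<in> \<Union>?F \<longleftrightarrow> x \<in> - msupport M"
    proof
      assume "x \<in> \<Union>?F"
      then obtain y j where "x \<in> cb y j" "emeasure M (cb y j) = 0" by auto
      then have "\<not> (\<forall>V. open V \<and> x \<in> V \<longrightarrow> emeasure M V > 0)"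
        using open_cb[of y j] by (metis less_irrefl)
      then show "x \<in> - msupport M" by (simp add: msupport_def)
    next
      assume "x \<in> - msupport M"
      then have "\<not> (\<forall>V. open V \<and> x \<in> V \<longrightarrow> emeasure M V > 0)" by (simp add: msupport_def)
      then obtain V where "open V" "x \<in> V" "\<not> emeasure M V > 0" by blast
      then show "x \<in> \<Union>?F" by (intro *) auto
    qed
  qed
  ultimately show ?thesis by simp
qed

text \<open>Maximal balls in an ultrametric space are disjoint.\<close>

lemma maximal_cb_cover:
  fixes Y :: "('a::field fls ^ 'd::finite) set"
  assumes ex: "\<And>y. y \<in> Y \<Longrightarrow> \<exists>j\<le>j0. Q (cb y j)"
    and bd: "\<And>y j. y \<in> Y \<Longrightarrow> Q (cb y j) \<Longrightarrow> j \<le> j0"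
  obtains lev where "\<And>y. y \<in> Y \<Longrightarrow> Q (cb y (lev y))" "\<And>y. y \<in> Y \<Longrightarrow> \<not> Q (cb y (lev y + 1))"
    "disjoint ((\<lambda>y. cb y (lev y)) ` Y)"
proof -
  have "\<exists>j. Q (cb y j) \<and> (\<forall>i. Q (cb y i) \<longrightarrow> i \<le> j)" if y: "y \<in> Y" for y
  proof -
    obtain i where i: "Q (cb y i)" using ex[OF y] by auto
    define n where "n = (LEAST n. Q (cb y (j0 - int n)))"
    have "Q (cb y (j0 - int (nat (j0 - i))))" using i bd[OF y i] by simp
    then have n: "Q (cb y (j0 - int n))" unfolding n_def by (rule LeastI)
    have "l \<le> j0 - int n" if l: "Q (cb y l)" for l
    proof -
      have "l \<le> j0" by (rule bd[OF y l])
      then have "Q (cb y (j0 - int (nat (j0 - l))))" using l by simp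
      then have "n \<le> nat (j0 - l)" unfolding n_def by (rule Least_le)
      then show ?thesis using \<open>l \<le> j0\<close> by linarith
    qed
    then show ?thesis using n by auto
  qed
  then have "\<forall>y\<in>Y. \<exists>j. Q (cb y j) \<and> (\<forall>i. Q (cb y i) \<longrightarrow> i \<le> j)" by auto
  from bchoice[OF this] obtain lev
    where lev: "\<And>y. y \<in> Y \<Longrightarrow> Q (cb y (lev y))" "\<And>y i. y \<in> Y \<Longrightarrow> Q (cb y i) \<Longrightarrow> i \<le> lev y"
    by auto
  have le: "cb y (lev y) = cb z (lev z)"
    if "y \<in> Y" "z \<in> Y" "p \<in> cb y (lev y)" "p \<in> cb z (lev z)" "lev y \<le> lev z" for y z p
  proof -
    have "p \<in> cb y (lev z)" using that(3) cb_mono[OF that(5), of y] by auto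
    then have eq: "cb y (lev z) = cb z (lev z)" using cb_eq that(4) by metis
    then have "Q (cb y (lev z))" using lev(1)[OF that(2)] by simp
    then have "lev z \<le> lev y" using lev(2) that(1) by auto
    then show ?thesis using eq that(5) by simp
  qed
  show ?thesis
  proof (rule that[of lev])
    show "\<not> Q (cb y (lev y + 1))" if "y \<in> Y" for y
      using lev(2)[OF that, of "lev y + 1"] by auto
    show "disjoint ((\<lambda>y. cb y (lev y)) ` Y)"
      unfolding disjoint_def
    proof clarify
      fix y z assume yz: "y \<in> Y" "z \<in> Y" "cb y (lev y) \<noteq> cb z (lev z)"
      show "cb y (lev y) \<inter> cb z (lev z) = {}"
      proof (rule equals0I)
        fix p assume "p \<in> cb y (lev y) \<inter> cb z (lev z)"
        then show False
          using le[of y z p] le[of z y p] yz by (cases "lev y \<le> lev z") auto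
      qed
    qed
  qed (rule lev(1))
qed

lemma emeasure_disjoint_UN_le:
  fixes c :: ennreal
  assumes "countable \<F>" "disjoint \<F>" "\<F> \<subseteq> sets M" "\<Union>\<F> \<subseteq> B0" "B0 \<in> sets M"
    and A: "\<And>B. B \<in> \<F> \<Longrightarrow> A B \<in> sets M" "\<And>B. B \<in> \<F> \<Longrightarrow> A B \<subseteq> B"
      "\<And>B. B \<in> \<F> \<Longrightarrow> emeasure M (A B) \<le> c * emeasure M B"
  shows "emeasure M (\<Union>B\<in>\<F>. A B) \<le> c * emeasure M B0"
proof -
  have disj: "disjoint_family_on (\<lambda>B. B) \<F>" "disjoint_family_on A \<F>"
    using assms(2) A(2) unfolding disjoint_family_on_def disjoint_def by blast+
  have "emeasure M (\<Union>B\<in>\<F>. A B) = (\<integral>\<^sup>+B. emeasure M (A B) \<partial>count_space \<F>)"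
    by (rule emeasure_UN_countable[OF A(1) assms(1) disj(2)])
  also have "\<dots> \<le> (\<integral>\<^sup>+B. c * emeasure M B \<partial>count_space \<F>)"
    by (intro nn_integral_mono) (auto intro: A(3))
  also have "\<dots> = c * (\<integral>\<^sup>+B. emeasure M B \<partial>count_space \<F>)"
    by (rule nn_integral_cmult) simp
  also have "(\<integral>\<^sup>+B. emeasure M B \<partial>count_space \<F>) = emeasure M (\<Union>B\<in>\<F>. B)"
    by (rule emeasure_UN_countable[symmetric, OF _ assms(1) disj(1)]) (use assms(3) in auto)
  also have "c * emeasure M (\<Union>B\<in>\<F>. B) \<le> c * emeasure M B0"
    by (intro mult_left_mono emeasure_mono) (use assms(4,5) in auto)
  finally show ?thesis .
qed

text \<open>\<open>S\<close> is an abstract family with comparability \<open>cmp\<close>, and \<psi>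
  plays the part of the covolume. A point is marked by a finite chain \<open>T\<close> of moderate
  values that is saturated: whatever else is comparable with all of \<open>T\<close> has value at
  least 1. Saturation is what rules out short vectors later on.\<close>

definition marked :: "('s \<Rightarrow> 'x \<Rightarrow> real) \<Rightarrow> ('s \<Rightarrow> 's \<Rightarrow> bool) \<Rightarrow> real \<Rightarrow> 's set \<Rightarrow> 'x \<Rightarrow> bool" where
  "marked \<psi> cmp \<epsilon> S y \<longleftrightarrow> (\<exists>T\<subseteq>S. finite T \<and> (\<forall>s\<in>T. \<forall>t\<in>T. cmp s t) \<and>
     (\<forall>t\<in>T. \<epsilon> \<le> \<psi> t y \<and> \<psi> t y \<le> 1) \<and>
     (\<forall>s\<in>S. (\<forall>t\<in>T. cmp s t) \<longrightarrow> s \<notin> T \<longrightarrow> 1 \<le> \<psi> s y))"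

text \<open>Restricting to the elements comparable with \<open>t\<close> and then adjoining
  \<open>t\<close> to the chain keeps saturation, because comparability with
  \<open>insert t T\<close> is comparability with \<open>T\<close> inside the restricted
  set.\<close>

lemma marked_insert:
  assumes sym: "\<And>s t. s \<in> S \<Longrightarrow> t \<in> S \<Longrightarrow> cmp s t \<Longrightarrow> cmp t s" and refl: "\<And>s. s \<in> S \<Longrightarrow> cmp s s"
    and t: "t \<in> S" "\<epsilon> \<le> \<psi> t y" "\<psi> t y \<le> 1"
    and m: "marked \<psi> cmp \<epsilon> {s \<in> S. cmp s t \<and> s \<noteq> t} y"
  shows "marked \<psi> cmp \<epsilon> S y"
proof -
  let ?S' = "{s \<in> S. cmp s t \<and> s \<noteq> t}"
  from m obtain T where T: "T \<subseteq> ?S'" "finite T" "\<forall>s\<in>T. \<forall>s'\<in>T. cmp s s'"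
    "\<forall>s\<in>T. \<epsilon> \<le> \<psi> s y \<and> \<psi> s y \<le> 1"
    "\<forall>s\<in>?S'. (\<forall>s'\<in>T. cmp s s') \<longrightarrow> s \<notin> T \<longrightarrow> 1 \<le> \<psi> s y"
    unfolding marked_def by (elim exE conjE) (rule that)
  have Tt: "s \<in> S" "cmp s t" "cmp t s" if "s \<in> T" for s
    using that T(1) sym t(1) by auto
  have "insert t T \<subseteq> S" using T(1) t(1) by auto
  moreover have "finite (insert t T)" using T(2) by simp
  moreover have "\<forall>s\<in>insert t T. \<forall>s'\<in>insert t T. cmp s s'"
    using T(3) Tt refl[OF t(1)] by simp
  moreover have "\<forall>s\<in>insert t T. \<epsilon> \<le> \<psi> s y \<and> \<psi> s y \<le> 1"
    using T(4) t by simp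
  moreover have "\<forall>s\<in>S. (\<forall>s'\<in>insert t T. cmp s s') \<longrightarrow> s \<notin> insert t T \<longrightarrow> 1 \<le> \<psi> s y"
    using T(5) by simp
  ultimately show ?thesis unfolding marked_def by (intro exI conjI)
qed

text \<open>One step of the induction removes, inside the parent ball, the exceptional set for one
  rank less and the points where \<open>\<psi> t\<close> is below \<epsilon>; this gives
  \<open>loss D \<delta> n + \<delta>\<close>. Comparing the parent with the ball itself costs the
  factor \<open>D\<close>.\<close>

primrec loss :: "ennreal \<Rightarrow> ennreal \<Rightarrow> nat \<Rightarrow> ennreal" where
  "loss D \<delta> 0 = 0"
| "loss D \<delta> (Suc n) = (loss D \<delta> n + \<delta>) * D"

text \<open>The inductive argument of Kleinbock and Margulis. If some \<open>\<psi> s y\<close> is below 1, take the largest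
  ball around \<open>y\<close> on which one of these functions, say \<open>\<psi> t\<close>, stays below 1. On the next larger ball
  every \<open>\<psi> s\<close> reaches 1 again, so that both the goodness of \<open>\<psi> t\<close> and the induction hypothesis for
  the elements comparable with \<open>t\<close> apply to it.\<close>

lemma quantitative_nondivergence:
  fixes M :: "('a::{field,finite} fls ^ 'd::finite) measure"
    and \<psi> :: "'s \<Rightarrow> 'a fls ^ 'd \<Rightarrow> real" and rk :: "'s \<Rightarrow> nat"
  assumes M: "radon_measure M"
    and fed: "\<And>x j. x \<in> msupport M \<Longrightarrow> cb x (j + 1) \<subseteq> B0 \<Longrightarrow>
        emeasure M (cb x (j + 1)) \<le> D * emeasure M (cb x j)"
    and good: "\<And>s x j. s \<in> S0 \<Longrightarrow> x \<in> msupport M \<Longrightarrow> cb x j \<subseteq> B0 \<Longrightarrow>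
        \<exists>y\<in>cb x j \<inter> msupport M. 1 \<le> \<psi> s y \<Longrightarrow>
        emeasure M {y \<in> cb x j. \<psi> s y < \<epsilon>} \<le> \<delta> * emeasure M (cb x j)"
    and op: "\<And>s c. s \<in> S0 \<Longrightarrow> open {y. \<psi> s y < c}"
    and sym: "\<And>s t. s \<in> S0 \<Longrightarrow> t \<in> S0 \<Longrightarrow> cmp s t \<Longrightarrow> cmp t s" and refl: "\<And>s. s \<in> S0 \<Longrightarrow> cmp s s"
    and rk: "\<And>s t. s \<in> S0 \<Longrightarrow> t \<in> S0 \<Longrightarrow> cmp s t \<Longrightarrow> rk s = rk t \<Longrightarrow> s = t"
    and S: "S \<subseteq> S0" and R: "finite R" "card R = n" "rk ` S \<subseteq> R"
    and x: "x \<in> msupport M" "cb x j \<subseteq> B0"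
    and sup: "\<And>s. s \<in> S \<Longrightarrow> \<exists>y\<in>cb x j \<inter> msupport M. 1 \<le> \<psi> s y"
  shows "\<exists>A\<in>sets M. A \<subseteq> cb x j \<and> emeasure M A \<le> loss D \<delta> n * emeasure M (cb x j) \<and>
    (\<forall>y\<in>cb x j \<inter> msupport M - A. marked \<psi> cmp \<epsilon> S y)"
  using S R x sup
proof (induction n arbitrary: S R x j)
  case 0
  then have "S = {}" by auto
  then have "marked \<psi> cmp \<epsilon> S y" for y by (auto simp: marked_def)
  then show ?case by (intro bexI[of _ "{}"]) auto
next
  case (Suc n)
  note S = Suc.prems(1) and R = Suc.prems(2-4) and x = Suc.prems(5,6) and sup = Suc.prems(7)
  define Q where "Q B \<longleftrightarrow> (\<exists>s\<in>S. \<forall>z\<in>B \<inter> msupport M. \<psi> s z < 1)" for B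
  define Y where "Y = {y \<in> cb x j \<inter> msupport M. \<exists>s\<in>S. \<psi> s y < 1}"
  \<comment> \<open>Every \<open>\<psi> s\<close> reaches 1 on \<open>cb x j\<close>, so a ball on
    which some \<open>\<psi> s\<close> stays below 1 has level below \<open>j\<close>; its parent
    therefore still lies in \<open>cb x j\<close>.\<close>
  have lt: "i < j" if yY: "y \<in> Y" and Qi: "Q (cb y i)" for y i
  proof (rule ccontr)
    assume "\<not> i < j"
    then have "cb y j \<subseteq> cb y i" by (intro cb_mono) simp
    moreover have "cb y j = cb x j" using yY by (intro cb_eq) (simp add: Y_def)
    ultimately have "cb x j \<subseteq> cb y i" by simp
    moreover obtain s where s: "s \<in> S" "\<And>z. z \<in> cb y i \<Longrightarrow> z \<in> msupport M \<Longrightarrow> \<psi> s z < 1"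
      using Qi unfolding Q_def by auto
    moreover obtain z where "z \<in> cb x j" "z \<in> msupport M" "1 \<le> \<psi> s z" using sup[OF s(1)] by auto
    ultimately show False by (meson not_less subsetD)
  qed
  have exQ: "\<exists>i\<le>j. Q (cb y i)" if y: "y \<in> Y" for y
  proof -
    obtain s where s: "s \<in> S" "\<psi> s y < 1" using y by (auto simp: Y_def)
    have "open {y. \<psi> s y < 1}" using op s(1) S by auto
    moreover have "y \<in> {y. \<psi> s y < 1}" using s by simp
    ultimately obtain i where "cb y i \<subseteq> {y. \<psi> s y < 1}" using open_contains_cb by metis
    then have "Q (cb y i)" using s(1) by (auto simp: Q_def)
    then show ?thesis using lt[OF y, of i] by (intro exI[of _ i]) auto
  qed
  obtain lev where lev: "\<And>y. y \<in> Y \<Longrightarrow> Q (cb y (lev y))" "\<And>y. y \<in> Y \<Longrightarrow> \<not> Q (cb y (lev y + 1))"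
      "disjoint ((\<lambda>y. cb y (lev y)) ` Y)"
    by (rule maximal_cb_cover[of Y j Q, OF exQ less_imp_le[OF lt]]) auto
  define \<F> where "\<F> = (\<lambda>y. cb y (lev y)) ` Y"
  have ball: "\<exists>A. A \<in> sets M \<and> A \<subseteq> B \<and> emeasure M A \<le> loss D \<delta> (Suc n) * emeasure M B \<and>
      (\<forall>z\<in>B \<inter> msupport M - A. marked \<psi> cmp \<epsilon> S z)" if BF: "B \<in> \<F>" for B
  proof -
    obtain y where y: "y \<in> Y" and B: "B = cb y (lev y)" using BF by (auto simp: \<F>_def)
    obtain t where t: "t \<in> S" "\<And>z. z \<in> B \<inter> msupport M \<Longrightarrow> \<psi> t z < 1"
      using lev(1)[OF y] unfolding Q_def B by auto
    have ysupp: "y \<in> msupport M" and yx: "y \<in> cb x j" using y by (auto simp: Y_def)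
    let ?P = "cb y (lev y + 1)"
    have "lev y < j" by (rule lt[OF y lev(1)[OF y]])
    then have "?P \<subseteq> cb y j" by (intro cb_mono) simp
    then have PB0: "?P \<subseteq> B0" using cb_eq[OF yx] x(2) by simp
    have supP: "\<exists>z\<in>?P \<inter> msupport M. 1 \<le> \<psi> s z" if "s \<in> S" for s
      using lev(2)[OF y] that unfolding Q_def by (meson not_less)
    let ?S' = "{s \<in> S. cmp s t \<and> s \<noteq> t}"
    \<comment> \<open>Comparable elements of equal rank coincide, so the elements of
      \<open>?S'\<close> avoid the rank of \<open>t\<close> and the induction hypothesis applies
      with one rank less.\<close>
    have rkt: "rk t \<in> R" using R(3) t(1) by auto
    have "rk ` ?S' \<subseteq> R - {rk t}"
      using R(3) rk S t(1) by (auto simp: subset_iff)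
    moreover have "card (R - {rk t}) = n" using R(1,2) rkt by simp
    ultimately have "\<exists>A\<in>sets M. A \<subseteq> ?P \<and> emeasure M A \<le> loss D \<delta> n * emeasure M ?P \<and>
        (\<forall>z\<in>?P \<inter> msupport M - A. marked \<psi> cmp \<epsilon> ?S' z)"
      using S R(1) ysupp PB0 supP by (intro Suc.IH[of ?S' "R - {rk t}" y "lev y + 1"]) auto
    then obtain A1 where A1: "A1 \<in> sets M" "A1 \<subseteq> ?P"
        "emeasure M A1 \<le> loss D \<delta> n * emeasure M ?P"
        "\<And>z. z \<in> ?P \<Longrightarrow> z \<in> msupport M \<Longrightarrow> z \<notin> A1 \<Longrightarrow> marked \<psi> cmp \<epsilon> ?S' z"
      by auto
    define A2 where "A2 = {z \<in> ?P. \<psi> t z < \<epsilon>}"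
    have "A2 = ?P \<inter> {z. \<psi> t z < \<epsilon>}" by (auto simp: A2_def)
    then have A2: "A2 \<in> sets M" using op[of t \<epsilon>] t(1) S radon_sets_open[OF M] by auto
    have A2': "emeasure M A2 \<le> \<delta> * emeasure M ?P"
      unfolding A2_def using good[of t y "lev y + 1"] t(1) S ysupp PB0 supP by auto
    have Bsub: "B \<subseteq> ?P" unfolding B by (rule cb_mono) simp
    \<comment> \<open>Both exceptional sets are controlled on the parent \<open>?P\<close>.
      Intersecting with \<open>B\<close> keeps the sets attached to different balls of
      \<open>\<F>\<close> disjoint.\<close>
    have "emeasure M ((A1 \<union> A2) \<inter> B) \<le> emeasure M (A1 \<union> A2)"
      using A1(1) A2 by (intro emeasure_mono) auto
    also have "\<dots> \<le> emeasure M A1 + emeasure M A2" using A1(1) A2 by (rule emeasure_subadditive)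
    also have "\<dots> \<le> (loss D \<delta> n + \<delta>) * emeasure M ?P"
      using add_mono[OF A1(3) A2'] by (simp add: distrib_right)
    also have "\<dots> \<le> (loss D \<delta> n + \<delta>) * (D * emeasure M B)"
      unfolding B by (intro mult_left_mono fed ysupp PB0) simp
    finally have meas: "emeasure M ((A1 \<union> A2) \<inter> B) \<le> loss D \<delta> (Suc n) * emeasure M B"
      by (simp add: mult.assoc)
    have "marked \<psi> cmp \<epsilon> S z" if z: "z \<in> B" "z \<in> msupport M" "z \<notin> (A1 \<union> A2) \<inter> B" for z
    proof (rule marked_insert)
      show "marked \<psi> cmp \<epsilon> ?S' z" using A1(4) z Bsub by auto
      show "\<epsilon> \<le> \<psi> t z" using z Bsub by (auto simp: A2_def)
      show "\<psi> t z \<le> 1" using t(2)[of z] z by auto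
    qed (use t(1) sym refl S in auto)
    then show ?thesis
      using meas A1(1) A2 radon_sets_open[OF M open_cb, of y "lev y"] B
      by (intro exI[of _ "(A1 \<union> A2) \<inter> B"]) auto
  qed
  from ball have "\<forall>B\<in>\<F>. \<exists>A. A \<in> sets M \<and> A \<subseteq> B \<and> emeasure M A \<le> loss D \<delta> (Suc n) * emeasure M B \<and>
      (\<forall>z\<in>B \<inter> msupport M - A. marked \<psi> cmp \<epsilon> S z)" by (rule ballI)
  from bchoice[OF this] obtain A where A0: "\<forall>B\<in>\<F>. A B \<in> sets M \<and> A B \<subseteq> B \<and>
      emeasure M (A B) \<le> loss D \<delta> (Suc n) * emeasure M B \<and>
      (\<forall>z\<in>B \<inter> msupport M - A B. marked \<psi> cmp \<epsilon> S z)" by (rule exE)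
  have A: "A B \<in> sets M" "A B \<subseteq> B" "emeasure M (A B) \<le> loss D \<delta> (Suc n) * emeasure M B"
    "z \<in> B \<Longrightarrow> z \<in> msupport M \<Longrightarrow> z \<notin> A B \<Longrightarrow> marked \<psi> cmp \<epsilon> S z" if "B \<in> \<F>" for B z
    using bspec[OF A0 that] by (simp_all del: loss.simps)
  have cF: "countable \<F>" by (rule countable_subset[OF _ countable_cb]) (auto simp: \<F>_def)
  have Fsub: "B \<subseteq> cb x j" if BF: "B \<in> \<F>" for B
  proof -
    obtain y where y: "y \<in> Y" and B: "B = cb y (lev y)" using BF by (auto simp: \<F>_def)
    have "lev y < j" by (rule lt[OF y lev(1)[OF y]])
    then have "B \<subseteq> cb y j" unfolding B by (intro cb_mono) simp
    moreover have "cb y j = cb x j" using y by (intro cb_eq) (simp add: Y_def)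
    ultimately show ?thesis by simp
  qed
  have Fsets: "\<F> \<subseteq> sets M" using radon_sets_open[OF M open_cb] by (auto simp: \<F>_def)
  show ?case
  proof (intro bexI[of _ "\<Union>B\<in>\<F>. A B"] conjI ballI)
    show "(\<Union>B\<in>\<F>. A B) \<in> sets M" using A(1) cF by (intro sets.countable_UN') auto
    show "(\<Union>B\<in>\<F>. A B) \<subseteq> cb x j" using A(2) Fsub by blast
    show "emeasure M (\<Union>B\<in>\<F>. A B) \<le> loss D \<delta> (Suc n) * emeasure M (cb x j)"
      by (rule emeasure_disjoint_UN_le[OF cF _ Fsets])
        (use lev(3) Fsub A radon_sets_open[OF M open_cb] in \<open>auto simp: \<F>_def\<close>)
    fix z assume z: "z \<in> cb x j \<inter> msupport M - (\<Union>B\<in>\<F>. A B)"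
    show "marked \<psi> cmp \<epsilon> S z"
    proof (cases "z \<in> Y")
      case True
      then have "cb z (lev z) \<in> \<F>" by (auto simp: \<F>_def)
      then show ?thesis using A(4)[of "cb z (lev z)" z] z by auto
    next
      case False
      then have "\<forall>s\<in>S. 1 \<le> \<psi> s z" using z by (auto simp: Y_def not_less)
      then show ?thesis unfolding marked_def by (intro exI[of _ "{}"]) auto
    qed
  qed
qed

lemma cb_subset_imp_le:
  assumes "cb y i \<subseteq> cb x j"
  shows "i \<le> j"
proof (rule ccontr)
  assume "\<not> i \<le> j"
  \<comment> \<open>\<open>z\<close> differs from \<open>y\<close> only by 1 at the coefficient
    \<open>- i\<close>, in every coordinate. Every level is thus realised by a distance and a ball
    determines its level, which bounds the levels of the balls inside \<open>cb x j\<close>.\<close>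
  define z where "z = (\<chi> k. y $ k + fls_shift i (fls_const 1))"
  have z: "z $ k $$ n = y $ k $$ n + (if n = - i then 1 else 0)" for k n
    by (auto simp: z_def)
  have "z \<in> cb y i" by (simp add: mem_cb_iff z)
  then have "z \<in> cb x j" "y \<in> cb x j" using assms by auto
  moreover have "- i < - j" using \<open>\<not> i \<le> j\<close> by simp
  ultimately have "z $ undefined $$ (- i) = y $ undefined $$ (- i)" unfolding mem_cb_iff by simp
  then show False by (simp add: z)
qed

text \<open>By outer regularity there is no need for a density theorem.\<close>

lemma null_set_if_half_in_balls:
  fixes M :: "('a::{field,finite} fls ^ 'd::finite) measure"
  assumes M: "radon_measure M" and U: "open U" and A: "A \<in> sets M" "A \<subseteq> U"
    and half: "\<And>x j. x \<in> msupport M \<Longrightarrow> cb x j \<subseteq> U \<Longrightarrow>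
      emeasure M (A \<inter> cb x j) \<le> ennreal (1/2) * emeasure M (cb x j)"
  shows "A \<in> null_sets M"
proof -
  \<comment> \<open>Balls that miss the support are null, and in any other ball a point of the
    support can serve as centre.\<close>
  have half': "emeasure M (A \<inter> cb y i) \<le> ennreal (1/2) * emeasure M (cb y i)" if "cb y i \<subseteq> U" for y i
  proof (cases "\<exists>x. x \<in> cb y i \<inter> msupport M")
    case True
    then obtain x where "x \<in> cb y i" "x \<in> msupport M" by auto
    then show ?thesis using half[of x i] cb_eq[of x y i] that by simp
  next
    case False
    then have "A \<inter> cb y i \<subseteq> - msupport M" by auto
    then have "emeasure M (A \<inter> cb y i) \<le> emeasure M (- msupport M)"
      using null_sets_compl_msupport[OF M] by (intro emeasure_mono) auto
    also have "\<dots> = 0" using null_sets_compl_msupport[OF M] by auto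
    finally show ?thesis by simp
  qed
  have ballnull: "A \<inter> cb x j \<in> null_sets M" if x: "cb x j \<subseteq> U" for x j
  proof -
    let ?A = "A \<inter> cb x j"
    have Asets: "?A \<in> sets M" using A(1) radon_sets_open[OF M open_cb] by auto
    have le: "emeasure M ?A \<le> ennreal (1/2) * emeasure M V" if V: "open V" "?A \<subseteq> V" for V
    proof -
      \<comment> \<open>Cutting down to \<open>cb x j\<close> bounds the levels of the balls inside
        the open set, so that maximal ones exist; they partition \<open>V'\<close>.\<close>
      define V' where "V' = V \<inter> cb x j"
      have V': "open V'" "?A \<subseteq> V'" using V by (auto simp: V'_def)
      have bd: "i \<le> j" if "cb y i \<subseteq> V'" for y i
        using that cb_subset_imp_le[of y i x j] by (auto simp: V'_def)
      have ex: "\<exists>i\<le>j. cb y i \<subseteq> V'" if y: "y \<in> V'" for y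
        using open_contains_cb[OF V'(1) y] bd by metis
      obtain lev where lev: "\<And>y. y \<in> V' \<Longrightarrow> cb y (lev y) \<subseteq> V'"
        "disjoint ((\<lambda>y. cb y (lev y)) ` V')"
        by (rule maximal_cb_cover[of V' j "\<lambda>B. B \<subseteq> V'", OF ex bd]) auto
      define \<F> where "\<F> = (\<lambda>y. cb y (lev y)) ` V'"
      have cF: "countable \<F>" by (rule countable_subset[OF _ countable_cb]) (auto simp: \<F>_def)
      have Fsets: "\<F> \<subseteq> sets M" using radon_sets_open[OF M open_cb] by (auto simp: \<F>_def)
      have FV: "\<Union>\<F> \<subseteq> V'" using lev(1) by (auto simp: \<F>_def)
      have "\<exists>B\<in>\<F>. p \<in> B" if "p \<in> ?A" for p
        using that V'(2) by (intro bexI[of _ "cb p (lev p)"]) (auto simp: \<F>_def)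
      then have "emeasure M ?A \<le> emeasure M (\<Union>B\<in>\<F>. A \<inter> B)"
        using A(1) cF Fsets by (intro emeasure_mono sets.countable_UN') auto
      also have "\<dots> \<le> ennreal (1/2) * emeasure M V'"
      proof (rule emeasure_disjoint_UN_le[OF cF _ Fsets FV])
        show "disjoint \<F>" using lev(2) by (simp add: \<F>_def)
        show "V' \<in> sets M" by (rule radon_sets_open[OF M V'(1)])
        fix B assume B: "B \<in> \<F>"
        show "A \<inter> B \<in> sets M" using A(1) B Fsets by auto
        show "emeasure M (A \<inter> B) \<le> ennreal (1/2) * emeasure M B"
        proof -
          obtain y where "y \<in> V'" "B = cb y (lev y)" using B by (auto simp: \<F>_def)
          then show ?thesis using half'[of y "lev y"] lev(1) x by (auto simp: V'_def)
        qed
      qed auto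
      also have "\<dots> \<le> ennreal (1/2) * emeasure M V"
        using radon_sets_open[OF M V(1)] by (intro mult_left_mono emeasure_mono) (auto simp: V'_def)
      finally show ?thesis .
    qed
    \<comment> \<open>The infimum over \<open>V\<close> bounds the measure of \<open>?A\<close> by
      half of itself; being finite, it is zero.\<close>
    have "emeasure M ?A \<le> ennreal (1/2) * emeasure M ?A"
    proof -
      have "ennreal 2 * emeasure M ?A \<le> emeasure M V" if V: "open V" "?A \<subseteq> V" for V
      proof -
        have "ennreal 2 * emeasure M ?A \<le> ennreal 2 * (ennreal (1/2) * emeasure M V)"
          by (intro mult_left_mono le V) simp
        also have "\<dots> = emeasure M V"
          by (simp only: mult.assoc[symmetric] ennreal_mult[symmetric]) simp
        finally show ?thesis .
      qed
      then have "ennreal 2 * emeasure M ?A \<le> (INF V\<in>{V. open V \<and> ?A \<subseteq> V}. emeasure M V)"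
        by (intro INF_greatest) auto
      also have "\<dots> = emeasure M ?A"
        using radon_measureD(3)[OF M, of ?A] Asets radon_measureD(1)[OF M] by simp
      finally have "ennreal (1/2) * (ennreal 2 * emeasure M ?A) \<le> ennreal (1/2) * emeasure M ?A"
        by (rule mult_left_mono) simp
      then show ?thesis by (simp only: mult.assoc[symmetric] ennreal_mult[symmetric]) simp
    qed
    moreover have "emeasure M ?A < \<infinity>"
    proof -
      have "emeasure M ?A \<le> emeasure M (cb x j)"
        using radon_sets_open[OF M open_cb] by (intro emeasure_mono) auto
      then show ?thesis using emeasure_cb_finite[OF M, of x j] by simp
    qed
    ultimately have "measure M ?A \<le> 1/2 * measure M ?A"
      by (cases "emeasure M ?A") (auto simp: measure_def ennreal_mult[symmetric] simp del: ennreal_half)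
    moreover have "measure M ?A \<ge> 0" by simp
    ultimately have "measure M ?A = 0" by linarith
    then have "emeasure M ?A = 0"
      using \<open>emeasure M ?A < \<infinity>\<close> by (simp add: emeasure_eq_ennreal_measure)
    then show ?thesis using Asets by auto
  qed
  let ?F = "{B. (\<exists>x j. B = cb x j) \<and> B \<subseteq> U}"
  have "countable ?F" by (rule countable_subset[OF _ countable_cb]) auto
  then have "(\<Union>B\<in>?F. A \<inter> B) \<in> null_sets M"
    using ballnull by (intro null_sets_UN') auto
  moreover have "(\<Union>B\<in>?F. A \<inter> B) = A"
  proof (rule set_eqI)
    fix p
    have "\<exists>B\<in>?F. p \<in> A \<inter> B" if p: "p \<in> A"
    proof -
      obtain j where "cb p j \<subseteq> U" using open_contains_cb[OF U, of p] p A(2) by auto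
      then show ?thesis using p by (intro bexI[of _ "cb p j"]) auto
    qed
    then show "p \<in> (\<Union>B\<in>?F. A \<inter> B) \<longleftrightarrow> p \<in> A" by auto
  qed
  ultimately show ?thesis by simp
qed

unbundle no fps_syntax


section \<open>Wedge products of vectors\<close>

lemma sum_fun_apply: "(\<Sum>x\<in>A. f x) i = (\<Sum>x\<in>A. f x i :: 'b::comm_monoid_add)"
  by (induction A rule: infinite_finite_induct) auto

definition fscale :: "'b::field \<Rightarrow> (nat \<Rightarrow> 'b) \<Rightarrow> nat \<Rightarrow> 'b" where
  "fscale c v = (\<lambda>i. c * v i)"

lemma fscale_apply: "fscale c v i = c * v i"
  by (simp add: fscale_def)

interpretation fv: vector_space fscale
  by unfold_locales (auto simp: fscale_def fun_eq_iff algebra_simps)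

text \<open>Multivectors are given by their coordinates, indexed by sets of rows; no exterior algebra is
  constructed.\<close>

definition wedge :: "(nat set \<Rightarrow> 'b::field) \<Rightarrow> (nat \<Rightarrow> 'b) \<Rightarrow> nat set \<Rightarrow> 'b" where
  "wedge w v I = (\<Sum>r\<in>I. (- 1) ^ card {s\<in>I. r < s} * w (I - {r}) * v r)"

text \<open>\<open>wedges vs I\<close> is the minor on the rows \<open>I\<close> of the matrix whose
  columns are the entries of \<open>vs\<close> in reverse order: the head of the list is the last
  column, along which \<open>wedge\<close> expands. The sign counts the rows of \<open>I\<close>
  after the deleted one.\<close>

primrec wedges :: "(nat \<Rightarrow> 'b::field) list \<Rightarrow> nat set \<Rightarrow> 'b" where
  "wedges [] = (\<lambda>I. if I = {} then 1 else 0)"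
| "wedges (v # vs) = wedge (wedges vs) v"

lemma wedge_infinite [simp]: "infinite I \<Longrightarrow> wedge w v I = 0"
  by (simp add: wedge_def)

lemma wedge_zero_right: "wedge w 0 I = 0"
  by (simp add: wedge_def)

lemma wedge_zero_left [simp]: "wedge (\<lambda>I. 0) v I = 0"
  by (simp add: wedge_def)

lemma wedge_comb_right: "wedge w (fscale c u + v) I = c * wedge w u I + wedge w v I"
  by (simp add: wedge_def fscale_apply sum_distrib_left sum.distrib[symmetric] algebra_simps)

lemma wedge_scale_left: "wedge (\<lambda>I. c * w I) v I = c * wedge w v I"
  by (simp add: wedge_def sum_distrib_left algebra_simps)

definition dsign :: "nat set \<Rightarrow> nat \<Rightarrow> nat \<Rightarrow> 'b::field" where
  "dsign I r s = (- 1) ^ card {x\<in>I. r < x} * (- 1) ^ card {x\<in>I - {r}. s < x}"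

text \<open>For \<open>r < s\<close>, deleting \<open>s\<close> first removes one row from those
  counted after \<open>r\<close>, whereas the rows after \<open>s\<close> are the same with or
  without \<open>r\<close>.\<close>

lemma dsign_swap:
  assumes "finite I" "r \<in> I" "s \<in> I" "r \<noteq> s"
  shows "dsign I s r = - (dsign I r s :: 'b::field)"
proof -
  have *: "dsign I s r = - (dsign I r s :: 'b)" if "r \<in> I" "s \<in> I" "r < s" for r s
  proof -
    have "{x\<in>I. r < x} = insert s {x\<in>I - {s}. r < x}" using that by auto
    then have "card {x\<in>I. r < x} = Suc (card {x\<in>I - {s}. r < x})" using assms(1) by simp
    moreover have "{x\<in>I - {r}. s < x} = {x\<in>I. s < x}" using that by auto
    ultimately show ?thesis by (simp add: dsign_def)
  qed
  show ?thesis
    using *[of r s] *[of s r] assms by (cases "r < s") auto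
qed

lemma wedge_wedge:
  "wedge (wedge w u) v I = (\<Sum>r\<in>I. \<Sum>s\<in>I. if r = s then 0 else dsign I r s * w (I - {r} - {s}) * u s * v r)"
proof (cases "finite I")
  case True
  have "(- 1) ^ card {s\<in>I. r < s} * wedge w u (I - {r}) * v r =
      (\<Sum>s\<in>I. if r = s then 0 else dsign I r s * w (I - {r} - {s}) * u s * v r)" if "r \<in> I" for r
  proof -
    have "(- 1) ^ card {s\<in>I. r < s} * wedge w u (I - {r}) * v r =
        (\<Sum>s\<in>I - {r}. dsign I r s * w (I - {r} - {s}) * u s * v r)"
      by (simp add: wedge_def dsign_def sum_distrib_left sum_distrib_right mult.assoc)
    also have "\<dots> = (\<Sum>s\<in>I. if r = s then 0 else dsign I r s * w (I - {r} - {s}) * u s * v r)"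
      using True by (intro sum.mono_neutral_cong_left) auto
    finally show ?thesis .
  qed
  then show ?thesis unfolding wedge_def[of "wedge w u"] by (rule sum.cong[OF refl])
qed simp

lemma wedge_swap: "wedge (wedge w u) v I = - wedge (wedge w v) u I"
proof (cases "finite I")
  case True
  have "wedge (wedge w u) v I =
      (\<Sum>s\<in>I. \<Sum>r\<in>I. if r = s then 0 else dsign I r s * w (I - {r} - {s}) * u s * v r)"
    unfolding wedge_wedge by (rule sum.swap)
  also have "\<dots> = (\<Sum>s\<in>I. \<Sum>r\<in>I. - (if s = r then 0 else dsign I s r * w (I - {s} - {r}) * v r * u s))"
  proof (intro sum.cong refl)
    fix s r assume "s \<in> I" "r \<in> I"
    moreover have "I - {r} - {s} = I - {s} - {r}" by auto
    ultimately show "(if r = s then 0 else dsign I r s * w (I - {r} - {s}) * u s * v r) =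
        - (if s = r then 0 else dsign I s r * w (I - {s} - {r}) * v r * u s)"
      using dsign_swap[OF True, of s r, where 'b = 'a] by (simp add: ac_simps)
  qed
  also have "\<dots> = - wedge (wedge w v) u I"
    unfolding wedge_wedge by (simp only: sum_negf)
  finally show ?thesis .
qed simp

text \<open>In characteristic 2 antisymmetry alone does not annihilate the diagonal, so its
  vanishing is assumed. \<open>wedge_same\<close> is drawn from this sum, since
  \<open>wedge_swap\<close> would only show that twice the value is zero.\<close>

lemma sum_antisymmetric_eq_0:
  fixes g :: "'i \<Rightarrow> 'i \<Rightarrow> 'b::ab_group_add"
  assumes "finite I" "\<And>r. r \<in> I \<Longrightarrow> g r r = 0" "\<And>r s. r \<in> I \<Longrightarrow> s \<in> I \<Longrightarrow> g s r = - g r s"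
  shows "(\<Sum>r\<in>I. \<Sum>s\<in>I. g r s) = 0"
  using assms
proof (induction I rule: finite_induct)
  case (insert a I)
  have "(\<Sum>r\<in>I. g r a) = (\<Sum>r\<in>I. - g a r)"
    by (intro sum.cong refl insert.prems(2)) auto
  then have row: "(\<Sum>r\<in>I. g r a) = - (\<Sum>s\<in>I. g a s)" by (simp only: sum_negf)
  have IH: "(\<Sum>r\<in>I. \<Sum>s\<in>I. g r s) = 0"
    by (rule insert.IH; rule insert.prems; simp)
  have diag: "g a a = 0" by (rule insert.prems(1)) simp
  show ?case
    by (simp only: sum.insert[OF insert.hyps] sum.distrib row IH diag) simp
next
  case empty
  show ?case by (simp only: sum.empty)
qed

lemma wedge_same: "wedge (wedge w v) v I = 0"
proof (cases "finite I")
  case True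
  show ?thesis unfolding wedge_wedge
  proof (rule sum_antisymmetric_eq_0[OF True])
    fix r s assume "r \<in> I" "s \<in> I"
    moreover have "I - {r} - {s} = I - {s} - {r}" by auto
    ultimately show "(if s = r then 0 else dsign I s r * w (I - {s} - {r}) * v r * v s) =
        - (if r = s then 0 else dsign I r s * w (I - {r} - {s}) * v s * v r)"
      using dsign_swap[OF True, of s r, where 'b = 'a] by (simp add: mult.assoc mult.commute)
  qed simp
qed simp

lemma wedges_move_front: "wedges (us @ x # vs) I = (- 1) ^ length us * wedges (x # us @ vs) I"
proof (induction us arbitrary: I)
  case (Cons u us)
  have "wedges (us @ x # vs) = (\<lambda>I. (- 1) ^ length us * wedges (x # us @ vs) I)"
    by (rule ext) (rule Cons.IH)
  then have "wedges ((u # us) @ x # vs) I = wedge (\<lambda>I. (- 1) ^ length us * wedges (x # us @ vs) I) u I"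
    by simp
  also have "\<dots> = (- 1) ^ length us * wedge (wedge (wedges (us @ vs)) x) u I"
    by (simp add: wedge_scale_left)
  also have "\<dots> = (- 1) ^ length (u # us) * wedges (x # (u # us) @ vs) I"
    by (subst wedge_swap) simp
  finally show ?case .
qed simp

lemma wedges_eq_0_if_not_distinct: "\<not> distinct vs \<Longrightarrow> wedges (map \<phi> vs) I = 0"
proof -
  assume "\<not> distinct vs"
  then obtain xs ys zs y where vs: "vs = xs @ [y] @ ys @ [y] @ zs"
    using not_distinct_decomp by blast
  have "wedges (map \<phi> xs @ \<phi> y # (map \<phi> ys @ \<phi> y # map \<phi> zs)) I =
      (- 1) ^ length xs * wedges (((\<phi> y # map \<phi> xs) @ map \<phi> ys) @ \<phi> y # map \<phi> zs) I"
    by (simp add: wedges_move_front)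
  also have "\<dots> = 0"
    unfolding wedges_move_front by (simp add: wedge_same)
  finally show ?thesis by (simp add: vs)
qed

text \<open>The factor is the sign of a permutation. It is chosen before \<phi> and
  \<open>I\<close>, so that the same factor serves a list and its image under any map.\<close>

lemma wedges_permute:
  fixes xs ys :: "'v list"
  shows "mset xs = mset ys \<Longrightarrow>
    \<exists>c :: 'b::field. \<forall>\<phi> I. wedges (map \<phi> xs) I = c * wedges (map \<phi> ys) I"
proof (induction ys arbitrary: xs)
  case Nil
  then show ?case by (intro exI[of _ 1]) simp
next
  case (Cons y ys)
  then have "y \<in> set xs" by (metis list.set_intros(1) mset_eq_setD)
  then obtain a b where xs: "xs = a @ y # b" by (meson split_list)
  then have "mset (a @ b) = mset ys" using Cons.prems by simp
  from Cons.IH[OF this] obtain c :: 'b where c: "\<forall>\<phi> I. wedges (map \<phi> (a @ b)) I = c * wedges (map \<phi> ys) I"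
    by (rule exE)
  have "wedges (map \<phi> xs) I = ((- 1) ^ length a * c) * wedges (map \<phi> (y # ys)) I"
    for \<phi> :: "'v \<Rightarrow> nat \<Rightarrow> 'b" and I
  proof -
    have "wedges (map \<phi> xs) I = (- 1) ^ length a * wedge (wedges (map \<phi> (a @ b))) (\<phi> y) I"
      by (simp add: xs wedges_move_front)
    also have "wedges (map \<phi> (a @ b)) = (\<lambda>I. c * wedges (map \<phi> ys) I)"
      by (rule ext) (use c in blast)
    finally show ?thesis by (simp add: wedge_scale_left)
  qed
  then show ?case by (intro exI allI)
qed

definition flinear :: "((nat \<Rightarrow> 'b::field) \<Rightarrow> nat \<Rightarrow> 'b) \<Rightarrow> bool" where
  "flinear \<phi> \<longleftrightarrow> (\<forall>c u v. \<phi> (fscale c u + v) = fscale c (\<phi> u) + \<phi> v)"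

lemma flinear_0: "flinear \<phi> \<Longrightarrow> \<phi> 0 = 0"
proof -
  assume "flinear \<phi>"
  then have "\<phi> (fscale (- 1) 0 + 0) = fscale (- 1) (\<phi> 0) + \<phi> 0" unfolding flinear_def by blast
  then show ?thesis by (simp add: fv.scale_minus_left)
qed

text \<open>Passing from \<open>vs\<close> to a list of vectors in its span multiplies the wedge product by a
  determinant, which is not affected by applying a linear map to all vectors.\<close>

lemma wedges_in_span:
  assumes "set ys \<subseteq> fv.span (set vs)" "set zs \<subseteq> set vs" "length ys + length zs = length vs"
  shows "\<exists>c. \<forall>\<phi> I. flinear \<phi> \<longrightarrow> wedges (map \<phi> (ys @ zs)) I = c * wedges (map \<phi> vs) I"
  using assms
proof (induction ys arbitrary: zs)
  case Nil
  show ?case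
  proof (cases "distinct zs")
    case True
    then have "card (set vs) \<ge> length vs"
      using card_mono[OF _ Nil.prems(2)] Nil.prems(3) by (simp add: distinct_card)
    then have dv: "distinct vs" using card_length[of vs] by (simp add: card_distinct)
    have "set zs = set vs"
      using Nil.prems(2,3) True dv by (intro card_subset_eq) (auto simp: distinct_card)
    then have "mset zs = mset vs" using True dv by (simp add: set_eq_iff_mset_eq_distinct)
    from wedges_permute[OF this] show ?thesis by auto
  next
    case False
    show ?thesis
      by (intro exI[of _ 0] allI impI)
        (simp only: append_Nil mult_zero_left wedges_eq_0_if_not_distinct[OF False])
  qed
next
  case (Cons y ys)
  define P where "P x \<longleftrightarrow> (\<exists>c. \<forall>\<phi> I. flinear \<phi> \<longrightarrow> wedges (map \<phi> (x # ys @ zs)) I = c * wedges (map \<phi> vs) I)" for x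
  \<comment> \<open>An entry \<open>x\<close> of \<open>vs\<close> is moved behind
    \<open>ys\<close>, where it counts as a further entry of \<open>zs\<close> for the induction
    hypothesis; this costs a sign. Linearity in the first factor then extends the claim to the
    span.\<close>
  have base: "P x" if "x \<in> set vs" for x
  proof -
    have "\<exists>c. \<forall>\<phi> I. flinear \<phi> \<longrightarrow> wedges (map \<phi> (ys @ (x # zs))) I = c * wedges (map \<phi> vs) I"
      using Cons.prems that by (intro Cons.IH) auto
    then obtain c where c: "\<forall>\<phi> I. flinear \<phi> \<longrightarrow> wedges (map \<phi> (ys @ (x # zs))) I = c * wedges (map \<phi> vs) I"
      by (rule exE)
    have "wedges (map \<phi> (x # ys @ zs)) I = ((- 1) ^ length ys * c) * wedges (map \<phi> vs) I"
      if "flinear \<phi>" for \<phi> I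
    proof -
      have "(- 1) ^ length ys * wedges (map \<phi> (x # ys @ zs)) I = c * wedges (map \<phi> vs) I"
        using c that by (simp add: wedges_move_front)
      then have "(- 1) ^ length ys * ((- 1) ^ length ys * wedges (map \<phi> (x # ys @ zs)) I) =
          (- 1) ^ length ys * (c * wedges (map \<phi> vs) I)" by simp
      then show ?thesis by (simp add: mult.assoc[symmetric] power_add[symmetric])
    qed
    then show ?thesis unfolding P_def by (intro exI allI impI)
  qed
  have "y \<in> fv.span (set vs)" using Cons.prems(1) by simp
  then have "P y"
  proof (induction rule: fv.span_induct_alt)
    case base
    show ?case unfolding P_def by (intro exI[of _ 0] allI impI)
      (simp only: list.map wedges.simps flinear_0 wedge_zero_right mult_zero_left)
  next
    case (step a x y)
    from step(2) obtain c where c: "\<forall>\<phi> I. flinear \<phi> \<longrightarrow> wedges (map \<phi> (y # ys @ zs)) I = c * wedges (map \<phi> vs) I"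
      unfolding P_def by (rule exE)
    from base[OF step(1)] obtain c' where
      c': "\<forall>\<phi> I. flinear \<phi> \<longrightarrow> wedges (map \<phi> (x # ys @ zs)) I = c' * wedges (map \<phi> vs) I"
      unfolding P_def by (rule exE)
    have "wedges (map \<phi> ((fscale a x + y) # ys @ zs)) I = (a * c' + c) * wedges (map \<phi> vs) I"
      if "flinear \<phi>" for \<phi> I
    proof -
      have "\<phi> (fscale a x + y) = fscale a (\<phi> x) + \<phi> y" using that unfolding flinear_def by blast
      moreover have "wedges (map \<phi> (y # ys @ zs)) I = c * wedges (map \<phi> vs) I"
        "wedges (map \<phi> (x # ys @ zs)) I = c' * wedges (map \<phi> vs) I"
        using c c' that by blast+
      ultimately show ?thesis
        by (simp add: wedge_comb_right distrib_right mult.assoc)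
    qed
    then show ?case unfolding P_def by (intro exI allI impI)
  qed
  then show ?case unfolding P_def by simp
qed

section \<open>Linear independence and nonvanishing wedge products\<close>

lemma wedge_wedges_in_span_eq_0:
  assumes "v \<in> fv.span (set vs)"
  shows "wedge (wedges vs) v I = 0"
  using assms
proof (induction rule: fv.span_induct_alt)
  case (step c x y)
  from step(1) obtain a b where "vs = a @ x # b" by (meson split_list)
  then have "\<not> distinct (x # vs)" by simp
  from wedges_eq_0_if_not_distinct[OF this, of "\<lambda>x. x"] have "wedge (wedges vs) x I = 0" by simp
  then show ?case using step(2) by (simp only: wedge_comb_right) simp
qed (rule wedge_zero_right)

lemma wedges_nonzero_imp_independent:
  assumes "wedges vs I \<noteq> 0"
  shows "distinct vs \<and> fv.independent (set vs)"
  using assms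
proof (induction vs arbitrary: I)
  case Nil
  then show ?case by (simp add: fv.independent_empty)
next
  case (Cons v vs)
  have "\<exists>J. wedges vs J \<noteq> 0"
  proof (rule ccontr)
    assume "\<not> ?thesis"
    then have "wedges vs = (\<lambda>I. 0)" by auto
    then show False using Cons.prems by simp
  qed
  then have "distinct vs \<and> fv.independent (set vs)" using Cons.IH by auto
  moreover have "v \<notin> fv.span (set vs)"
    using Cons.prems wedge_wedges_in_span_eq_0[of v vs I] by auto
  ultimately show ?case
    using fv.span_base[of v "set vs"] fv.independent_insertI[of v "set vs"] by auto
qed

lemma wedges_append_eq_0:
  "(\<And>I. wedges vs I = 0) \<Longrightarrow> wedges (us @ vs) I = 0"
proof (induction us arbitrary: I)
  case (Cons u us)
  then have "wedges (us @ vs) = (\<lambda>I. 0)" by auto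
  then show ?case by simp
qed simp

lemma wedges_support:
  assumes "wedges vs I \<noteq> 0" "\<And>v i. v \<in> set vs \<Longrightarrow> i \<notin> A \<Longrightarrow> v i = 0"
  shows "finite I \<and> card I = length vs \<and> I \<subseteq> A"
  using assms
proof (induction vs arbitrary: I)
  case Nil
  then show ?case by (auto split: if_splits)
next
  case (Cons v vs)
  have "finite I" using Cons.prems(1) by (metis wedges.simps(2) wedge_infinite)
  obtain r where r: "r \<in> I" "wedges vs (I - {r}) \<noteq> 0" "v r \<noteq> 0"
  proof -
    have "\<exists>r\<in>I. (- 1) ^ card {s\<in>I. r < s} * wedges vs (I - {r}) * v r \<noteq> 0"
      using Cons.prems(1) unfolding wedges.simps wedge_def by (meson sum.neutral)
    then show ?thesis using that by auto
  qed
  have "finite (I - {r}) \<and> card (I - {r}) = length vs \<and> I - {r} \<subseteq> A"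
    by (rule Cons.IH[OF r(2)]) (use Cons.prems(2) in auto)
  moreover have "r \<in> A" using r(3) Cons.prems(2) by auto
  moreover have "card I = Suc (card (I - {r}))" by (rule card.remove[OF \<open>finite I\<close> r(1)])
  ultimately show ?case using \<open>finite I\<close> by auto
qed

definition unit_vec :: "nat \<Rightarrow> nat \<Rightarrow> 'b::field" where
  "unit_vec i = (\<lambda>j. if j = i then 1 else 0)"

lemma wedges_unit_vec:
  "distinct xs \<Longrightarrow> wedges (map unit_vec xs) (set xs) \<noteq> (0 :: 'b::field)"
proof (induction xs)
  case (Cons x xs)
  let ?I = "insert x (set xs)"
  have "wedges (map unit_vec (x # xs)) (set (x # xs)) =
      (\<Sum>r\<in>?I. if r = x then (- 1) ^ card {s\<in>?I. x < s} * wedges (map unit_vec xs) (?I - {x}) else (0::'b))"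
    unfolding wedges.simps list.map list.set wedge_def
    by (intro sum.cong) (auto simp: unit_vec_def)
  also have "\<dots> = (- 1) ^ card {s\<in>?I. x < s} * wedges (map unit_vec xs) (set xs)"
    using Cons.prems by simp
  finally show ?case using Cons by simp
qed simp

lemma supported_in_span_unit_vec:
  fixes v :: "nat \<Rightarrow> 'b::field"
  assumes "\<And>i. i \<ge> n \<Longrightarrow> v i = 0"
  shows "v \<in> fv.span (set (map unit_vec [0..<n]))"
proof -
  have "v = (\<Sum>i<n. fscale (v i) (unit_vec i))"
    using assms by (auto simp: fun_eq_iff sum_fun_apply fscale_apply unit_vec_def if_distrib not_less cong: if_cong)
  also have "\<dots> \<in> fv.span (set (map unit_vec [0..<n]))"
    by (intro fv.span_sum fv.span_scale fv.span_base) auto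
  finally show ?thesis .
qed

text \<open>Unit vectors \<open>us\<close> complete \<open>vs\<close> to a basis of the coordinate
  space of dimension \<open>n\<close>. The wedge product of all unit vectors is nonzero and is a
  multiple of that of \<open>us @ vs\<close>, whose inner factor is
  \<open>wedges vs\<close>.\<close>

lemma independent_imp_wedges_nonzero:
  fixes vs :: "(nat \<Rightarrow> 'b::field) list"
  assumes ind: "fv.independent (set vs)" and dist: "distinct vs"
    and supp: "\<And>v i. v \<in> set vs \<Longrightarrow> i \<ge> n \<Longrightarrow> v i = 0"
  shows "\<exists>I. wedges vs I \<noteq> 0"
proof -
  let ?es = "map unit_vec [0..<n] :: (nat \<Rightarrow> 'b) list"
  let ?V = "set ?es \<union> set vs"
  have es: "wedges ?es {0..<n} \<noteq> 0" using wedges_unit_vec[of "[0..<n]"] by simp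
  then have dE: "distinct ?es" and iE: "fv.independent (set ?es)"
    using wedges_nonzero_imp_independent by blast+
  obtain B where B: "set vs \<subseteq> B" "B \<subseteq> ?V" "fv.independent B" "?V \<subseteq> fv.span B"
    using fv.maximal_independent_subset_extend[of "set vs" ?V] ind by blast
  have "?V \<subseteq> fv.span (set ?es)"
    using supported_in_span_unit_vec supp fv.span_base by blast
  then have "B \<subseteq> fv.span (set ?es)" using B(2) by blast
  then have fB: "finite B" "card B \<le> card (set ?es)"
    using fv.independent_span_bound[of "set ?es" B] B(3) by blast+
  have "set ?es \<subseteq> fv.span B" using B(4) by blast
  then have "card (set ?es) \<le> card B" using fv.independent_span_bound[OF fB(1) iE] by auto
  then have cB: "card B = length ?es" using fB(2) distinct_card[OF dE] by simp
  obtain us where us: "set us = B - set vs" "distinct us"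
    using finite_distinct_list[of "B - set vs"] fB(1) by auto
  have sus: "set (us @ vs) = B" using us B(1) by auto
  have "distinct (us @ vs)" using us dist by auto
  from distinct_card[OF this] have "length (us @ vs) = card B" unfolding sus by simp
  then have "\<exists>c. \<forall>\<phi> I. flinear \<phi> \<longrightarrow> wedges (map \<phi> (?es @ [])) I = c * wedges (map \<phi> (us @ vs)) I"
    using B(4) cB sus by (intro wedges_in_span) auto
  then obtain c where c: "\<And>\<phi> I. flinear \<phi> \<Longrightarrow> wedges (map \<phi> (?es @ [])) I = c * wedges (map \<phi> (us @ vs)) I"
    by auto
  have "flinear (\<lambda>v. v :: nat \<Rightarrow> 'b)" by (simp add: flinear_def)
  from c[OF this, of "{0..<n}"] es have "wedges (us @ vs) {0..<n} \<noteq> 0"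
    by (auto simp: list.map_ident)
  then show ?thesis using wedges_append_eq_0 by metis
qed

lemma span_eq_if_subset_length_eq:
  assumes ind: "fv.independent (set vs)" "distinct vs" and len: "length us \<le> length vs"
    and sub: "fv.span (set vs) \<subseteq> fv.span (set us)"
  shows "fv.span (set vs) = fv.span (set us)"
proof (rule ccontr)
  assume "\<not> ?thesis"
  then have "\<not> set us \<subseteq> fv.span (set vs)" using sub fv.span_minimal[OF _ fv.subspace_span] by blast
  then obtain x where x: "x \<in> set us" "x \<notin> fv.span (set vs)" by auto
  then have "fv.independent (insert x (set vs))" using ind(1) by (simp add: fv.independent_insertI)
  moreover have "insert x (set vs) \<subseteq> fv.span (set us)"
    using x(1) sub fv.span_superset[of "set vs"] fv.span_base[of x "set us"] by auto
  ultimately have "card (insert x (set vs)) \<le> card (set us)"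
    using fv.independent_span_bound[of "set us"] by auto
  moreover have "x \<notin> set vs" using x(2) fv.span_base by auto
  ultimately show False
    using distinct_card[OF ind(2)] card_length[of us] len by simp
qed

section \<open>Minors under row operations\<close>

lemma wedges_scale_rows:
  "wedges (map (\<lambda>v i. t i * v i) vs) I = (\<Prod>i\<in>I. t i) * wedges vs I"
proof (induction vs arbitrary: I)
  case (Cons v vs)
  show ?case
  proof (cases "finite I")
    case True
    have "wedges (map (\<lambda>v i. t i * v i) (v # vs)) I =
        (\<Sum>r\<in>I. (\<Prod>i\<in>I. t i) * ((- 1) ^ card {s\<in>I. r < s} * wedges vs (I - {r}) * v r))"
      unfolding wedges.simps list.map wedge_def Cons.IH
    proof (intro sum.cong refl)
      fix r assume "r \<in> I"
      then have "prod t I = t r * prod t (I - {r})" by (rule prod.remove[OF True])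
      then show "(- 1) ^ card {s\<in>I. r < s} * (prod t (I - {r}) * wedges vs (I - {r})) * (t r * v r) =
          prod t I * ((- 1) ^ card {s\<in>I. r < s} * wedges vs (I - {r}) * v r)"
        by (simp add: algebra_simps)
    qed
    then show ?thesis by (simp add: wedge_def sum_distrib_left)
  qed simp
qed simp

lemma wedges_replace_row_outside:
  "r \<notin> I \<Longrightarrow> wedges (map (\<lambda>v. v(r := g v)) vs) I = wedges vs I"
proof (induction vs arbitrary: I)
  case (Cons v vs)
  then show ?case by (auto simp: wedge_def intro!: sum.cong)
qed simp

lemma wedges_replace_row_sum:
  assumes "0 \<in> I"
  shows "wedges (map (\<lambda>v. v(0 := \<Sum>i\<in>A. c i * v i)) vs) I =
    (\<Sum>i\<in>A. c i * wedges (map (\<lambda>v. v(0 := v i)) vs) I)"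
  using assms
proof (induction vs arbitrary: I)
  case (Cons v vs)
  let ?vs = "\<lambda>i. map (\<lambda>v. v(0 := v i)) vs"
  have "(- 1) ^ card {s\<in>I. r < s} * wedges (map (\<lambda>v. v(0 := \<Sum>i\<in>A. c i * v i)) vs) (I - {r}) * (v(0 := \<Sum>i\<in>A. c i * v i)) r =
      (\<Sum>i\<in>A. c i * ((- 1) ^ card {s\<in>I. r < s} * wedges (?vs i) (I - {r}) * (v(0 := v i)) r))" if "r \<in> I" for r
  proof (cases "r = 0")
    case True
    then show ?thesis
      by (simp add: wedges_replace_row_outside sum_distrib_left sum_distrib_right algebra_simps)
  next
    case False
    then have "0 \<in> I - {r}" using Cons.prems by auto
    from Cons.IH[OF this] show ?thesis using False
      by (simp only: fun_upd_other[OF False] sum_distrib_left sum_distrib_right)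
        (simp add: algebra_simps)
  qed
  then have "wedges (map (\<lambda>v. v(0 := \<Sum>i\<in>A. c i * v i)) (v # vs)) I =
      (\<Sum>r\<in>I. \<Sum>i\<in>A. c i * ((- 1) ^ card {s\<in>I. r < s} * wedges (?vs i) (I - {r}) * (v(0 := v i)) r))"
    unfolding wedges.simps list.map wedge_def by (intro sum.cong refl)
  also have "\<dots> = (\<Sum>i\<in>A. c i * wedges (map (\<lambda>v. v(0 := v i)) (v # vs)) I)"
    by (subst sum.swap) (simp add: wedge_def sum_distrib_left)
  finally show ?case .
qed auto

lemma card_split_at:
  fixes i :: nat
  assumes "finite J" "i \<notin> J"
  shows "card J = card {s\<in>J. s < i} + card {s\<in>J. i < s}"
proof -
  have "s \<in> {s\<in>J. s < i} \<union> {s\<in>J. i < s} \<longleftrightarrow> s \<in> J" for s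
    using assms(2) by (cases s i rule: linorder_cases) auto
  then have "{s\<in>J. s < i} \<union> {s\<in>J. i < s} = J" by blast
  moreover have "card ({s\<in>J. s < i} \<union> {s\<in>J. i < s}) = card {s\<in>J. s < i} + card {s\<in>J. i < s}"
    using assms(1) by (intro card_Un_disjoint) auto
  ultimately show ?thesis by (simp only:)
qed

text \<open>Row 0 has become a copy of row \<open>i\<close>. Moving it to its place in
  \<open>insert i J\<close> passes exactly the rows of \<open>J\<close> before \<open>i\<close>,
  which accounts for the sign.\<close>

lemma wedges_replace_row:
  assumes "0 \<notin> J" "i \<notin> J" "i \<noteq> 0" "finite J"
  shows "wedges (map (\<lambda>v. v(0 := v i)) vs) (insert 0 J) =
    (- 1) ^ card {s\<in>J. s < i} * wedges vs (insert i J)"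
  using assms
proof (induction vs arbitrary: J)
  case (Cons v vs)
  let ?vs = "map (\<lambda>v. v(0 := v i)) vs"
  have gt0: "{s\<in>insert 0 J. 0 < s} = J" 
  proof (rule set_eqI)
    fix s show "s \<in> {s\<in>insert 0 J. 0 < s} \<longleftrightarrow> s \<in> J"
      using Cons.prems(1) by (cases s) auto
  qed
  have "wedges (map (\<lambda>v. v(0 := v i)) (v # vs)) (insert 0 J) =
      (- 1) ^ card J * wedges vs J * v i +
      (\<Sum>r\<in>J. (- 1) ^ card {s\<in>insert 0 J. r < s} * wedges ?vs (insert 0 J - {r}) * (v(0 := v i)) r)"
    unfolding wedges.simps list.map wedge_def
    using Cons.prems gt0 by (simp add: wedges_replace_row_outside)
  also have "(\<Sum>r\<in>J. (- 1) ^ card {s\<in>insert 0 J. r < s} * wedges ?vs (insert 0 J - {r}) * (v(0 := v i)) r) =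
      (\<Sum>r\<in>J. (- 1) ^ card {s\<in>J. s < i} * ((- 1) ^ card {s\<in>insert i J. r < s} * wedges vs (insert i J - {r}) * v r))"
  proof (intro sum.cong refl)
    fix r assume r: "r \<in> J"
    have r0: "r \<noteq> 0" "r \<noteq> i" using r Cons.prems by metis+
    have e1: "insert 0 J - {r} = insert 0 (J - {r})" "insert i J - {r} = insert i (J - {r})"
      using r0 by auto
    have e2: "{s\<in>insert 0 J. r < s} = {s\<in>J. r < s}" by auto
    have IH: "wedges ?vs (insert 0 (J - {r})) = (- 1) ^ card {s\<in>J - {r}. s < i} * wedges vs (insert i (J - {r}))"
      using Cons.prems by (intro Cons.IH) auto
    \<comment> \<open>For \<open>r < i\<close> two counts change by one, as \<open>r\<close> leaves
      the rows before \<open>i\<close> and \<open>i\<close> joins the rows after \<open>r\<close>,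
      and the signs cancel; otherwise neither count changes.\<close>
    have sgn: "(- 1) ^ card {s\<in>J. r < s} * (- 1) ^ card {s\<in>J - {r}. s < i} =
        (- 1 :: 'a) ^ card {s\<in>J. s < i} * (- 1) ^ card {s\<in>insert i J. r < s}"
    proof (cases "r < i")
      case True
      have "{s\<in>insert i J. r < s} = insert i {s\<in>J. r < s}" using True by auto
      then have "card {s\<in>insert i J. r < s} = Suc (card {s\<in>J. r < s})" using Cons.prems by simp
      moreover have "{s\<in>J. s < i} = insert r {s\<in>J - {r}. s < i}" using True r by auto
      then have "card {s\<in>J. s < i} = Suc (card {s\<in>J - {r}. s < i})" using Cons.prems by simp
      ultimately show ?thesis by simp
    next
      case False
      then have "{s\<in>insert i J. r < s} = {s\<in>J. r < s}" "{s\<in>J. s < i} = {s\<in>J - {r}. s < i}"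
        using r0 by auto
      then show ?thesis by simp
    qed
    show "(- 1) ^ card {s\<in>insert 0 J. r < s} * wedges ?vs (insert 0 J - {r}) * (v(0 := v i)) r =
        (- 1) ^ card {s\<in>J. s < i} * ((- 1) ^ card {s\<in>insert i J. r < s} * wedges vs (insert i J - {r}) * v r)"
      unfolding e1 e2 IH using r0 sgn by (simp add: mult.assoc[symmetric])
  qed
  also have "(- 1) ^ card J * wedges vs J * v i =
      (- 1) ^ card {s\<in>J. s < i} * ((- 1) ^ card {s\<in>insert i J. i < s} * wedges vs (insert i J - {i}) * v i)"
  proof -
    have e: "insert i J - {i} = J" "{s\<in>insert i J. i < s} = {s\<in>J. i < s}" using Cons.prems by auto
    have "card J = card {s\<in>J. s < i} + card {s\<in>J. i < s}"
      by (rule card_split_at) (use Cons.prems in auto)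
    then show ?thesis unfolding e by (simp add: power_add mult.assoc)
  qed
  also have "(- 1) ^ card {s\<in>J. s < i} * ((- 1) ^ card {s\<in>insert i J. i < s} * wedges vs (insert i J - {i}) * v i) +
      (\<Sum>r\<in>J. (- 1) ^ card {s\<in>J. s < i} * ((- 1) ^ card {s\<in>insert i J. r < s} * wedges vs (insert i J - {r}) * v r)) =
      (- 1) ^ card {s\<in>J. s < i} * wedges (v # vs) (insert i J)"
    unfolding wedges.simps wedge_def
    using Cons.prems by (simp add: sum_distrib_left distrib_left)
  finally show ?case .
qed auto

text \<open>Alternation in the rows, whereas \<open>wedge_same\<close> concerns the columns. In the
  expansion along a column the terms of rows 0 and \<open>i\<close> cancel, and the others vanish by
  induction.\<close>

lemma wedges_repeated_row:
  assumes "0 \<notin> J" "i \<in> J" "finite J"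
  shows "wedges (map (\<lambda>v. v(0 := v i)) vs) (insert 0 J) = 0"
  using assms
proof (induction vs arbitrary: J)
  case (Cons v vs)
  let ?vs = "map (\<lambda>v. v(0 := v i)) vs"
  have i0: "i \<noteq> 0" using Cons.prems by metis
  have gt0: "{s\<in>insert 0 J. 0 < s} = J" 
  proof (rule set_eqI)
    fix s show "s \<in> {s\<in>insert 0 J. 0 < s} \<longleftrightarrow> s \<in> J"
      using Cons.prems(1) by (cases s) auto
  qed
  have "wedges (map (\<lambda>v. v(0 := v i)) (v # vs)) (insert 0 J) =
      (- 1) ^ card J * wedges vs J * v i +
      (\<Sum>r\<in>J. (- 1) ^ card {s\<in>insert 0 J. r < s} * wedges ?vs (insert 0 J - {r}) * (v(0 := v i)) r)"
    unfolding wedges.simps list.map wedge_def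
    using Cons.prems gt0 by (simp add: wedges_replace_row_outside)
  also have "(\<Sum>r\<in>J. (- 1) ^ card {s\<in>insert 0 J. r < s} * wedges ?vs (insert 0 J - {r}) * (v(0 := v i)) r) =
      (\<Sum>r\<in>J. if r = i then - ((- 1) ^ card J * wedges vs J * v i) else 0)"
  proof (intro sum.cong refl)
    fix r assume r: "r \<in> J"
    have r0: "r \<noteq> 0" using r Cons.prems by metis
    have e1: "insert 0 J - {r} = insert 0 (J - {r})" using r0 by auto
    have e2: "{s\<in>insert 0 J. r < s} = {s\<in>J. r < s}" by auto
    show "(- 1) ^ card {s\<in>insert 0 J. r < s} * wedges ?vs (insert 0 J - {r}) * (v(0 := v i)) r =
        (if r = i then - ((- 1) ^ card J * wedges vs J * v i) else 0)"
    proof (cases "r = i")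
      case True
      have "wedges ?vs (insert 0 (J - {i})) = (- 1) ^ card {s\<in>J - {i}. s < i} * wedges vs (insert i (J - {i}))"
        using Cons.prems i0 by (intro wedges_replace_row) auto
      moreover have "insert i (J - {i}) = J" "{s\<in>J - {i}. s < i} = {s\<in>J. s < i}" using Cons.prems by auto
      moreover have "card J = Suc (card {s\<in>J. s < i} + card {s\<in>J. i < s})"
      proof -
        have "card (J - {i}) = card {s\<in>J - {i}. s < i} + card {s\<in>J - {i}. i < s}"
          by (rule card_split_at) (use Cons.prems in auto)
        moreover have "{s\<in>J - {i}. s < i} = {s\<in>J. s < i}" "{s\<in>J - {i}. i < s} = {s\<in>J. i < s}"
          by auto
        ultimately show ?thesis using card.remove[OF Cons.prems(3,2)] by simp
      qed
      ultimately show ?thesis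
        using True i0 unfolding e1 e2 by (simp add: power_add algebra_simps)
    next
      case False
      then have "wedges ?vs (insert 0 (J - {r})) = 0" using Cons.prems by (intro Cons.IH) auto
      then show ?thesis using False unfolding e1 by simp
    qed
  qed
  also have "\<dots> = - ((- 1) ^ card J * wedges vs J * v i)" using Cons.prems by simp
  finally show ?case by simp
qed auto

section \<open>Coefficient bounds, integral vectors and monomials\<close>

text \<open>Boundedness is measured against the values on \<open>Y\<close> alone, so that a bound on
  the support points of a ball can control the coefficients of a combination.\<close>

definition bounded_functional :: "'x set \<Rightarrow> (('x \<Rightarrow> 'a::field fls) \<Rightarrow> 'a fls) \<Rightarrow> bool" where
  "bounded_functional Y l \<longleftrightarrow> (\<forall>c u v. l (\<lambda>y. c * u y + v y) = c * l u + l v) \<and>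
     (\<exists>K\<ge>0. \<forall>h b. 0 \<le> b \<longrightarrow> (\<forall>y\<in>Y. fls_abs (h y) \<le> b) \<longrightarrow> fls_abs (l h) \<le> K * b)"

lemma bounded_functionalD:
  assumes "bounded_functional Y l"
  shows "l (\<lambda>y. c * u y + v y) = c * l u + l v"
    and "\<exists>K\<ge>0. \<forall>h b. 0 \<le> b \<longrightarrow> (\<forall>y\<in>Y. fls_abs (h y) \<le> b) \<longrightarrow> fls_abs (l h) \<le> K * b"
  using assms unfolding bounded_functional_def by simp_all

lemma bounded_functional_eval: "y \<in> Y \<Longrightarrow> bounded_functional Y (\<lambda>h. h y)"
  unfolding bounded_functional_def by (intro conjI exI[of _ 1]) auto

lemma bounded_functional_zero: "bounded_functional Y (\<lambda>h. 0)"
  unfolding bounded_functional_def by (intro conjI exI[of _ 0]) auto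

lemma bounded_functional_comb:
  fixes l l' :: "('x \<Rightarrow> 'a::field fls) \<Rightarrow> 'a fls"
  assumes "bounded_functional Y l" "bounded_functional Y l'"
  shows "bounded_functional Y (\<lambda>h. a * l h + l' h)"
  unfolding bounded_functional_def
proof (intro conjI allI)
  fix c u v
  show "a * l (\<lambda>y. c * u y + v y) + l' (\<lambda>y. c * u y + v y) = c * (a * l u + l' u) + (a * l v + l' v)"
    unfolding bounded_functionalD(1)[OF assms(1)] bounded_functionalD(1)[OF assms(2)]
    by (simp add: algebra_simps)
next
  obtain K where K: "K \<ge> 0" "\<And>h b. 0 \<le> b \<Longrightarrow> (\<forall>y\<in>Y. fls_abs (h y) \<le> b) \<Longrightarrow> fls_abs (l h) \<le> K * b"
    using bounded_functionalD(2)[OF assms(1)] by auto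
  obtain K' where K': "K' \<ge> 0" "\<And>h b. 0 \<le> b \<Longrightarrow> (\<forall>y\<in>Y. fls_abs (h y) \<le> b) \<Longrightarrow> fls_abs (l' h) \<le> K' * b"
    using bounded_functionalD(2)[OF assms(2)] by auto
  show "\<exists>K\<ge>0. \<forall>h b. 0 \<le> b \<longrightarrow> (\<forall>y\<in>Y. fls_abs (h y) \<le> b) \<longrightarrow> fls_abs (a * l h + l' h) \<le> K * b"
  proof (intro exI[of _ "fls_abs a * K + K'"] conjI allI impI)
    show "0 \<le> fls_abs a * K + K'" using K(1) K'(1) by simp
    fix h :: "'x \<Rightarrow> 'a fls" and b assume hb: "(0::real) \<le> b" "\<forall>y\<in>Y. fls_abs (h y) \<le> b"
    have "fls_abs (a * l h) \<le> fls_abs a * (K * b)"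
      unfolding fls_abs_mult by (intro mult_left_mono K(2)[OF hb]) simp
    moreover have "fls_abs (l' h) \<le> K' * b" by (rule K'(2)[OF hb])
    moreover have "0 \<le> fls_abs a * (K * b)" "0 \<le> K' * b" using K(1) K'(1) hb(1) by simp_all
    ultimately show "fls_abs (a * l h + l' h) \<le> (fls_abs a * K + K') * b"
      by (intro fls_abs_add_le) (simp_all add: algebra_simps)
  qed
qed

lemma bounded_functional_sum:
  assumes "\<And>i. i \<in> I \<Longrightarrow> bounded_functional Y (l i)"
  shows "bounded_functional Y (\<lambda>h. \<Sum>i\<in>I. a i * l i h)"
  using assms
proof (induction I rule: infinite_finite_induct)
  case (insert i I)
  then show ?case by (simp add: bounded_functional_comb)
qed (auto intro: bounded_functional_zero)

lemma bounded_functional_apply_sum: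
  assumes "bounded_functional Y l"
  shows "l (\<lambda>y. \<Sum>i\<in>I. c i * f i y) = (\<Sum>i\<in>I. c i * l (f i))"
proof (induction I rule: infinite_finite_induct)
  case (insert i I)
  then show ?case using bounded_functionalD(1)[OF assms, of "c i" "f i" "\<lambda>y. \<Sum>i\<in>I. c i * f i y"] by simp
next
  case empty
  have "l (\<lambda>y. (- 1) * 0 + 0) = (- 1) * l (\<lambda>y. 0) + l (\<lambda>y. 0)"
    using bounded_functionalD(1)[OF assms, of "- 1" "\<lambda>y. 0" "\<lambda>y. 0"] by simp
  then show ?case by simp
next
  case (infinite I)
  have "l (\<lambda>y. (- 1) * 0 + 0) = (- 1) * l (\<lambda>y. 0) + l (\<lambda>y. 0)"
    using bounded_functionalD(1)[OF assms, of "- 1" "\<lambda>y. 0" "\<lambda>y. 0"] by simp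
  then show ?case using infinite by simp
qed

text \<open>The functionals are linear combinations of evaluations at finitely many points, so that no
  compactness argument is needed to bound the coefficients.\<close>

lemma dual_functionals:
  fixes f :: "'i \<Rightarrow> 'x \<Rightarrow> 'a::field fls"
  assumes "finite I" "\<And>c. \<forall>y\<in>Y. (\<Sum>i\<in>I. c i * f i y) = 0 \<Longrightarrow> \<forall>i\<in>I. c i = 0"
  shows "\<exists>l. \<forall>i\<in>I. bounded_functional Y (l i) \<and> (\<forall>i'\<in>I. l i (f i') = (if i = i' then 1 else 0))"
  using assms
proof (induction I rule: finite_induct)
  case (insert g I)
  have "\<exists>l. \<forall>i\<in>I. bounded_functional Y (l i) \<and> (\<forall>i'\<in>I. l i (f i') = (if i = i' then 1 else 0))"
  proof (rule insert.IH)
    fix c assume c: "\<forall>y\<in>Y. (\<Sum>i\<in>I. c i * f i y) = 0"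
    have "(\<Sum>i\<in>I. (c(g := 0)) i * f i y) = (\<Sum>i\<in>I. c i * f i y)" for y
      using insert.hyps(2) by (intro sum.cong) auto
    then have "\<forall>i\<in>insert g I. (c(g := 0)) i = 0"
      using insert.hyps c by (intro insert.prems) simp
    then show "\<forall>i\<in>I. c i = 0" using insert.hyps(2) by (metis fun_upd_other insertI2)
  qed
  then obtain l where l0: "\<forall>i\<in>I. bounded_functional Y (l i) \<and> (\<forall>i'\<in>I. l i (f i') = (if i = i' then 1 else 0))"
    by (rule exE)
  have l: "bounded_functional Y (l i)" "i' \<in> I \<Longrightarrow> l i (f i') = (if i = i' then 1 else 0)" if "i \<in> I" for i i'
    using bspec[OF l0 that] by simp_all
  \<comment> \<open>These are the coefficients of \<open>f g\<close> minus its projection to the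
    earlier functions. By independence this combination is nonzero at some \<open>y\<close>;
    evaluation there, with the earlier components subtracted and divided by the value \<delta>, is
    dual to \<open>f g\<close>.\<close>
  define c where "c = (\<lambda>i. if i = g then 1 else - l i (f g))"
  have "\<exists>y\<in>Y. (\<Sum>i\<in>insert g I. c i * f i y) \<noteq> 0"
  proof (rule ccontr)
    assume "\<not> ?thesis"
    then have "\<forall>i\<in>insert g I. c i = 0" by (intro insert.prems) simp
    then show False by (simp add: c_def)
  qed
  then obtain y where y: "y \<in> Y" "(\<Sum>i\<in>insert g I. c i * f i y) \<noteq> 0" by auto
  define \<delta> where "\<delta> = f g y - (\<Sum>i\<in>I. l i (f g) * f i y)"
  have "(\<Sum>i\<in>I. c i * f i y) = (\<Sum>i\<in>I. - (l i (f g) * f i y))"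
    using insert.hyps(2) by (intro sum.cong) (auto simp: c_def)
  then have \<delta>: "\<delta> \<noteq> 0" using y(2) insert.hyps by (simp add: \<delta>_def c_def sum_negf)
  define lg where "lg = (\<lambda>h. inverse \<delta> * h y + (\<Sum>i\<in>I. (- inverse \<delta> * f i y) * l i h))"
  have lg: "bounded_functional Y lg"
    unfolding lg_def
    by (intro bounded_functional_comb bounded_functional_eval bounded_functional_sum l(1) y(1))
  have lg_eq: "lg h = inverse \<delta> * (h y - (\<Sum>i\<in>I. l i h * f i y))" for h
    by (simp add: lg_def right_diff_distrib sum_distrib_left sum_negf algebra_simps)
  have lgg: "lg (f g) = 1" using \<delta> by (simp add: lg_eq \<delta>_def[symmetric])
  have lgi: "lg (f i') = 0" if i': "i' \<in> I" for i'
  proof -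
    have "(\<Sum>i\<in>I. l i (f i') * f i y) = (\<Sum>i\<in>I. if i = i' then f i y else 0)"
      using l(2) i' by (intro sum.cong) auto
    also have "\<dots> = f i' y" using insert.hyps(1) i' by simp
    finally show ?thesis by (simp add: lg_eq)
  qed
  \<comment> \<open>The earlier functionals are corrected by multiples of \<open>lg\<close> so as to
    vanish on \<open>f g\<close>.\<close>
  define l' where "l' = (\<lambda>i. if i = g then lg else (\<lambda>h. (- l i (f g)) * lg h + l i h))"
  have "bounded_functional Y (l' i) \<and> (\<forall>i'\<in>insert g I. l' i (f i') = (if i = i' then 1 else 0))"
    if i: "i \<in> insert g I" for i
  proof (cases "i = g")
    case True
    then show ?thesis using lg lgg lgi insert.hyps(2) by (auto simp: l'_def)
  next
    case False
    then have "i \<in> I" using i by simp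
    moreover have "bounded_functional Y (\<lambda>h. (- l i (f g)) * lg h + l i h)"
      by (intro bounded_functional_comb lg l(1)) fact
    ultimately show ?thesis using False lgg lgi l(2) insert.hyps(2)
      by (auto simp: l'_def)
  qed
  then show ?case by (intro exI[of _ l'] ballI)
qed simp

text \<open>The dual functional of \<open>f i\<close> applied to the combination returns
  \<open>c i\<close>. The constant depends on \<open>Y\<close> and \<open>f\<close> only, hence
  serves all sublattices and all times at once.\<close>

lemma coefficients_bounded:
  fixes f :: "'i \<Rightarrow> 'x \<Rightarrow> 'a::field fls"
  assumes "finite I" "\<And>c. \<forall>y\<in>Y. (\<Sum>i\<in>I. c i * f i y) = 0 \<Longrightarrow> \<forall>i\<in>I. c i = 0"
  obtains K where "\<And>c i. i \<in> I \<Longrightarrow> \<forall>y\<in>Y. fls_abs (\<Sum>i\<in>I. c i * f i y) \<le> 1 \<Longrightarrow> fls_abs (c i) \<le> K"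
proof -
  obtain l where l0: "\<forall>i\<in>I. bounded_functional Y (l i) \<and> (\<forall>i'\<in>I. l i (f i') = (if i = i' then 1 else 0))"
    using dual_functionals[of I Y f, OF assms] by (rule exE)
  have l: "bounded_functional Y (l i)" "i' \<in> I \<Longrightarrow> l i (f i') = (if i = i' then 1 else 0)" if "i \<in> I" for i i'
    using bspec[OF l0 that] by simp_all
  have "\<forall>i\<in>I. \<exists>K\<ge>0. \<forall>h b. 0 \<le> b \<longrightarrow> (\<forall>y\<in>Y. fls_abs (h y) \<le> b) \<longrightarrow> fls_abs (l i h) \<le> K * b"
    using bounded_functionalD(2)[OF l(1)] by blast
  from bchoice[OF this] obtain K where
    K: "\<forall>i\<in>I. K i \<ge> 0 \<and> (\<forall>h b. 0 \<le> b \<longrightarrow> (\<forall>y\<in>Y. fls_abs (h y) \<le> b) \<longrightarrow> fls_abs (l i h) \<le> K i * b)"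
    by (rule exE)
  have "fls_abs (c i) \<le> sum K I" if i: "i \<in> I" and bd: "\<forall>y\<in>Y. fls_abs (\<Sum>i\<in>I. c i * f i y) \<le> 1" for c i
  proof -
    have "l i (\<lambda>y. \<Sum>i\<in>I. c i * f i y) = (\<Sum>i'\<in>I. c i' * l i (f i'))"
      by (rule bounded_functional_apply_sum[OF l(1)[OF i]])
    also have "\<dots> = (\<Sum>i'\<in>I. if i' = i then c i else 0)"
      using l(2)[OF i] by (intro sum.cong) auto
    also have "\<dots> = c i" using assms(1) i by simp
    finally have eq: "l i (\<lambda>y. \<Sum>i\<in>I. c i * f i y) = c i" .
    have "0 \<le> b \<longrightarrow> (\<forall>y\<in>Y. fls_abs (h y) \<le> b) \<longrightarrow> fls_abs (l i h) \<le> K i * b" for h b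
      by (rule bspec[OF K i, THEN conjunct2, THEN spec, THEN spec])
    from this[of 1 "\<lambda>y. \<Sum>i\<in>I. c i * f i y"] have "fls_abs (c i) \<le> K i * 1"
      using bd unfolding eq by simp
    also have "\<dots> \<le> sum K I" using K i assms(1) member_le_sum[of i I K] by auto
    finally show ?thesis .
  qed
  then show ?thesis by (rule that)
qed

section \<open>Polynomials inside the field of Laurent series\<close>

lemma of_Lambda_pCons: "of_Lambda (pCons a p) = fls_const a + fls_X_inv * of_Lambda p"
  by (simp add: of_Lambda_def map_poly_pCons)

lemma of_Lambda_0 [simp]: "of_Lambda 0 = 0"
  by (simp add: of_Lambda_def)

lemma of_Lambda_add: "of_Lambda (p + q) = of_Lambda p + of_Lambda q"
  by (induction p q rule: poly_induct2)
    (simp_all add: of_Lambda_pCons fls_plus_const[symmetric] algebra_simps)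

lemma of_Lambda_smult: "of_Lambda (smult a p) = fls_const a * of_Lambda p"
  by (induction p) (simp_all add: of_Lambda_pCons distrib_left mult.left_commute)

lemma of_Lambda_mult: "of_Lambda (p * q) = of_Lambda p * of_Lambda q"
  by (induction p)
    (simp_all add: of_Lambda_pCons of_Lambda_add of_Lambda_smult distrib_right mult.assoc)

lemma of_Lambda_minus: "of_Lambda (- p) = - of_Lambda p"
  using of_Lambda_add[of p "- p"] by (simp add: eq_neg_iff_add_eq_0 add.commute)

lemma of_Lambda_1: "of_Lambda 1 = 1"
  using of_Lambda_pCons[of 1 0] by (simp add: one_pCons)

lemma of_Lambda_nth:
  "fls_nth (of_Lambda p) n = (if n \<le> 0 then coeff p (nat (- n)) else 0)"
proof (induction p arbitrary: n)
  case (pCons a p)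
  have "fls_nth (of_Lambda (pCons a p)) n = (if n = 0 then a else 0) + fls_nth (of_Lambda p) (n + 1)"
    by (simp add: of_Lambda_pCons fls_X_inv_times_conv_shift)
  also have "\<dots> = (if n \<le> 0 then coeff (pCons a p) (nat (- n)) else 0)"
  proof (cases "n < 0")
    case True
    then have "nat (- n) = Suc (nat (- (n + 1)))" by simp
    then show ?thesis using True pCons.IH by simp
  next
    case False
    then show ?thesis using pCons.IH by auto
  qed
  finally show ?case .
qed simp

lemma of_Lambda_eq_0_iff [simp]: "of_Lambda p = 0 \<longleftrightarrow> p = 0"
proof
  assume "of_Lambda p = 0"
  then have "coeff p m = 0" for m using of_Lambda_nth[of p "- int m"] by simp
  then show "p = 0" by (simp add: poly_eqI)
qed simp

text \<open>The leading coefficient sits at the exponent \<open>- int (degree p)\<close>, which is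
  at most 0. This discreteness of \<Lambda> in F is the source of the lower bounds on
  covolumes.\<close>

lemma fls_abs_of_Lambda_ge_1: "p \<noteq> 0 \<Longrightarrow> fls_abs (of_Lambda p) \<ge> 1"
proof -
  assume p: "p \<noteq> 0"
  have "fls_nth (of_Lambda p) (- int (degree p)) \<noteq> 0"
    using p by (simp add: of_Lambda_nth)
  then have "fls_subdegree (of_Lambda p) \<le> - int (degree p)" by (rule fls_subdegree_leI)
  then have "fls_subdegree (of_Lambda p) \<le> 0" by linarith
  then show ?thesis using p by (simp add: fls_abs_def)
qed

lemma range_of_Lambda_closed:
  "0 \<in> range of_Lambda" "1 \<in> range of_Lambda"
  "u \<in> range of_Lambda \<Longrightarrow> v \<in> range of_Lambda \<Longrightarrow> u + v \<in> range of_Lambda"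
  "u \<in> range of_Lambda \<Longrightarrow> v \<in> range of_Lambda \<Longrightarrow> u * v \<in> range of_Lambda"
  "u \<in> range of_Lambda \<Longrightarrow> - u \<in> range of_Lambda"
proof -
  show "0 \<in> range of_Lambda" by (rule range_eqI[of _ _ 0]) simp
  show "1 \<in> range of_Lambda" by (rule range_eqI[of _ _ 1]) (simp add: of_Lambda_1)
qed (auto simp: of_Lambda_add[symmetric] of_Lambda_mult[symmetric] of_Lambda_minus[symmetric])

lemma wedges_in_range_of_Lambda:
  assumes "\<And>v i. v \<in> set vs \<Longrightarrow> v i \<in> range of_Lambda"
  shows "wedges vs I \<in> range of_Lambda"
  using assms
proof (induction vs arbitrary: I)
  case Nil
  show ?case by (simp add: range_of_Lambda_closed)
next
  case (Cons v vs)
  have sgn: "(- 1) ^ m \<in> range of_Lambda" for m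
    by (induction m) (auto intro: range_of_Lambda_closed simp del: mult_minus1)
  have "(\<Sum>r\<in>J. (- 1) ^ card {s\<in>I. r < s} * wedges vs (I - {r}) * v r) \<in> range of_Lambda" for J
  proof (induction J rule: infinite_finite_induct)
    case (insert r J)
    have "(- 1) ^ card {s\<in>I. r < s} * wedges vs (I - {r}) * v r \<in> range of_Lambda"
      using Cons.prems by (intro range_of_Lambda_closed(4) sgn Cons.IH) auto
    then show ?case using insert by (simp add: range_of_Lambda_closed(3))
  qed (simp_all add: range_of_Lambda_closed)
  then show ?case by (simp add: wedge_def)
qed

lemma fls_abs_range_of_Lambda: "u \<in> range of_Lambda \<Longrightarrow> u \<noteq> 0 \<Longrightarrow> fls_abs u \<ge> 1"
  using fls_abs_of_Lambda_ge_1 by auto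

lemma fls_abs_sign [simp]: "fls_abs ((- 1) ^ m :: 'a::field fls) = 1"
  by (simp add: fls_abs_power)

section \<open>Counting monomials\<close>

lemma finite_card_bounded_exponents:
  assumes "finite A"
  shows "finite {f :: 'x \<Rightarrow> nat. (\<forall>x. x \<notin> A \<longrightarrow> f x = 0) \<and> sum f A \<le> k} \<and>
    card {f :: 'x \<Rightarrow> nat. (\<forall>x. x \<notin> A \<longrightarrow> f x = 0) \<and> sum f A \<le> k} = (k + card A) choose card A"
  using assms
proof (induction A arbitrary: k rule: finite_induct)
  case empty
  have "{f :: 'x \<Rightarrow> nat. (\<forall>x. x \<notin> {} \<longrightarrow> f x = 0) \<and> sum f {} \<le> k} = {\<lambda>x. 0}" by auto
  then show ?case by simp
next
  case (insert a A)
  let ?F = "\<lambda>A k. {f :: 'x \<Rightarrow> nat. (\<forall>x. x \<notin> A \<longrightarrow> f x = 0) \<and> sum f A \<le> k}"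
  let ?g = "\<lambda>(j, f :: 'x \<Rightarrow> nat). f(a := j)"
  have sum_upd: "sum (f(a := j)) A = sum f A" for f :: "'x \<Rightarrow> nat" and j
    using insert.hyps(2) by (intro sum.cong) auto
  \<comment> \<open>Splitting off the value \<open>j\<close> at \<open>a\<close> leaves the budget
    \<open>k - j\<close> for the rest; the sum over \<open>j\<close> is a hockey-stick sum of
    binomial coefficients.\<close>
  have "bij_betw ?g (SIGMA j:{..k}. ?F A (k - j)) (?F (insert a A) k)"
  proof (rule bij_betwI[where g = "\<lambda>f. (f a, f(a := 0))"])
    show "?g \<in> (SIGMA j:{..k}. ?F A (k - j)) \<rightarrow> ?F (insert a A) k"
      using insert.hyps sum_upd by auto
    show "(\<lambda>f. (f a, f(a := 0))) \<in> ?F (insert a A) k \<rightarrow> (SIGMA j:{..k}. ?F A (k - j))"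
      using insert.hyps sum_upd by auto
  qed (use insert.hyps(2) in \<open>auto simp: fun_eq_iff\<close>)
  moreover have "finite (SIGMA j:{..k}. ?F A (k - j))" using insert.IH by auto
  moreover have "card (SIGMA j:{..k}. ?F A (k - j)) = (\<Sum>j\<le>k. (k - j + card A) choose card A)"
    using insert.IH by (subst card_SigmaI) auto
  moreover have "(\<Sum>j\<le>k. (k - j + card A) choose card A) = (\<Sum>j\<le>k. (card A + j) choose card A)"
    by (rule sum.reindex_bij_witness[of _ "\<lambda>j. k - j" "\<lambda>j. k - j"]) (auto simp: add.commute)
  moreover have "(\<Sum>j\<le>k. (card A + j) choose card A) = (k + card (insert a A)) choose card (insert a A)"
    unfolding choose_rising_sum(1) using insert.hyps by (simp add: add.commute)
  ultimately show ?case
    by (metis (no_types, lifting) bij_betw_finite bij_betw_same_card)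
qed

lemma card_monomials:
  "finite {\<alpha> :: 'd::finite monomial. monomial_degree \<alpha> \<le> k}"
  "card {\<alpha> :: 'd::finite monomial. monomial_degree \<alpha> \<le> k} = (k + CARD('d)) choose CARD('d)"
proof -
  let ?F = "{f :: 'd \<Rightarrow> nat. (\<forall>x. x \<notin> UNIV \<longrightarrow> f x = 0) \<and> sum f UNIV \<le> k}"
  have bij: "bij_betw Poly_Mapping.lookup {\<alpha> :: 'd monomial. monomial_degree \<alpha> \<le> k} ?F"
  proof (rule bij_betwI[where g = Abs_poly_mapping])
    show "Poly_Mapping.lookup (Abs_poly_mapping f) = f" if "f \<in> ?F" for f :: "'d \<Rightarrow> nat"
      by (simp add: Abs_poly_mapping_inverse)
    then show "Abs_poly_mapping \<in> ?F \<rightarrow> {\<alpha> :: 'd monomial. monomial_degree \<alpha> \<le> k}"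
      by (auto simp: monomial_degree_def)
  qed (auto simp: monomial_degree_def)
  have F: "finite ?F \<and> card ?F = (k + CARD('d)) choose CARD('d)"
    by (rule finite_card_bounded_exponents) simp
  show "finite {\<alpha> :: 'd monomial. monomial_degree \<alpha> \<le> k}"
    using bij_betw_finite[OF bij] F by (rule iffD2[OF _ conjunct1])
  show "card {\<alpha> :: 'd monomial. monomial_degree \<alpha> \<le> k} = (k + CARD('d)) choose CARD('d)"
    using bij_betw_same_card[OF bij] F by (rule trans[OF _ conjunct2])
qed

text \<open>The exponent in \<open>dirichlet_improvable\<close> is the number of nonconstant
  monomials, and this agreement is what gives the flow determinant one.\<close>

lemma nonconstant_monomials:
  "finite (nonconstant_monomials k :: 'd::finite monomial set)"
  "card (nonconstant_monomials k :: 'd::finite monomial set) = num_monomials k CARD('d)"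
  "{\<alpha> :: 'd::finite monomial. monomial_degree \<alpha> \<le> k} = insert 0 (nonconstant_monomials k)"
proof -
  show *: "{\<alpha> :: 'd::finite monomial. monomial_degree \<alpha> \<le> k} = insert 0 (nonconstant_monomials k)"
    by (auto simp: nonconstant_monomials_def monomial_degree_def)
  show f: "finite (nonconstant_monomials k :: 'd::finite monomial set)"
    using card_monomials(1)[of k, where 'd = 'd] unfolding * by simp
  have "(0 :: 'd monomial) \<notin> nonconstant_monomials k" by (simp add: nonconstant_monomials_def)
  then show "card (nonconstant_monomials k :: 'd::finite monomial set) = num_monomials k CARD('d)"
    using card_monomials(2)[of k, where 'd = 'd] f unfolding * by (simp add: num_monomials_def)
qed

section \<open>Nondivergence for nonplanar maps\<close>

lemma fls_abs_X_inv [simp]: "fls_abs (fls_X_inv :: 'a::field fls) = exp 1"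
  by (simp add: fls_abs_def)

lemma fls_abs_X [simp]: "fls_abs (fls_X :: 'a::field fls) = exp (- 1)"
  by (simp add: fls_abs_def)

definition wnorm :: "nat \<Rightarrow> (nat set \<Rightarrow> 'a::field fls) \<Rightarrow> real" where
  "wnorm n w = Max ((\<lambda>I. fls_abs (w I)) ` Pow {..n})"

lemma wnorm_le_iff: "wnorm n w \<le> b \<longleftrightarrow> (\<forall>I\<subseteq>{..n}. fls_abs (w I) \<le> b)"
  unfolding wnorm_def by (subst Max_le_iff) auto

lemma wnorm_less_iff: "wnorm n w < b \<longleftrightarrow> (\<forall>I\<subseteq>{..n}. fls_abs (w I) < b)"
  unfolding wnorm_def by (subst Max_less_iff) auto

lemma fls_abs_le_wnorm: "I \<subseteq> {..n} \<Longrightarrow> fls_abs (w I) \<le> wnorm n w"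
  using wnorm_le_iff[of n w "wnorm n w"] by simp

lemma wnorm_ge_iff: "b \<le> wnorm n w \<longleftrightarrow> (\<exists>I\<subseteq>{..n}. b \<le> fls_abs (w I))"
  using wnorm_less_iff[of n w b] by (meson not_le)

lemma wnorm_scale: "wnorm n (\<lambda>I. c * w I) = fls_abs c * wnorm n w"
proof (rule antisym)
  show "wnorm n (\<lambda>I. c * w I) \<le> fls_abs c * wnorm n w"
    unfolding wnorm_le_iff fls_abs_mult by (auto intro: mult_left_mono fls_abs_le_wnorm)
  obtain I where "I \<subseteq> {..n}" "wnorm n w \<le> fls_abs (w I)" using wnorm_ge_iff[of "wnorm n w" n w] by auto
  then show "fls_abs c * wnorm n w \<le> wnorm n (\<lambda>I. c * w I)"
    unfolding wnorm_ge_iff fls_abs_mult by (intro exI[of _ I] conjI mult_left_mono) auto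
qed

text \<open>The ultrametric inequality bounds the Laplace sum by its largest term, so no dimensional
  factor enters and short vectors can be compared with the very \<epsilon> of the chain.\<close>

lemma wnorm_wedge_le:
  assumes "wnorm n w \<le> 1" "0 \<le> b" "\<And>i. i \<le> n \<Longrightarrow> fls_abs (v i) \<le> b"
  shows "wnorm n (wedge w v) \<le> b"
  unfolding wnorm_le_iff
proof (intro allI impI)
  fix I :: "nat set" assume I: "I \<subseteq> {..n}"
  show "fls_abs (wedge w v I) \<le> b"
    unfolding wedge_def
  proof (rule fls_abs_sum_le[OF assms(2)])
    fix r assume r: "r \<in> I"
    have "I - {r} \<subseteq> {..n}" using I by auto
    then have "fls_abs (w (I - {r})) \<le> 1" using assms(1) unfolding wnorm_le_iff by blast
    moreover have "fls_abs (v r) \<le> b" using r I by (intro assms(3)) auto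
    ultimately have "fls_abs (w (I - {r})) * fls_abs (v r) \<le> 1 * b" by (intro mult_mono) auto
    then show "fls_abs ((- 1) ^ card {s\<in>I. r < s} * w (I - {r}) * v r) \<le> b"
      by (simp add: fls_abs_mult)
  qed
qed

section \<open>Rational subspaces and minimal bases\<close>

definition lattice :: "nat \<Rightarrow> (nat \<Rightarrow> 'a::field fls) set" where
  "lattice n = {v. (\<forall>i. v i \<in> range of_Lambda) \<and> (\<forall>i>n. v i = 0)}"

text \<open>A primitive sublattice is represented by its span \<open>V\<close> over F. The
  nonvanishing wedge product expresses linear independence of the list, so its length is the
  rank.\<close>

definition generates :: "nat \<Rightarrow> (nat \<Rightarrow> 'a::field fls) list \<Rightarrow> (nat \<Rightarrow> 'a fls) set \<Rightarrow> bool" where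
  "generates n vs V \<longleftrightarrow> set vs \<subseteq> lattice n \<and> V = fv.span (set vs) \<and> (\<exists>I. wedges vs I \<noteq> 0)"

lemma generatesD:
  assumes "generates n vs V"
  shows "set vs \<subseteq> lattice n" "V = fv.span (set vs)" "\<exists>I. wedges vs I \<noteq> 0"
    "distinct vs" "fv.independent (set vs)"
  using assms wedges_nonzero_imp_independent unfolding generates_def by blast+

lemma generates_support:
  assumes "generates n vs V" "wedges vs I \<noteq> 0"
  shows "I \<subseteq> {..n}" "card I = length vs"
proof -
  have "v i = 0" if "v \<in> set vs" "i \<notin> {..n}" for v i
    using generatesD(1)[OF assms(1)] that by (auto simp: lattice_def not_le)
  with wedges_support[of vs I "{..n}"] assms(2) have "finite I \<and> card I = length vs \<and> I \<subseteq> {..n}"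
    by blast
  then show "I \<subseteq> {..n}" "card I = length vs" by simp_all
qed

lemma wnorm_generates_ge_1:
  assumes "generates n vs V"
  shows "1 \<le> wnorm n (wedges vs)"
proof -
  obtain I where I: "wedges vs I \<noteq> 0" using generatesD(3)[OF assms] by auto
  have "wedges vs I \<in> range of_Lambda"
    using generatesD(1)[OF assms] by (intro wedges_in_range_of_Lambda) (auto simp: lattice_def)
  then have "1 \<le> fls_abs (wedges vs I)" using I by (rule fls_abs_range_of_Lambda)
  then show ?thesis unfolding wnorm_ge_iff using generates_support(1)[OF assms I] by auto
qed

lemma generates_length_le:
  assumes "generates n vs V"
  shows "length vs \<le> n + 1"
proof -
  obtain I where I: "wedges vs I \<noteq> 0" using generatesD(3)[OF assms] by auto
  have "card I \<le> card {..n}" using generates_support(1)[OF assms I] by (intro card_mono) auto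
  then show ?thesis using generates_support(2)[OF assms I] by simp
qed

lemma generates_same_length:
  assumes "generates n vs V" "generates n us V"
  shows "length vs = length us"
proof -
  have "card (set vs) \<le> card (set us)" if "generates n vs V" "generates n us V" for vs us
    using fv.independent_span_bound[of "set us" "set vs"] fv.span_superset[of "set vs"]
      generatesD(2,5)[OF that(1)] generatesD(2)[OF that(2)] by auto
  from this[OF assms] this[OF assms(2,1)] show ?thesis
    using distinct_card generatesD(4) assms by (metis le_antisym)
qed

text \<open>A generating list whose wedge product has minimal norm generates a primitive sublattice; this
  is the only property of primitive sublattices that is needed.\<close>

definition minimal_generators :: "nat \<Rightarrow> (nat \<Rightarrow> 'a::field fls) set \<Rightarrow> (nat \<Rightarrow> 'a fls) list" where
  "minimal_generators n V = (ARG_MIN (\<lambda>vs. nat \<lfloor>ln (wnorm n (wedges vs))\<rfloor>) vs. generates n vs V)"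

lemma generates_minimal_generators:
  assumes "generates n vs V"
  shows "generates n (minimal_generators n V) V"
  unfolding minimal_generators_def
  using arg_min_nat_lemma[of "\<lambda>vs. generates n vs V" vs, OF assms] by blast

text \<open>The two wedge products differ by a factor \<open>c\<close>. If
  \<open>fls_abs c < 1\<close>, it is at most \<open>exp (- 1)\<close>, so the logarithm of the norm
  drops by at least 1, which survives the floor; both norms are at least 1, so the truncation to
  \<open>nat\<close> hides nothing. A general \<phi> occurs because the same \<open>c\<close> is
  needed after the flow is applied.\<close>

lemma minimal_generators:
  fixes vs :: "(nat \<Rightarrow> 'a::field fls) list"
  assumes gen: "generates n vs V"
  shows "\<exists>c. 1 \<le> fls_abs c \<and> (\<forall>\<phi> I. flinear \<phi> \<longrightarrow>
    wedges (map \<phi> vs) I = c * wedges (map \<phi> (minimal_generators n V)) I)"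
proof -
  let ?d = "\<lambda>vs :: (nat \<Rightarrow> 'a fls) list. nat \<lfloor>ln (wnorm n (wedges vs))\<rfloor>"
  define us where "us = minimal_generators n V"
  have us: "generates n us V" unfolding us_def by (rule generates_minimal_generators[OF gen])
  have le: "?d us \<le> ?d vs"
    unfolding us_def minimal_generators_def
    using arg_min_nat_lemma[of "\<lambda>vs. generates n vs V" vs ?d, OF gen] gen by blast
  have "set vs \<subseteq> fv.span (set us)"
    using fv.span_superset[of "set vs"] generatesD(2)[OF gen] generatesD(2)[OF us] by simp
  then obtain c where c: "\<forall>\<phi> I. flinear \<phi> \<longrightarrow> wedges (map \<phi> (vs @ [])) I = c * wedges (map \<phi> us) I"
    using wedges_in_span[of vs us "[]"] generates_same_length[OF gen us] by auto
  have "flinear (\<lambda>v. v :: nat \<Rightarrow> 'a fls)" by (simp add: flinear_def)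
  have eq: "wedges vs I = c * wedges us I" for I
  proof -
    have "wedges (map (\<lambda>v. v) (vs @ [])) I = c * wedges (map (\<lambda>v. v) us) I"
      using c \<open>flinear (\<lambda>v. v)\<close> by blast
    then show ?thesis by (simp only: list.map_ident append_Nil2)
  qed
  have "1 \<le> fls_abs c"
  proof (rule ccontr)
    assume "\<not> ?thesis"
    obtain I where "wedges vs I \<noteq> 0" using generatesD(3)[OF gen] by auto
    then have "c \<noteq> 0" using eq[of I] by auto
    then obtain i where i: "fls_abs c = exp (real_of_int i)" by (rule fls_abs_exp_cases)
    then have "i \<le> - 1" using \<open>\<not> 1 \<le> fls_abs c\<close> by simp
    have "wedges vs = (\<lambda>I. c * wedges us I)" by (rule ext) (rule eq)
    then have "wnorm n (wedges vs) = exp (real_of_int i) * wnorm n (wedges us)"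
      by (simp add: wnorm_scale i)
    moreover have g1: "wnorm n (wedges us) \<ge> 1" "wnorm n (wedges vs) \<ge> 1"
      using wnorm_generates_ge_1 gen us by auto
    ultimately have "ln (wnorm n (wedges vs)) = real_of_int i + ln (wnorm n (wedges us))"
      by (simp add: ln_mult)
    then have "\<lfloor>ln (wnorm n (wedges vs))\<rfloor> < \<lfloor>ln (wnorm n (wedges us))\<rfloor>"
      using \<open>i \<le> - 1\<close> by simp
    moreover have "0 \<le> \<lfloor>ln (wnorm n (wedges vs))\<rfloor>" using g1(2) by simp
    ultimately show False using le by linarith
  qed
  then show ?thesis using c unfolding us_def by (intro exI[of _ c]) simp
qed

text \<open>The friendly hypotheses rewritten for balls of integer level. Since \<open>f 0\<close>
  is the constant 1, sums over \<open>{..n}\<close> include the constants; goodness is normalised to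
  combinations that reach 1 on the support, and \<open>D\<close> compares a ball with its
  parent.\<close>

locale nondivergence_system =
  fixes M :: "('a::{field,finite} fls ^ 'd::finite) measure" and U :: "('a fls ^ 'd) set"
    and n :: nat and f :: "nat \<Rightarrow> 'a fls ^ 'd \<Rightarrow> 'a fls" and D :: ennreal and C a :: real
  assumes radon: "radon_measure M"
    and fed: "\<And>x j. x \<in> msupport M \<Longrightarrow> cb x (j + 1) \<subseteq> U \<Longrightarrow>
      emeasure M (cb x (j + 1)) \<le> D * emeasure M (cb x j)"
    and f0: "\<And>x. f 0 x = 1"
    and f_cont: "\<And>i. fls_continuous (f i)"
    and good: "\<And>c x j \<epsilon>. x \<in> msupport M \<Longrightarrow> cb x j \<subseteq> U \<Longrightarrow> 0 < \<epsilon> \<Longrightarrow>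
      \<exists>y\<in>cb x j \<inter> msupport M. 1 \<le> fls_abs (\<Sum>i\<le>n. c i * f i y) \<Longrightarrow>
      emeasure M {y\<in>cb x j. fls_abs (\<Sum>i\<le>n. c i * f i y) < \<epsilon>} \<le>
        ennreal (C * \<epsilon> powr a) * emeasure M (cb x j)"
    and nonplanar: "\<And>c x j. x \<in> msupport M \<Longrightarrow> cb x j \<subseteq> U \<Longrightarrow>
      \<forall>y\<in>cb x j \<inter> msupport M. (\<Sum>i\<le>n. c i * f i y) = 0 \<Longrightarrow> \<forall>i\<in>{..n}. c i = 0"
begin

text \<open>The diagonal matrix with entries T^(mn), T^(-m), ..., T^(-m), of determinant one. It
  brings the bound on the value of a polynomial and the bound on its coefficients to the common
  bound \<epsilon>.\<close>

definition flow :: "nat \<Rightarrow> nat \<Rightarrow> 'a fls" where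
  "flow m i = (if i = 0 then fls_X_inv ^ (m * n) else fls_X ^ m)"

definition act :: "nat \<Rightarrow> 'a fls ^ 'd \<Rightarrow> (nat \<Rightarrow> 'a fls) \<Rightarrow> nat \<Rightarrow> 'a fls" where
  "act m x v = (\<lambda>i. flow m i * (v(0 := \<Sum>j\<le>n. f j x * v j)) i)"

lemma flinear_act: "flinear (act m x)"
  unfolding flinear_def act_def
  by (auto simp: fun_eq_iff fscale_apply algebra_simps sum.distrib sum_distrib_left)

text \<open>Row 0 of the moved vectors is a combination of the rows \<open>i\<close> with
  coefficients \<open>f i x\<close>, so a minor through row 0 splits into minors with a copied row
  \<open>i\<close>. A minor avoiding row 0 does not depend on \<open>x\<close> and is entered as
  coefficient of \<open>f 0\<close>.\<close>

definition coord :: "nat \<Rightarrow> (nat \<Rightarrow> 'a fls) list \<Rightarrow> nat set \<Rightarrow> nat \<Rightarrow> 'a fls" where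
  "coord m vs I i = (\<Prod>r\<in>I. flow m r) *
     (if 0 \<in> I then wedges (map (\<lambda>v. v(0 := v i)) vs) I else if i = 0 then wedges vs I else 0)"

lemma wedges_act: "wedges (map (act m x) vs) I = (\<Sum>i\<le>n. coord m vs I i * f i x)"
proof -
  let ?g = "\<lambda>v. v(0 := \<Sum>j\<le>n. f j x * v j)"
  have "map (act m x) vs = map (\<lambda>v i. flow m i * v i) (map ?g vs)"
    by (simp add: act_def)
  then have eq: "wedges (map (act m x) vs) I = (\<Prod>r\<in>I. flow m r) * wedges (map ?g vs) I"
    by (simp only: wedges_scale_rows)
  show ?thesis
  proof (cases "0 \<in> I")
    case True
    show ?thesis
      unfolding eq wedges_replace_row_sum[OF True] coord_def
      using True by (simp add: sum_distrib_left algebra_simps)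
  next
    case False
    have "(\<Sum>i\<le>n. coord m vs I i * f i x) = (\<Sum>i\<le>n. if i = 0 then (\<Prod>r\<in>I. flow m r) * wedges vs I else 0)"
      using False by (intro sum.cong) (auto simp: coord_def f0)
    then show ?thesis unfolding eq wedges_replace_row_outside[OF False] by simp
  qed
qed

lemma fls_abs_prod: "fls_abs (\<Prod>r\<in>I. g r) = (\<Prod>r\<in>I. fls_abs (g r :: 'b::field fls))"
  by (induction I rule: infinite_finite_induct) (simp_all add: fls_abs_mult)

text \<open>Row 0 contributes \<open>m * n\<close> and every other row of \<open>I\<close>
  contributes \<open>- m\<close>. The exponent is at least \<open>m\<close> as long as
  \<open>card I \<le> n\<close>, and is 0 in full rank.\<close>

lemma fls_abs_prod_flow:
  assumes "finite I" "0 \<in> I"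
  shows "fls_abs (\<Prod>r\<in>I. flow m r) = exp (real m * (real n + 1 - real (card I)))"
proof -
  have "(\<Prod>r\<in>I. fls_abs (flow m r)) = fls_abs (flow m 0) * (\<Prod>r\<in>I - {0}. fls_abs (flow m r))"
    by (rule prod.remove[OF assms])
  also have "(\<Prod>r\<in>I - {0}. fls_abs (flow m r)) = (\<Prod>r\<in>I - {0}. exp (- real m))"
    by (intro prod.cong) (auto simp: flow_def fls_abs_power exp_of_nat_mult[symmetric])
  also have "\<dots> = exp (- real m * real (card (I - {0})))"
    by (simp add: exp_of_nat_mult[symmetric] mult.commute)
  also have "real (card (I - {0})) = real (card I) - 1"
    using card.remove[OF assms] by simp
  also have "fls_abs (flow m 0) = exp (real m * real n)"
    by (simp add: flow_def fls_abs_power exp_of_nat_mult[symmetric])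
  also have "exp (real m * real n) * exp (- real m * (real (card I) - 1)) =
      exp (real m * (real n + 1 - real (card I)))"
    by (simp add: exp_add[symmetric] algebra_simps)
  finally show ?thesis by (simp add: fls_abs_prod)
qed

definition subspaces :: "(nat \<Rightarrow> 'a fls) set set" where
  "subspaces = {V. \<exists>vs. vs \<noteq> [] \<and> generates n vs V}"

definition height :: "nat \<Rightarrow> (nat \<Rightarrow> 'a fls) set \<Rightarrow> 'a fls ^ 'd \<Rightarrow> real" where
  "height m V x = wnorm n (wedges (map (act m x) (minimal_generators n V)))"

lemma subspaces_minimal_generators:
  assumes "V \<in> subspaces"
  shows "generates n (minimal_generators n V) V" "minimal_generators n V \<noteq> []"
proof -
  obtain vs where vs: "vs \<noteq> []" "generates n vs V" using assms by (auto simp: subspaces_def)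
  show g: "generates n (minimal_generators n V) V" by (rule generates_minimal_generators[OF vs(2)])
  show "minimal_generators n V \<noteq> []" using generates_same_length[OF vs(2) g] vs(1) by auto
qed

lemma open_height_less: "open {y. height m V y < c}"
proof -
  have "{y. height m V y < c} =
      (\<Inter>I\<in>Pow {..n}. {y. fls_abs (\<Sum>i\<le>n. coord m (minimal_generators n V) I i * f i y) < c})"
    unfolding height_def wnorm_less_iff wedges_act by auto
  also have "open \<dots>"
    by (intro open_INT ballI open_fls_abs_less fls_continuous_sum fls_continuous_mult
        fls_continuous_const f_cont) simp
  finally show ?thesis .
qed

text \<open>A single coordinate that reaches 1 on the support carries the estimate: where the
  maximum is below \<epsilon>, so is this coordinate.\<close>

lemma emeasure_height_less:
  assumes "x \<in> msupport M" "cb x j \<subseteq> U" "0 < \<epsilon>" "\<exists>y\<in>cb x j \<inter> msupport M. 1 \<le> height m V y"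
  shows "emeasure M {y\<in>cb x j. height m V y < \<epsilon>} \<le> ennreal (C * \<epsilon> powr a) * emeasure M (cb x j)"
proof -
  let ?F = "\<lambda>I y. \<Sum>i\<le>n. coord m (minimal_generators n V) I i * f i y"
  obtain y I where y: "y \<in> cb x j \<inter> msupport M" "I \<subseteq> {..n}" "1 \<le> fls_abs (?F I y)"
    using assms(4) unfolding height_def wnorm_ge_iff wedges_act by auto
  have "open {z. fls_abs (?F I z) < \<epsilon>}"
    by (intro open_fls_abs_less fls_continuous_sum fls_continuous_mult fls_continuous_const f_cont)
  moreover have "{z\<in>cb x j. fls_abs (?F I z) < \<epsilon>} = cb x j \<inter> {z. fls_abs (?F I z) < \<epsilon>}" by auto
  ultimately have "{z\<in>cb x j. fls_abs (?F I z) < \<epsilon>} \<in> sets M"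
    using radon_sets_open[OF radon] by (simp add: open_Int)
  moreover have "{z\<in>cb x j. height m V z < \<epsilon>} \<subseteq> {z\<in>cb x j. fls_abs (?F I z) < \<epsilon>}"
    using y(2) unfolding height_def wnorm_less_iff wedges_act by auto
  ultimately have "emeasure M {z\<in>cb x j. height m V z < \<epsilon>} \<le> emeasure M {z\<in>cb x j. fls_abs (?F I z) < \<epsilon>}"
    by (intro emeasure_mono)
  also have "\<dots> \<le> ennreal (C * \<epsilon> powr a) * emeasure M (cb x j)"
    using y by (intro good assms(1-3)) auto
  finally show ?thesis .
qed

text \<open>If a height stayed below 1 on the support in the ball, \<open>K\<close> would bound all
  coefficients of its minors, whereas in rank at most \<open>n\<close> some coefficient has absolute
  value at least \<open>exp m\<close>. The time \<open>m1\<close> depends on the ball but not on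
  \<open>V\<close>.\<close>

lemma height_ge_1_somewhere:
  assumes x: "x \<in> msupport M" "cb x j \<subseteq> U"
  obtains m1 where "\<And>m V. m1 \<le> m \<Longrightarrow> V \<in> subspaces \<Longrightarrow> \<exists>y\<in>cb x j \<inter> msupport M. 1 \<le> height m V y"
proof -
  obtain K where K: "\<And>c i. i \<in> {..n} \<Longrightarrow>
      \<forall>y\<in>cb x j \<inter> msupport M. fls_abs (\<Sum>i\<le>n. c i * f i y) \<le> 1 \<Longrightarrow> fls_abs (c i) \<le> K"
    using coefficients_bounded[of "{..n}" "cb x j \<inter> msupport M" f, OF _ nonplanar[OF x]] by auto
  obtain m1 where m1: "K < real m1" using reals_Archimedean2 by auto
  show ?thesis
  proof (rule that[of m1])
    fix m V assume m: "m1 \<le> m" and V: "V \<in> subspaces"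
    define vs where "vs = minimal_generators n V"
    have gen: "generates n vs V" and ne: "vs \<noteq> []"
      unfolding vs_def using subspaces_minimal_generators[OF V] by auto
    obtain J where J: "wedges vs J \<noteq> 0" using generatesD(3)[OF gen] by auto
    have Jn: "J \<subseteq> {..n}" "card J = length vs" using generates_support[OF gen J] by auto
    have finJ: "finite J" using Jn(1) finite_subset by auto
    have "wedges vs J \<in> range of_Lambda"
      using generatesD(1)[OF gen] by (intro wedges_in_range_of_Lambda) (auto simp: lattice_def)
    then have J1: "1 \<le> fls_abs (wedges vs J)" using J by (rule fls_abs_range_of_Lambda)
    have card_le: "card J \<le> n + 1" using Jn(2) generates_length_le[OF gen] by simp
    show "\<exists>y\<in>cb x j \<inter> msupport M. 1 \<le> height m V y"
    proof (cases "card J = n + 1")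
      \<comment> \<open>In full rank the coefficients with \<open>i \<noteq> 0\<close> have a
        repeated row and vanish, and the flow has determinant one on all rows; the minor is
        constant, of absolute value at least 1.\<close>
      case True
      then have J_eq: "J = {..n}" using Jn(1) by (intro card_subset_eq) auto
      have "coord m vs J i = (if i = 0 then (\<Prod>r\<in>J. flow m r) * wedges vs J else 0)" if "i \<le> n" for i
      proof (cases "i = 0")
        case True
        then show ?thesis using J_eq by (simp add: coord_def)
      next
        case False
        have "J = insert 0 (J - {0})" using J_eq by auto
        moreover have "wedges (map (\<lambda>v. v(0 := v i)) vs) (insert 0 (J - {0})) = 0"
          using that False J_eq by (intro wedges_repeated_row) auto
        ultimately show ?thesis using False J_eq by (simp add: coord_def)
      qed
      then have "(\<Sum>i\<le>n. coord m vs J i * f i x) =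
          (\<Sum>i\<le>n. if i = 0 then (\<Prod>r\<in>J. flow m r) * wedges vs J else 0)"
        by (intro sum.cong) (auto simp: f0)
      then have "wedges (map (act m x) vs) J = (\<Prod>r\<in>J. flow m r) * wedges vs J"
        unfolding wedges_act by simp
      moreover have "fls_abs (\<Prod>r\<in>J. flow m r) = 1"
        using J_eq True by (subst fls_abs_prod_flow) auto
      ultimately have "1 \<le> fls_abs (wedges (map (act m x) vs) J)"
        using J1 by (simp add: fls_abs_mult)
      then have "1 \<le> height m V x"
        unfolding height_def vs_def[symmetric] wnorm_ge_iff using Jn(1) by auto
      then show ?thesis using x(1) by auto
    next
      case False
      have J0: "J \<noteq> {}" using Jn(2) ne by auto
      \<comment> \<open>A coefficient that grows under the flow belongs to a set containing row 0.
        If \<open>J\<close> does not contain it, row 0 takes the place of some \<open>i\<close> in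
        \<open>J\<close>, and the copied row \<open>i\<close> recovers the minor on \<open>J\<close>
        up to sign.\<close>
      obtain i I where I: "i \<le> n" "0 \<in> I" "I \<subseteq> {..n}" "card I = card J"
        "fls_abs (wedges (map (\<lambda>v. v(0 := v i)) vs) I) = fls_abs (wedges vs J)"
      proof (cases "0 \<in> J")
        case True
        show ?thesis by (rule that[of 0 J]) (use True Jn in auto)
      next
        case F: False
        obtain i where i: "i \<in> J" using J0 by auto
        then have i0: "i \<noteq> 0" using F by metis
        have "wedges (map (\<lambda>v. v(0 := v i)) vs) (insert 0 (J - {i})) =
            (- 1) ^ card {s\<in>J - {i}. s < i} * wedges vs (insert i (J - {i}))"
          using F i0 finJ by (intro wedges_replace_row) auto
        moreover have "insert i (J - {i}) = J" using i by auto
        ultimately have "fls_abs (wedges (map (\<lambda>v. v(0 := v i)) vs) (insert 0 (J - {i}))) = fls_abs (wedges vs J)"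
          by (simp add: fls_abs_mult)
        moreover have "card (insert 0 (J - {i})) = card J"
          using F finJ card.remove[OF finJ i] by simp
        ultimately show ?thesis using i Jn(1) by (intro that[of i "insert 0 (J - {i})"]) auto
      qed
      show ?thesis
      proof (rule ccontr)
        assume no: "\<not> ?thesis"
        have "\<forall>y\<in>cb x j \<inter> msupport M. fls_abs (\<Sum>i\<le>n. coord m vs I i * f i y) \<le> 1"
        proof
          fix y assume "y \<in> cb x j \<inter> msupport M"
          then have "height m V y < 1" using no by (auto simp: not_le)
          then have "fls_abs (wedges (map (act m y) vs) I) < 1"
            unfolding height_def vs_def[symmetric] wnorm_less_iff using I(3) by auto
          then show "fls_abs (\<Sum>i\<le>n. coord m vs I i * f i y) \<le> 1" by (simp add: wedges_act)
        qed
        then have "fls_abs (coord m vs I i) \<le> K" using I(1) by (intro K) auto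
        moreover have "exp (real m) \<le> fls_abs (coord m vs I i)"
        proof -
          have "real m * 1 \<le> real m * (real n + 1 - real (card I))"
            using card_le False I(4) by (intro mult_left_mono) auto
          moreover have "finite I" using I(3) by (rule finite_subset) simp
          ultimately have "exp (real m) \<le> fls_abs (\<Prod>r\<in>I. flow m r)"
            using fls_abs_prod_flow[of I m] I(2) by simp
          also have "\<dots> \<le> fls_abs (\<Prod>r\<in>I. flow m r) * fls_abs (wedges vs J)"
            using mult_left_mono[OF J1 fls_abs_nonneg[of "\<Prod>r\<in>I. flow m r"]] by simp
          also have "\<dots> = fls_abs (coord m vs I i)"
            using I(2,5) by (simp add: coord_def fls_abs_mult)
          finally show ?thesis .
        qed
        moreover have "real m \<le> exp (real m)" using exp_ge_add_one_self[of "real m"] by linarith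
        ultimately show False using m m1 by linarith
      qed
    qed
  qed
qed

text \<open>Suppose \<open>v\<close> were short, and take the largest member of the chain without
  \<open>v\<close>, or zero if there is none. Adjoining \<open>v\<close> gives a subspace comparable
  with the whole chain, of height at most 1 times the size of \<open>v\<close>, hence below
  \<epsilon>. Yet members of the chain have height at least \<epsilon>, and saturation gives at
  least 1 otherwise.\<close>

lemma marked_imp_no_short_vector:
  assumes y: "marked (height m) (\<lambda>V W. V \<subseteq> W \<or> W \<subseteq> V) \<epsilon> subspaces y" and \<epsilon>: "0 < \<epsilon>" "\<epsilon> \<le> 1"
    and v: "v \<in> lattice n" "v \<noteq> 0"
  shows "\<exists>i\<le>n. \<epsilon> \<le> fls_abs (act m y v i)"
proof (rule ccontr)
  assume "\<not> ?thesis"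
  then have short: "fls_abs (act m y v i) < \<epsilon>" if "i \<le> n" for i using that not_le by blast
  define b where "b = Max ((\<lambda>i. fls_abs (act m y v i)) ` {..n})"
  have b: "b < \<epsilon>" "fls_abs (act m y v i) \<le> b" if "i \<le> n" for i
    unfolding b_def using short that by (auto simp: Max_less_iff)
  have b0: "0 \<le> b" using b(2)[of 0] fls_abs_nonneg[of "act m y v 0"] by linarith
  from y obtain T where T: "T \<subseteq> subspaces" "finite T" "\<forall>V\<in>T. \<forall>W\<in>T. V \<subseteq> W \<or> W \<subseteq> V"
    "\<forall>V\<in>T. \<epsilon> \<le> height m V y \<and> height m V y \<le> 1"
    "\<forall>V\<in>subspaces. (\<forall>W\<in>T. V \<subseteq> W \<or> W \<subseteq> V) \<longrightarrow> V \<notin> T \<longrightarrow> 1 \<le> height m V y"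
    unfolding marked_def by (elim exE conjE) (rule that)
  have "\<exists>us. set us \<subseteq> lattice n \<and> (\<exists>I. wedges us I \<noteq> 0) \<and> v \<notin> fv.span (set us) \<and>
      wnorm n (wedges (map (act m y) us)) \<le> 1 \<and>
      (\<forall>W\<in>T. W \<subseteq> fv.span (set us) \<or> (v \<in> W \<and> fv.span (set us) \<subseteq> W))"
  proof (cases "\<exists>V\<in>T. v \<notin> V")
    case False
    have "wedges [] {} \<noteq> (0 :: 'a fls)" by simp
    then have "\<exists>I. wedges [] I \<noteq> (0 :: 'a fls)" by (rule exI)
    moreover have "wnorm n (wedges (map (act m y) [])) \<le> 1" by (simp add: wnorm_le_iff)
    moreover have "v \<notin> fv.span (set [])" using v(2) by (simp add: fv.span_empty)
    moreover have "\<forall>W\<in>T. v \<in> W \<and> fv.span (set []) \<subseteq> W"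
    proof
      fix W assume W: "W \<in> T"
      then have "W \<in> subspaces" using T(1) by auto
      then have "W = fv.span (set (minimal_generators n W))"
        using subspaces_minimal_generators(1) generatesD(2) by blast
      then have "0 \<in> W" using fv.span_zero by metis
      then show "v \<in> W \<and> fv.span (set []) \<subseteq> W" using False W by (simp add: fv.span_empty)
    qed
    ultimately show ?thesis by (intro exI[of _ "[]"]) auto
  next
    case True
    let ?T = "{V\<in>T. v \<notin> V}" and ?rk = "\<lambda>V. length (minimal_generators n V)"
    have fT: "finite ?T" "?T \<noteq> {}" using T(2) True by auto
    define V where "V = (ARG_MAX ?rk V. V \<in> ?T)"
    obtain V0 where V0: "V0 \<in> ?T" using fT(2) by auto
    have bound: "\<forall>W. W \<in> ?T \<longrightarrow> ?rk W < n + 2"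
    proof (intro allI impI)
      fix W assume "W \<in> ?T"
      then have "W \<in> subspaces" using T(1) by auto
      from generates_length_le[OF subspaces_minimal_generators(1)[OF this]]
      show "?rk W < n + 2" by simp
    qed
    have V: "V \<in> ?T" "\<And>W. W \<in> ?T \<Longrightarrow> ?rk W \<le> ?rk V"
      unfolding V_def using arg_max_nat_lemma[of "\<lambda>V. V \<in> ?T" V0 ?rk "n + 2", OF V0 bound] by auto
    let ?us = "minimal_generators n V"
    have VS: "V \<in> subspaces" using V(1) T(1) by auto
    note gen = subspaces_minimal_generators(1)[OF VS]
    have Vspan: "V = fv.span (set ?us)" by (rule generatesD(2)[OF gen])
    \<comment> \<open>A member not contained in \<open>V\<close> contains \<open>V\<close>; if it
      missed \<open>v\<close>, the maximal rank of \<open>V\<close> would force equality.\<close>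
    have dich: "W \<subseteq> V \<or> (v \<in> W \<and> V \<subseteq> W)" if W: "W \<in> T" for W
    proof (cases "W \<subseteq> V")
      case False
      then have sub: "V \<subseteq> W" using T(3) V(1) W by auto
      have WS: "W \<in> subspaces" using W T(1) by auto
      note genW = subspaces_minimal_generators(1)[OF WS]
      have "v \<in> W"
      proof (rule ccontr)
        assume "v \<notin> W"
        then have "?rk W \<le> ?rk V" using W by (intro V(2)) simp
        then have "fv.span (set ?us) = fv.span (set (minimal_generators n W))"
          using sub generatesD[OF gen] generatesD(2)[OF genW]
          by (intro span_eq_if_subset_length_eq) auto
        then have "V = W" using Vspan generatesD(2)[OF genW] by simp
        then show False using False by simp
      qed
      then show ?thesis using sub by simp
    qed simp
    have "\<forall>W\<in>T. W \<subseteq> fv.span (set ?us) \<or> (v \<in> W \<and> fv.span (set ?us) \<subseteq> W)"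
      unfolding Vspan[symmetric] using dich by blast
    moreover have "wnorm n (wedges (map (act m y) ?us)) \<le> 1"
      using T(4) V(1) by (simp add: height_def)
    moreover have "v \<notin> fv.span (set ?us)" unfolding Vspan[symmetric] using V(1) by simp
    ultimately show ?thesis
      using generatesD(1,3)[OF gen] by (intro exI[of _ ?us] conjI)
  qed
  then obtain us where us: "set us \<subseteq> lattice n" "\<exists>I. wedges us I \<noteq> 0" "v \<notin> fv.span (set us)"
    "wnorm n (wedges (map (act m y) us)) \<le> 1"
    "\<forall>W\<in>T. W \<subseteq> fv.span (set us) \<or> (v \<in> W \<and> fv.span (set us) \<subseteq> W)"
    by (elim exE conjE) (rule that, (assumption | rule exI)+)
  define V where "V = fv.span (set (v # us))"
  have ind: "distinct us" "fv.independent (set us)"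
    using us(2) wedges_nonzero_imp_independent by blast+
  have "\<exists>I. wedges (v # us) I \<noteq> 0"
  proof (rule independent_imp_wedges_nonzero)
    show "fv.independent (set (v # us))" using ind(2) us(3) by (simp add: fv.independent_insertI)
    show "distinct (v # us)" using ind(1) us(3) fv.span_base by auto
    show "w i = 0" if "w \<in> set (v # us)" "n + 1 \<le> i" for w i
      using that us(1) v(1) by (auto simp: lattice_def)
  qed
  then have gen: "generates n (v # us) V"
    using us(1) v(1) by (auto simp: generates_def V_def)
  then have VS: "V \<in> subspaces" by (auto simp: subspaces_def)
  have cmp: "V \<subseteq> W \<or> W \<subseteq> V" if W: "W \<in> T" for W
  proof (cases "W \<subseteq> fv.span (set us)")
    case True
    also have "fv.span (set us) \<subseteq> V" unfolding V_def by (intro fv.span_mono) auto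
    finally show ?thesis by simp
  next
    case False
    then have vW: "v \<in> W" "fv.span (set us) \<subseteq> W" using us(5) W by auto
    have "W \<in> subspaces" using W T(1) by auto
    then have "W = fv.span (set (minimal_generators n W))"
      using subspaces_minimal_generators(1) generatesD(2) by blast
    then have "fv.subspace W" using fv.subspace_span by metis
    moreover have "set (v # us) \<subseteq> W" using vW fv.span_superset[of "set us"] by auto
    ultimately have "V \<subseteq> W" unfolding V_def by (intro fv.span_minimal)
    then show ?thesis by simp
  qed
  \<comment> \<open>The list \<open>v # us\<close> need not be primitive: passing to minimal
    generators divides the wedge product by \<open>c\<close>, which cannot increase its
    norm.\<close>
  obtain c where c: "1 \<le> fls_abs c" "\<forall>\<phi> I. flinear \<phi> \<longrightarrow>
      wedges (map \<phi> (v # us)) I = c * wedges (map \<phi> (minimal_generators n V)) I"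
    using minimal_generators[OF gen] by (elim exE conjE) (rule that)
  have "wedges (map (act m y) (v # us)) = (\<lambda>I. c * wedges (map (act m y) (minimal_generators n V)) I)"
    by (rule ext) (use c(2) flinear_act in blast)
  then have "fls_abs c * height m V y = wnorm n (wedges (map (act m y) (v # us)))"
    by (simp only: height_def wnorm_scale)
  also have "\<dots> \<le> b"
    unfolding list.map wedges.simps by (rule wnorm_wedge_le[OF us(4) b0 b(2)])
  also have "b < \<epsilon>" by (rule b(1)[of 0]) simp
  finally have less: "fls_abs c * height m V y < \<epsilon>" .
  have "0 \<le> height m V y"
    using fls_abs_le_wnorm[of "{}" n] fls_abs_nonneg unfolding height_def by (meson empty_subsetI order_trans)
  then have "1 * height m V y \<le> fls_abs c * height m V y" using c(1) by (intro mult_right_mono)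
  then have lt: "height m V y < \<epsilon>" using less by linarith
  show False
  proof (cases "V \<in> T")
    case True
    then show False using T(4) lt by auto
  next
    case False
    then have "1 \<le> height m V y" using T(5) VS cmp by blast
    then show False using lt \<epsilon>(2) by linarith
  qed
qed

lemma short_vector_set_small:
  assumes x: "x \<in> msupport M" "cb x j \<subseteq> U" and \<epsilon>: "0 < \<epsilon>" "\<epsilon> \<le> 1"
  shows "\<exists>m1. \<forall>m\<ge>m1. \<exists>A\<in>sets M. emeasure M A \<le> loss D (ennreal (C * \<epsilon> powr a)) (n + 2) * emeasure M (cb x j) \<and>
    (\<forall>y\<in>cb x j \<inter> msupport M - A. \<forall>v\<in>lattice n. v \<noteq> 0 \<longrightarrow> (\<exists>i\<le>n. \<epsilon> \<le> fls_abs (act m y v i)))"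
proof -
  obtain m1 where m1: "\<And>m V. m1 \<le> m \<Longrightarrow> V \<in> subspaces \<Longrightarrow> \<exists>y\<in>cb x j \<inter> msupport M. 1 \<le> height m V y"
    using height_ge_1_somewhere[OF x] by blast
  show ?thesis
  proof (intro exI[of _ m1] allI impI)
    fix m assume m: "m1 \<le> m"
    \<comment> \<open>Ranks are taken in \<open>{..n + 1}\<close>, a set of \<open>n + 2\<close>
      elements, which fixes the index of \<open>loss\<close>.\<close>
    have "\<exists>A\<in>sets M. A \<subseteq> cb x j \<and>
        emeasure M A \<le> loss D (ennreal (C * \<epsilon> powr a)) (n + 2) * emeasure M (cb x j) \<and>
        (\<forall>y\<in>cb x j \<inter> msupport M - A. marked (height m) (\<lambda>V W. V \<subseteq> W \<or> W \<subseteq> V) \<epsilon> subspaces y)"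
    proof (rule quantitative_nondivergence[where rk = "\<lambda>V. length (minimal_generators n V)"
          and R = "{..n + 1}" and ?B0.0 = U and ?S0.0 = subspaces])
      show "V = W" if "V \<in> subspaces" "W \<in> subspaces" "V \<subseteq> W \<or> W \<subseteq> V"
        "length (minimal_generators n V) = length (minimal_generators n W)" for V W
      proof -
        have "V = W" if "V \<in> subspaces" "W \<in> subspaces" "V \<subseteq> W"
          "length (minimal_generators n V) = length (minimal_generators n W)" for V W
          using span_eq_if_subset_length_eq[of "minimal_generators n V" "minimal_generators n W"]
            generatesD[OF subspaces_minimal_generators(1)[OF that(1)]]
            generatesD(2)[OF subspaces_minimal_generators(1)[OF that(2)]] that(3,4) by simp
        then show ?thesis using that by metis
      qed
      show "(\<lambda>V. length (minimal_generators n V)) ` subspaces \<subseteq> {..n + 1}"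
        using generates_length_le subspaces_minimal_generators(1) by fastforce
      show "emeasure M {y \<in> cb z i. height m V y < \<epsilon>} \<le> ennreal (C * \<epsilon> powr a) * emeasure M (cb z i)"
        if "z \<in> msupport M" "cb z i \<subseteq> U" "\<exists>y\<in>cb z i \<inter> msupport M. 1 \<le> height m V y" for V z i
        by (rule emeasure_height_less[OF that(1,2) \<epsilon>(1) that(3)])
    qed (use radon fed open_height_less x m1[OF m] in auto)
    then obtain A where A: "A \<in> sets M"
      "emeasure M A \<le> loss D (ennreal (C * \<epsilon> powr a)) (n + 2) * emeasure M (cb x j)"
      "\<forall>y\<in>cb x j \<inter> msupport M - A. marked (height m) (\<lambda>V W. V \<subseteq> W \<or> W \<subseteq> V) \<epsilon> subspaces y"
      by (elim bexE conjE) (rule that)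
    show "\<exists>A\<in>sets M. emeasure M A \<le> loss D (ennreal (C * \<epsilon> powr a)) (n + 2) * emeasure M (cb x j) \<and>
        (\<forall>y\<in>cb x j \<inter> msupport M - A. \<forall>v\<in>lattice n. v \<noteq> 0 \<longrightarrow> (\<exists>i\<le>n. \<epsilon> \<le> fls_abs (act m y v i)))"
    proof (intro bexI[of _ A] conjI ballI impI)
      fix y and v :: "nat \<Rightarrow> 'a fls" assume "y \<in> cb x j \<inter> msupport M - A" "v \<in> lattice n" "v \<noteq> 0"
      then show "\<exists>i\<le>n. \<epsilon> \<le> fls_abs (act m y v i)"
        using A(3) by (intro marked_imp_no_short_vector[OF _ \<epsilon>]) auto
    qed (rule A)+
  qed
qed

end

section \<open>Dirichlet improvable vectors\<close>

lemma federer_on_cb: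
  fixes M :: "('a::{field,finite} fls ^ 'd::finite) measure"
  assumes M: "radon_measure M" and fed: "federer_on U M"
  obtains D where "D > 0" "\<And>x j. x \<in> msupport M \<Longrightarrow> cb x (j + 1) \<subseteq> U \<Longrightarrow>
    emeasure M (cb x (j + 1)) \<le> ennreal D * emeasure M (cb x j)"
proof -
  obtain D where D: "D > 0" "\<forall>x\<in>msupport M. \<forall>r>0. fball x (3 * r) \<subseteq> U \<longrightarrow>
      measure M (fball x (3 * r)) / measure M (fball x r) \<le> D"
    using fed unfolding federer_on_def by (elim exE conjE) (rule that)
  have "emeasure M (cb x (j + 1)) \<le> ennreal D * emeasure M (cb x j)"
    if x: "x \<in> msupport M" "cb x (j + 1) \<subseteq> U" for x j
  proof -
    \<comment> \<open>tripling this radius raises the level of the ball by exactly one, as \<open>e < 63/20 < e\<^sup>2\<close>\<close>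
    define r where "r = 21 / 20 * exp (real_of_int j)"
    have e: "2 \<le> exp (1::real)" "exp (1::real) \<le> 3"
      using exp_ge_add_one_self[of "1::real"] exp_le by auto
    have pos: "0 < exp (real_of_int j)" by simp
    have ej: "exp (real_of_int (j + 1)) = exp 1 * exp (real_of_int j)"
      by (simp add: exp_add)
    have ej2: "exp (real_of_int (j + 1 + 1)) = exp 1 * (exp 1 * exp (real_of_int j))"
      by (simp only: exp_add[symmetric]) simp
    have "r \<le> 2 * exp (real_of_int j)" unfolding r_def by simp
    also have "\<dots> \<le> exp 1 * exp (real_of_int j)" using e(1) by (intro mult_right_mono) auto
    finally have r1: "fball x r = cb x j"
      by (intro fball_eq_cb) (simp_all only: ej, simp add: r_def)
    have lo: "exp (real_of_int (j + 1)) < 3 * r"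
    proof -
      have "exp (real_of_int (j + 1)) \<le> 3 * exp (real_of_int j)"
        unfolding ej using e(2) by (intro mult_right_mono) auto
      also have "\<dots> < 3 * r" by (simp add: r_def)
      finally show ?thesis .
    qed
    have hi: "3 * r \<le> exp (real_of_int (j + 1 + 1))"
    proof -
      have "3 * r \<le> 2 * (2 * exp (real_of_int j))" by (simp add: r_def)
      also have "\<dots> \<le> exp 1 * (exp 1 * exp (real_of_int j))"
        using e(1) by (intro mult_mono) auto
      finally show ?thesis unfolding ej2 .
    qed
    have r3: "fball x (3 * r) = cb x (j + 1)" by (rule fball_eq_cb[OF lo hi])
    have fin: "emeasure M (cb x i) = ennreal (measure M (cb x i))" for i
      using emeasure_cb_finite[OF M, of x i] by (simp add: emeasure_eq_ennreal_measure)
    \<comment> \<open>Positivity comes from \<open>x\<close> being in the support and makes the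
      quotient genuine; division by zero would give 0.\<close>
    have "0 < measure M (cb x j)"
      using emeasure_cb_pos[OF x(1), of j] unfolding fin by (simp add: ennreal_less_zero_iff)
    moreover have "measure M (cb x (j + 1)) / measure M (cb x j) \<le> D"
      using D(2)[rule_format, OF x(1), of r] x(2) unfolding r1 r3 by (simp add: r_def)
    ultimately have "measure M (cb x (j + 1)) \<le> D * measure M (cb x j)"
      by (simp add: pos_divide_le_eq)
    then show ?thesis
      unfolding fin using D(1) by (simp add: ennreal_mult[symmetric] ennreal_leI)
  qed
  then show ?thesis using D(1) that by auto
qed

text \<open>The supremum on the ball is at least the value at \<open>y\<close>, hence at least 1,
  and \<open>(\<epsilon> / s) powr a\<close> is at most \<open>\<epsilon> powr a\<close>. Balls have
  finite measure, so the real inequality transfers to \<open>emeasure\<close>.\<close>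

lemma good_fun_cb:
  fixes M :: "('a::{field,finite} fls ^ 'd::finite) measure"
  assumes M: "radon_measure M" and g: "good_fun C a U M g" "fls_continuous g"
    and pos: "C > 0" "a > 0" "\<epsilon> > 0"
    and x: "x \<in> msupport M" "cb x j \<subseteq> U" and y: "y \<in> cb x j \<inter> msupport M" "1 \<le> fls_abs (g y)"
  shows "emeasure M {y\<in>cb x j. fls_abs (g y) < \<epsilon>} \<le> ennreal (C * \<epsilon> powr a) * emeasure M (cb x j)"
proof -
  let ?A = "{y\<in>cb x j. fls_abs (g y) < \<epsilon>}"
  define s where "s = sup_on_supp M (cb x j) g"
  obtain b where "\<And>y. y \<in> cb x j \<Longrightarrow> fls_abs (g y) \<le> b"
    using fls_continuous_bounded_on_cb[OF g(2), of x j] by auto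
  then have "bdd_above ((\<lambda>y. fls_abs (g y)) ` (cb x j \<inter> msupport M))"
    by (intro bdd_aboveI2[of _ _ b]) auto
  then have "fls_abs (g y) \<le> s"
    unfolding s_def sup_on_supp_def using y(1) by (intro cSUP_upper)
  then have s: "1 \<le> s" using y(2) by linarith
  have "\<forall>r>0. \<forall>\<epsilon>>0. fball x r \<subseteq> U \<longrightarrow> sup_on_supp M (fball x r) g > 0 \<longrightarrow>
      measure M {y \<in> fball x r. fls_abs (g y) < \<epsilon>}
        \<le> C * (\<epsilon> / sup_on_supp M (fball x r) g) powr a * measure M (fball x r)"
    using g(1) x(1) unfolding good_fun_def by (rule bspec)
  from this[rule_format, of "exp (real_of_int (j + 1))" \<epsilon>]
  have "measure M ?A \<le> C * (\<epsilon> / s) powr a * measure M (cb x j)"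
    using x(2) s pos unfolding fball_exp_Suc s_def[symmetric] by simp
  also have "\<dots> \<le> C * \<epsilon> powr a * measure M (cb x j)"
  proof -
    have "\<epsilon> / s \<le> \<epsilon> / 1" using s pos by (intro divide_left_mono) auto
    then have "(\<epsilon> / s) powr a \<le> \<epsilon> powr a" using s pos by (intro powr_mono2) auto
    then show ?thesis using pos by (intro mult_right_mono mult_left_mono) auto
  qed
  finally have le: "measure M ?A \<le> C * \<epsilon> powr a * measure M (cb x j)" .
  have fin: "emeasure M (cb x j) < \<infinity>" by (rule emeasure_cb_finite[OF M])
  have "emeasure M ?A \<le> emeasure M (cb x j)"
    using radon_sets_open[OF M open_cb] by (intro emeasure_mono) auto
  then have "emeasure M ?A < \<infinity>" using fin by (rule le_less_trans)
  then have "emeasure M ?A = ennreal (measure M ?A)" by (simp add: emeasure_eq_ennreal_measure)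
  also have "\<dots> \<le> ennreal (C * \<epsilon> powr a * measure M (cb x j))" using le by (rule ennreal_leI)
  also have "\<dots> = ennreal (C * \<epsilon> powr a) * emeasure M (cb x j)"
    using fin pos by (simp add: emeasure_eq_ennreal_measure ennreal_mult)
  finally show ?thesis .
qed

section \<open>Monomials as a nondivergence system\<close>

lemma monomial_value_0 [simp]: "monomial_value 0 x = 1"
  by (simp add: monomial_value_def)

lemma monomial_enumeration:
  obtains e :: "nat \<Rightarrow> 'd::finite monomial" where "e 0 = 0"
    "bij_betw e {1..num_monomials k CARD('d)} (nonconstant_monomials k)"
proof -
  let ?N = "num_monomials k CARD('d)"
  obtain h :: "nat \<Rightarrow> 'd monomial" where h: "bij_betw h {0..<?N} (nonconstant_monomials k)"
    using ex_bij_betw_nat_finite[OF nonconstant_monomials(1)[of k, where 'd = 'd]]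
    unfolding nonconstant_monomials(2) by auto
  have "bij_betw (\<lambda>i. i - 1) {1..?N} {0..<?N}"
    by (rule bij_betwI[where g = Suc]) auto
  from bij_betw_trans[OF this h] have "bij_betw (\<lambda>i. h (i - 1)) {1..?N} (nonconstant_monomials k)"
    by (simp add: comp_def)
  then have "bij_betw (\<lambda>i. if i = 0 then 0 else h (i - 1)) {1..?N} (nonconstant_monomials k)"
    by (subst bij_betw_cong[where g = "\<lambda>i. h (i - 1)"]) auto
  then show ?thesis by (intro that[of "\<lambda>i. if i = 0 then 0 else h (i - 1)"]) auto
qed

text \<open>\<open>g\<close> sees both index and monomial: coefficients are indexed by numbers in
  \<open>nondivergence_system\<close> but by monomials in \<open>good_map\<close> and
  \<open>nonplanar\<close>.\<close>

lemma sum_monomials_enumerated: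
  fixes e :: "nat \<Rightarrow> 'd::finite monomial" and N :: nat
  assumes "e 0 = 0" "bij_betw e {1..N} (nonconstant_monomials k)"
  shows "(\<Sum>i\<le>N. g i (e i)) = g 0 0 + (\<Sum>\<alpha>\<in>nonconstant_monomials k. g (the_inv_into {1..N} e \<alpha>) \<alpha>)"
proof -
  have "{..N} = insert 0 {1..N}" by auto
  then have "(\<Sum>i\<le>N. g i (e i)) = g 0 0 + (\<Sum>i\<in>{1..N}. g i (e i))"
    using assms(1) by simp
  also have "(\<Sum>i\<in>{1..N}. g i (e i)) = (\<Sum>i\<in>{1..N}. g (the_inv_into {1..N} e (e i)) (e i))"
    using assms(2) by (intro sum.cong) (auto simp: bij_betw_def the_inv_into_f_f)
  also have "\<dots> = (\<Sum>\<alpha>\<in>nonconstant_monomials k. g (the_inv_into {1..N} e \<alpha>) \<alpha>)"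
    by (rule sum.reindex_bij_betw[OF assms(2)])
  finally show ?thesis .
qed

lemma friendly_nondivergence_system:
  fixes M :: "('a::{field,finite} fls ^ 'd::finite) measure"
  assumes M: "radon_measure M" and fr: "friendly_on k U M"
    and e: "e 0 = 0" "bij_betw e {1..num_monomials k CARD('d)} (nonconstant_monomials k)"
  obtains D C a where "0 < C" "0 < a"
    "nondivergence_system M U (num_monomials k CARD('d)) (\<lambda>i. monomial_value (e i)) (ennreal D) C a"
proof -
  let ?N = "num_monomials k CARD('d)"
  obtain D where D: "D > 0" "\<And>x j. x \<in> msupport M \<Longrightarrow> cb x (j + 1) \<subseteq> U \<Longrightarrow>
      emeasure M (cb x (j + 1)) \<le> ennreal D * emeasure M (cb x j)"
    using federer_on_cb[OF M] fr unfolding friendly_on_def by blast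
  obtain C a where C: "C > 0" "a > 0" "good_map C a U M (nonconstant_monomials k) monomial_value"
    using fr unfolding friendly_on_def by blast
  have np: "nonplanar U M (nonconstant_monomials k) monomial_value"
    using fr unfolding friendly_on_def by blast
  have eq: "(\<Sum>i\<le>?N. c i * monomial_value (e i) y) = c 0 +
      (\<Sum>\<alpha>\<in>nonconstant_monomials k. c (the_inv_into {1..?N} e \<alpha>) * monomial_value \<alpha> y)"
    for c and y :: "'a fls ^ 'd"
    using sum_monomials_enumerated[OF e, of "\<lambda>i \<alpha>. c i * monomial_value \<alpha> y"] by simp
  have "nondivergence_system M U ?N (\<lambda>i. monomial_value (e i)) (ennreal D) C a"
  proof
    fix c :: "nat \<Rightarrow> 'a fls" and x j and \<epsilon> :: real
    assume x: "x \<in> msupport M" "cb x j \<subseteq> U" and \<epsilon>: "0 < \<epsilon>"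
      and "\<exists>y\<in>cb x j \<inter> msupport M. 1 \<le> fls_abs (\<Sum>i\<le>?N. c i * monomial_value (e i) y)"
    then obtain y where y: "y \<in> cb x j \<inter> msupport M"
      "1 \<le> fls_abs (\<Sum>i\<le>?N. c i * monomial_value (e i) y)" by auto
    have "good_fun C a U M (\<lambda>y. \<Sum>i\<le>?N. c i * monomial_value (e i) y)"
      unfolding eq using C(3) unfolding good_map_def by (elim allE)
    moreover have "fls_continuous (\<lambda>y. \<Sum>i\<le>?N. c i * monomial_value (e i) y)"
      by (intro fls_continuous_sum fls_continuous_mult fls_continuous_const fls_continuous_monomial_value)
    ultimately show "emeasure M {y \<in> cb x j. fls_abs (\<Sum>i\<le>?N. c i * monomial_value (e i) y) < \<epsilon>}
        \<le> ennreal (C * \<epsilon> powr a) * emeasure M (cb x j)"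
      using C(1,2) \<epsilon> x y by (rule good_fun_cb[OF M])
  next
    fix c :: "nat \<Rightarrow> 'a fls" and x j
    assume x: "x \<in> msupport M" "cb x j \<subseteq> U"
      and z: "\<forall>y\<in>cb x j \<inter> msupport M. (\<Sum>i\<le>?N. c i * monomial_value (e i) y) = 0"
    have "\<forall>c0 c. (\<forall>y\<in>cb x j \<inter> msupport M. c0 + (\<Sum>\<alpha>\<in>nonconstant_monomials k. c \<alpha> * monomial_value \<alpha> y) = 0)
        \<longrightarrow> c0 = 0 \<and> (\<forall>\<alpha>\<in>nonconstant_monomials k. c \<alpha> = 0)"
    proof -
      have "\<forall>r>0. fball x r \<subseteq> U \<longrightarrow> (\<forall>c0 c. (\<forall>y\<in>fball x r \<inter> msupport M.
          c0 + (\<Sum>\<alpha>\<in>nonconstant_monomials k. c \<alpha> * monomial_value \<alpha> y) = 0) \<longrightarrow>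
          c0 = 0 \<and> (\<forall>\<alpha>\<in>nonconstant_monomials k. c \<alpha> = 0))"
        using np x(1) unfolding nonplanar_def by (rule bspec)
      \<comment> \<open>\<open>cb x j\<close> is the open ball of radius \<open>exp (j + 1)\<close>,
        hence the shift.\<close>
      from this[THEN spec, of "exp (real_of_int (j + 1))"] show ?thesis
        using x(2) unfolding fball_exp_Suc by (simp only: exp_gt_zero simp_thms)
    qed
    from this[rule_format, of "c 0" "\<lambda>\<alpha>. c (the_inv_into {1..?N} e \<alpha>)"]
    have c: "c 0 = 0" "\<forall>\<alpha>\<in>nonconstant_monomials k. c (the_inv_into {1..?N} e \<alpha>) = 0"
      using z unfolding eq by simp_all
    show "\<forall>i\<in>{..?N}. c i = 0"
    proof
      fix i assume "i \<in> {..?N}"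
      then consider "i = 0" | "i \<in> {1..?N}" by fastforce
      then show "c i = 0"
      proof cases
        case 2
        then have "e i \<in> nonconstant_monomials k" "the_inv_into {1..?N} e (e i) = i"
          using e(2) by (auto simp: bij_betw_def the_inv_into_f_f)
        then show ?thesis using c(2) by metis
      qed (use c(1) in simp)
    qed
  qed (use M D e(1) in auto)
  then show ?thesis using C that by blast
qed

section \<open>Vectors improved at a given time\<close>

definition improved_at :: "nat \<Rightarrow> real \<Rightarrow> nat \<Rightarrow> ('a::field fls ^ 'd::finite) set" where
  "improved_at k \<epsilon> m = {x. \<exists>P :: ('a, 'd) Lambda_mpoly. P \<noteq> 0 \<and> total_degree P \<le> k \<and>
     fls_abs (mpoly_value P x) < \<epsilon> * exp (- (real m * real (num_monomials k CARD('d)))) \<and>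
     height_nc P < \<epsilon> * exp (real m)}"

lemma DI_eq: "DI k \<epsilon> = (\<Union>m0. \<Inter>m\<in>{m0..}. improved_at k \<epsilon> m)"
  by (auto simp: DI_def dirichlet_improvable_def improved_at_def)

text \<open>A union of open sets over polynomials is open however many polynomials occur. This makes
  \<open>DI\<close> Borel, as a countable union of countable intersections.\<close>

lemma open_improved_at: "open (improved_at k \<epsilon> m :: ('a::field fls ^ 'd::finite) set)"
proof -
  have "improved_at k \<epsilon> m = (\<Union>P\<in>{P :: ('a, 'd) Lambda_mpoly. P \<noteq> 0 \<and> total_degree P \<le> k \<and>
      height_nc P < \<epsilon> * exp (real m)}.
      {x. fls_abs (mpoly_value P x) < \<epsilon> * exp (- (real m * real (num_monomials k CARD('d))))})"
    by (auto simp: improved_at_def)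
  then show ?thesis by (auto intro!: open_fls_abs_less)
qed

lemma DI_borel: "(DI k \<epsilon> :: ('a::field fls ^ 'd::finite) set) \<in> sets borel"
  unfolding DI_eq
  by (intro sets.countable_UN sets.countable_INT' image_subsetI borel_open open_improved_at) auto

text \<open>The coefficient vector of \<open>P\<close> is short after the flow. The degree bound
  puts every key among the enumerated monomials, so \<open>P \<noteq> 0\<close> makes the vector
  nonzero; coordinate 0 of \<open>act\<close> is the scaled value at \<open>x\<close>, and the
  others are scaled coefficients.\<close>

lemma improved_at_imp_short_vector:
  fixes x :: "'a::{field,finite} fls ^ 'd::finite" and M :: "('a fls ^ 'd) measure"
  assumes "x \<in> improved_at k \<epsilon> m"
    and e: "e 0 = 0" "bij_betw e {1..num_monomials k CARD('d)} (nonconstant_monomials k)"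
    and sys: "nondivergence_system M U (num_monomials k CARD('d)) (\<lambda>i. monomial_value (e i)) D C a"
  shows "\<exists>v\<in>lattice (num_monomials k CARD('d)). v \<noteq> 0 \<and> (\<forall>i\<le>num_monomials k CARD('d).
    fls_abs (nondivergence_system.act (num_monomials k CARD('d)) (\<lambda>i. monomial_value (e i)) m x v i) < \<epsilon>)"
proof -
  let ?N = "num_monomials k CARD('d)"
  interpret S: nondivergence_system M U ?N "\<lambda>i. monomial_value (e i)" D C a by (rule sys)
  obtain P :: "('a, 'd) Lambda_mpoly" where P: "P \<noteq> 0" "total_degree P \<le> k"
    "fls_abs (mpoly_value P x) < \<epsilon> * exp (- (real m * real ?N))" "height_nc P < \<epsilon> * exp (real m)"
    using assms(1) unfolding improved_at_def by auto
  have keys: "Poly_Mapping.keys P \<subseteq> insert 0 (nonconstant_monomials k)"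
  proof
    fix \<alpha> assume "\<alpha> \<in> Poly_Mapping.keys P"
    then have "monomial_degree \<alpha> \<le> total_degree P" unfolding total_degree_def by (intro Max_ge) auto
    then show "\<alpha> \<in> insert 0 (nonconstant_monomials k)"
      using P(2) unfolding nonconstant_monomials(3)[symmetric] by simp
  qed
  define v where "v = (\<lambda>i. if i \<le> ?N then of_Lambda (Poly_Mapping.lookup P (e i)) else 0)"
  have "v \<in> lattice ?N"
    by (auto simp: lattice_def v_def intro: range_of_Lambda_closed(1))
  moreover have "v \<noteq> 0"
  proof
    assume v0: "v = 0"
    have z: "Poly_Mapping.lookup P (e i) = 0" if "i \<le> ?N" for i
      using fun_cong[OF v0, of i] that by (simp add: v_def)
    have img: "e ` {..?N} = insert 0 (nonconstant_monomials k)"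
    proof -
      have "{..?N} = insert 0 {1..?N}" by auto
      then have "e ` {..?N} = insert (e 0) (e ` {1..?N})" by (simp only: image_insert)
      then show ?thesis using e by (simp add: bij_betw_def)
    qed
    have "\<alpha> \<notin> Poly_Mapping.keys P" for \<alpha>
    proof
      assume \<alpha>: "\<alpha> \<in> Poly_Mapping.keys P"
      then have "\<alpha> \<in> e ` {..?N}" unfolding img using keys by (rule subsetD[rotated])
      then obtain i where "i \<le> ?N" "\<alpha> = e i" by auto
      then show False using z[of i] \<alpha> by (simp add: in_keys_iff)
    qed
    then have "Poly_Mapping.keys P = {}" by blast
    then show False using P(1) by simp
  qed
  moreover have "fls_abs (S.act m x v i) < \<epsilon>" if i: "i \<le> ?N" for i
  proof (cases "i = 0")
    case True
    have "(\<Sum>j\<le>?N. monomial_value (e j) x * v j) =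
        (\<Sum>j\<le>?N. of_Lambda (Poly_Mapping.lookup P (e j)) * monomial_value (e j) x)"
      by (intro sum.cong) (auto simp: v_def)
    also have "\<dots> = (\<Sum>\<alpha>\<in>insert 0 (nonconstant_monomials k).
        of_Lambda (Poly_Mapping.lookup P \<alpha>) * monomial_value \<alpha> x)"
      using nonconstant_monomials(1)[of k, where 'd = 'd]
      by (subst sum_monomials_enumerated[OF e, of "\<lambda>i \<alpha>. of_Lambda (Poly_Mapping.lookup P \<alpha>) * monomial_value \<alpha> x"],
          subst sum.insert) (auto simp: nonconstant_monomials_def)
    also have "\<dots> = mpoly_value P x"
      unfolding mpoly_value_def using keys nonconstant_monomials(1)[of k, where 'd = 'd]
      by (intro sum.mono_neutral_right) (auto simp: in_keys_iff)
    finally have "S.act m x v 0 = fls_X_inv ^ (m * ?N) * mpoly_value P x"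
      by (simp add: S.act_def S.flow_def)
    then have "fls_abs (S.act m x v 0) = exp (real m * real ?N) * fls_abs (mpoly_value P x)"
      by (simp add: fls_abs_mult fls_abs_power exp_of_nat_mult[symmetric])
    also have "\<dots> < exp (real m * real ?N) * (\<epsilon> * exp (- (real m * real ?N)))"
      using P(3) by simp
    also have "\<dots> = \<epsilon>" by (simp add: exp_minus)
    finally show ?thesis using True by simp
  next
    case False
    \<comment> \<open>\<open>height_nc\<close> is nonnegative, so its strict upper bound is
      positive; this covers the coefficients that vanish.\<close>
    have \<epsilon>0: "0 < \<epsilon> * exp (real m)"
    proof -
      have "0 \<le> height_nc P" unfolding height_nc_def by (intro Max_ge) auto
      then show ?thesis using P(4) by linarith
    qed
    have "fls_abs (v i) < \<epsilon> * exp (real m)"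
    proof (cases "Poly_Mapping.lookup P (e i) = 0")
      case True
      then show ?thesis using \<epsilon>0 i by (simp add: v_def)
    next
      case nz: False
      have "e i \<in> nonconstant_monomials k" using e(2) i False by (auto simp: bij_betw_def)
      then have "e i \<noteq> 0" by (auto simp: nonconstant_monomials_def)
      then have "fls_abs (of_Lambda (Poly_Mapping.lookup P (e i))) \<le> height_nc P"
        unfolding height_nc_def using nz by (intro Max_ge) (auto simp: in_keys_iff)
      then show ?thesis using P(4) i by (simp add: v_def)
    qed
    then have "exp (- real m) * fls_abs (v i) < exp (- real m) * (\<epsilon> * exp (real m))" by simp
    also have "\<dots> = \<epsilon>" by (simp add: exp_minus)
    also have "exp (- real m) * fls_abs (v i) = fls_abs (S.act m x v i)"
      using False by (simp add: S.act_def S.flow_def fls_abs_mult fls_abs_power exp_of_nat_mult[symmetric])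
    finally show ?thesis .
  qed
  ultimately show ?thesis by blast
qed

text \<open>Linearity separates a constant depending on \<open>D\<close> and \<open>n\<close> from
  the factor \<open>C * \<epsilon> powr a\<close>, which tends to 0 with \<epsilon>.\<close>

lemma loss_linear: "loss D \<delta> n = \<delta> * loss D 1 n"
  by (induction n) (simp_all add: algebra_simps)

lemma loss_finite: "loss (ennreal D) 1 n < \<infinity>"
  by (induction n) (auto simp: ennreal_mult_less_top)

lemma exists_small_loss:
  assumes "0 < C" "0 < a"
  shows "\<exists>\<epsilon>0>0. \<epsilon>0 \<le> 1 \<and> (\<forall>\<epsilon>. 0 < \<epsilon> \<and> \<epsilon> < \<epsilon>0 \<longrightarrow>
    loss (ennreal D) (ennreal (C * \<epsilon> powr a)) n \<le> ennreal (1/2))"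
proof -
  define g where "g = enn2real (loss (ennreal D) 1 n)"
  have g: "loss (ennreal D) 1 n = ennreal g" "0 \<le> g"
    unfolding g_def using loss_finite[of D n] by simp_all
  \<comment> \<open>Chosen so that \<open>C * b * (g + 1) = 1/2\<close>; adding 1 keeps the
    denominator positive when \<open>g = 0\<close>.\<close>
  define b where "b = 1 / (2 * C * (g + 1))"
  have b: "0 < b" using assms g(2) by (simp add: b_def)
  have "loss (ennreal D) (ennreal (C * \<epsilon> powr a)) n \<le> ennreal (1/2)"
    if "0 < \<epsilon>" "\<epsilon> < min 1 (b powr (1 / a))" for \<epsilon>
  proof -
    have "\<epsilon> powr a \<le> (b powr (1 / a)) powr a" using that assms by (intro powr_mono2) auto
    also have "\<dots> = b" using assms b by (simp add: powr_powr)
    finally have "C * \<epsilon> powr a * g \<le> C * b * (g + 1)"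
      using assms g(2) b by (intro mult_mono) auto
    also have "\<dots> = 1/2"
    proof -
      have "C * (g + 1) \<noteq> 0" using assms g(2) by simp
      then show ?thesis by (simp add: b_def mult.assoc)
    qed
    finally have "C * \<epsilon> powr a * g \<le> 1/2" .
    moreover have "loss (ennreal D) (ennreal (C * \<epsilon> powr a)) n = ennreal (C * \<epsilon> powr a * g)"
      using assms g by (subst loss_linear) (simp add: ennreal_mult)
    ultimately show ?thesis by (simp only: ennreal_leI)
  qed
  then show ?thesis using b by (intro exI[of _ "min 1 (b powr (1 / a))"]) auto
qed

text \<open>Points of \<open>E m0\<close> are improved at all times from \<open>m0\<close> on, in
  particular at \<open>max m0 m1\<close>, where the proportion is at most 1/2. The time
  \<open>m1\<close> varies with the ball, but the increasing sets \<open>E m0\<close> exhaust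
  \<open>DI k \<epsilon>\<close> in the ball, which inherits the bound.\<close>

lemma DI_null:
  fixes U :: "('a::{field,finite} fls ^ 'd::finite) set"
  assumes U: "open U" and M: "radon_measure M" and fr: "friendly_on k U M"
  shows "\<exists>\<epsilon>0>0. \<forall>\<epsilon>. 0 < \<epsilon> \<and> \<epsilon> < \<epsilon>0 \<longrightarrow> DI k \<epsilon> \<inter> U \<in> null_sets M"
proof -
  let ?N = "num_monomials k CARD('d)"
  obtain e :: "nat \<Rightarrow> 'd monomial" where e: "e 0 = 0" "bij_betw e {1..?N} (nonconstant_monomials k)"
    by (rule monomial_enumeration)
  obtain D C a where pos: "0 < C" "0 < a"
    and sys: "nondivergence_system M U ?N (\<lambda>i. monomial_value (e i)) (ennreal D) C a"
    by (rule friendly_nondivergence_system[OF M fr e])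
  interpret S: nondivergence_system M U ?N "\<lambda>i. monomial_value (e i)" "ennreal D" C a by (rule sys)
  from exists_small_loss[OF pos, of D "?N + 2"]
  obtain \<epsilon>0 where *: "0 < \<epsilon>0 \<and> \<epsilon>0 \<le> 1 \<and> (\<forall>\<epsilon>. 0 < \<epsilon> \<and> \<epsilon> < \<epsilon>0 \<longrightarrow>
      loss (ennreal D) (ennreal (C * \<epsilon> powr a)) (?N + 2) \<le> ennreal (1/2))"
    by (rule exE)
  note \<epsilon>0 = *[THEN conjunct1] *[THEN conjunct2, THEN conjunct1] *[THEN conjunct2, THEN conjunct2]
  have null: "DI k \<epsilon> \<inter> U \<in> null_sets M" if \<epsilon>: "0 < \<epsilon>" "\<epsilon> < \<epsilon>0" for \<epsilon>
  proof (rule null_set_if_half_in_balls[OF M U])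
    show "DI k \<epsilon> \<inter> U \<in> sets M"
      unfolding radon_measureD(1)[OF M] by (intro sets.Int DI_borel borel_open U)
    fix x j assume x: "x \<in> msupport M" "cb x j \<subseteq> U"
    define E where "E = (\<lambda>m0. (\<Inter>m\<in>{m0..}. improved_at k \<epsilon> m) \<inter> cb x j)"
    have E_sets: "E m0 \<in> sets M" for m0
    proof -
      have "(\<Inter>m\<in>{m0..}. improved_at k \<epsilon> m :: ('a fls ^ 'd) set) \<in> sets borel"
        by (intro sets.countable_INT' image_subsetI borel_open open_improved_at) auto
      then show ?thesis unfolding E_def radon_measureD(1)[OF M] by (intro sets.Int) auto
    qed
    from S.short_vector_set_small[OF x \<epsilon>(1) order_trans[OF less_imp_le[OF \<epsilon>(2)] \<epsilon>0(2)]]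
    obtain m1 where m1: "\<forall>m\<ge>m1. \<exists>A\<in>sets M.
        emeasure M A \<le> loss (ennreal D) (ennreal (C * \<epsilon> powr a)) (?N + 2) * emeasure M (cb x j) \<and>
        (\<forall>y\<in>cb x j \<inter> msupport M - A. \<forall>v\<in>lattice ?N. v \<noteq> 0 \<longrightarrow> (\<exists>i\<le>?N. \<epsilon> \<le> fls_abs (S.act m y v i)))"
      by (rule exE)
    have "emeasure M (E m0) \<le> ennreal (1/2) * emeasure M (cb x j)" for m0
    proof -
      define m where "m = max m0 m1"
      obtain A where A: "A \<in> sets M"
        "emeasure M A \<le> loss (ennreal D) (ennreal (C * \<epsilon> powr a)) (?N + 2) * emeasure M (cb x j)"
        "\<forall>y\<in>cb x j \<inter> msupport M - A. \<forall>v\<in>lattice ?N. v \<noteq> 0 \<longrightarrow> (\<exists>i\<le>?N. \<epsilon> \<le> fls_abs (S.act m y v i))"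
      proof -
        have "m1 \<le> m" by (simp add: m_def)
        from m1[THEN spec, THEN mp, OF this] show ?thesis by (elim bexE conjE) (rule that)
      qed
      have "E m0 \<subseteq> A \<union> (- msupport M)"
      proof
        fix y assume y: "y \<in> E m0"
        then have "y \<in> improved_at k \<epsilon> m" by (auto simp: E_def m_def)
        from improved_at_imp_short_vector[OF this e sys]
        obtain v where v: "v \<in> lattice ?N" "v \<noteq> 0" "\<forall>i\<le>?N. fls_abs (S.act m y v i) < \<epsilon>" by auto
        show "y \<in> A \<union> (- msupport M)"
        proof (rule ccontr)
          assume "y \<notin> A \<union> (- msupport M)"
          then have "y \<in> cb x j \<inter> msupport M - A" using y by (auto simp: E_def)
          from A(3)[rule_format, OF this v(1,2)] show False using v(3) by (auto simp: not_le[symmetric])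
        qed
      qed
      then have "emeasure M (E m0) \<le> emeasure M (A \<union> (- msupport M))"
        using A(1) null_sets_compl_msupport[OF M] by (intro emeasure_mono) auto
      also have "\<dots> = emeasure M A"
        by (rule emeasure_Un_null_set[OF A(1) null_sets_compl_msupport[OF M]])
      also have "\<dots> \<le> loss (ennreal D) (ennreal (C * \<epsilon> powr a)) (?N + 2) * emeasure M (cb x j)" by (rule A(2))
      also have "\<dots> \<le> ennreal (1/2) * emeasure M (cb x j)"
        using \<epsilon>0(3) \<epsilon> by (intro mult_right_mono) auto
      finally show ?thesis .
    qed
    then have "(SUP m0. emeasure M (E m0)) \<le> ennreal (1/2) * emeasure M (cb x j)" by (rule SUP_least)
    moreover have "(SUP m0. emeasure M (E m0)) = emeasure M (\<Union>m0. E m0)"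
    proof (rule SUP_emeasure_incseq)
      show "incseq E" by (rule monoI) (force simp: E_def)
    qed (use E_sets in auto)
    moreover have "(DI k \<epsilon> \<inter> U) \<inter> cb x j = (\<Union>m0. E m0)"
      using x(2) unfolding DI_eq E_def by auto
    ultimately show "emeasure M (DI k \<epsilon> \<inter> U \<inter> cb x j) \<le> ennreal (1/2) * emeasure M (cb x j)" by simp
  qed simp
  show ?thesis using \<epsilon>0(1) null by (intro exI[of _ \<epsilon>0]) simp
qed

lemma dirichlet_improvable_mono:
  assumes "dirichlet_improvable k \<epsilon> x" "\<epsilon> \<le> \<epsilon>'"
  shows "dirichlet_improvable k \<epsilon>' x"
proof -
  have "\<epsilon> * exp t \<le> \<epsilon>' * exp t" for t :: real using assms(2) by simp
  then show ?thesis using assms(1) unfolding dirichlet_improvable_def by (meson less_le_trans)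
qed

text \<open>The values \<open>1 / (real n + 3)\<close> are admissible because
  \<open>exp 1 \<le> 3\<close>, and they tend to 0; monotonicity in \<epsilon> reduces all cases to
  them. The countable intersection gives measurability.\<close>

lemma singular_vector_eq:
  "{x. singular_vector k x} = (\<Inter>n. DI k (1 / (real n + 3)))"
proof safe
  fix x :: "'a fls ^ 'd" and n
  assume "singular_vector k x"
  moreover have "1 / (real n + 3) \<le> 1 / exp 1"
    using exp_le by (intro divide_left_mono) auto
  ultimately show "x \<in> DI k (1 / (real n + 3))"
    unfolding singular_vector_def DI_def by simp
next
  fix x :: "'a fls ^ 'd"
  assume x: "x \<in> (\<Inter>n. DI k (1 / (real n + 3)))"
  show "singular_vector k x"
    unfolding singular_vector_def
  proof (intro allI impI)
    fix \<epsilon> :: real assume "0 < \<epsilon> \<and> \<epsilon> \<le> 1 / exp 1"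
    then obtain n where n: "1 / \<epsilon> < real n" using reals_Archimedean2 by auto
    have "1 / (real n + 3) \<le> \<epsilon>"
      using n \<open>0 < \<epsilon> \<and> \<epsilon> \<le> 1 / exp 1\<close> by (simp add: field_simps add_pos_pos)
    then show "dirichlet_improvable k \<epsilon> x"
      using x dirichlet_improvable_mono unfolding DI_def by blast
  qed
qed

theorem theorem2p5:
  fixes k :: nat
    and U :: "('a::{field,finite} fls ^ 'd::finite) set"
    and \<mu> :: "('a fls ^ 'd) measure"
  assumes "open U"
    and "radon_measure \<mu>"
    and "emeasure \<mu> U > 0"
    and "friendly_on k U \<mu>"
  shows "(\<exists>\<epsilon>0>0. \<forall>\<epsilon>. 0 < \<epsilon> \<and> \<epsilon> < \<epsilon>0 \<longrightarrow> DI k \<epsilon> \<inter> U \<in> null_sets \<mu>) \<and>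
         {x. singular_vector k x} \<inter> U \<in> null_sets \<mu>"
proof -
  obtain \<epsilon>0 where \<epsilon>0: "0 < \<epsilon>0" "\<forall>\<epsilon>. 0 < \<epsilon> \<and> \<epsilon> < \<epsilon>0 \<longrightarrow> DI k \<epsilon> \<inter> U \<in> null_sets \<mu>"
    using DI_null[OF assms(1,2,4)] by (elim exE conjE) (rule that)
  obtain n where n: "1 / \<epsilon>0 < real n" using reals_Archimedean2 by auto
  then have "1 / (real n + 3) < \<epsilon>0"
    using \<epsilon>0(1) by (simp add: field_simps add_pos_pos)
  then have "DI k (1 / (real n + 3)) \<inter> U \<in> null_sets \<mu>" using \<epsilon>0(2) by simp
  moreover have "{x. singular_vector k x} \<inter> U \<in> sets \<mu>"
    unfolding singular_vector_eq radon_measureD(1)[OF assms(2)]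
    using assms(1) by (intro sets.Int sets.countable_INT image_subsetI) (auto simp: DI_borel)
  moreover have "{x. singular_vector k x} \<inter> U \<subseteq> DI k (1 / (real n + 3)) \<inter> U"
    unfolding singular_vector_eq by auto
  ultimately have "{x. singular_vector k x} \<inter> U \<in> null_sets \<mu>" by (rule null_sets_subset)
  then show ?thesis using \<epsilon>0 by (intro conjI exI[of _ \<epsilon>0])
qed

end
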